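(* Let $R$ be a commutative ring. Suppose that $\mathcal C$ and $\mathcal D$ are finite categories whose idempotent completions are equivalent. Then $\mathcal C$ and $\mathcal D$ are isomorphic in the biset category $\mathbb B=\mathbb B_R$.
   Context: The idempotent completion of a finite category $\mathcal C$ is the category $\bar{\mathcal C}$ whose objects are the idempotent endomorphisms in $\mathcal C$, with $\mathrm{Hom}_{\bar{\mathcal C}}(e,f)=f\cdot\mathrm{Hom}_{\mathcal C}(x,y)\cdot e$ for idempotents $e\in\mathrm{End}_{\mathcal C}(x)$, $f\in\mathrm{End}_{\mathcal C}(y)$. $\mathrm{Set}$ is the category of finite sets. A $(\mathcal C,\mathcal D)$-biset is a functor $\Omega:\mathcal C\times\mathcal D^{\mathrm{op}}\to\mathrm{Set}$. The composite of a $(\mathcal C,\mathcal D)$-biset $\Omega$ and a $(\mathcal D,\mathcal E)$-biset $\Psi$ is $(\Omega\circ\Psi)(x,z)=\left(\bigsqcup_{y}\Omega(x,y)\times\Psi(y,z)\right)/\sim$, with $\sim$ generated by $(u\beta,v)\sim(u,\beta v)$ for morphisms $\beta$ of $\mathcal D$. $\mathbb B_R$ has finite categories as objects; $\mathrm{Hom}_{\mathbb B_R}(\mathcal C,\mathcal D)$ is $R\otimes_{\mathbb Z}$ of the Grothendieck group of finite $(\mathcal D,\mathcal C)$-bisets with respect to disjoint union, and composition is the $R$-bilinear extension of $\circ$. The identity of $\mathcal C$ is the biset $(x,y)\mapsto\mathrm{Hom}_{\mathcal C}(y,x)$. *)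

theory Defs
  imports "HOL-Algebra.Free_Abelian_Groups" "HOL-Algebra.Generated_Groups" "HOL-Algebra.Ring"
begin

section \<open>Categories, functors, equivalences\<close>

record ('o, 'm) cat =
  Ob :: "'o set"
  Arr :: "'m set"
  Dom :: "'m \<Rightarrow> 'o"
  Cod :: "'m \<Rightarrow> 'o"
  Ident :: "'o \<Rightarrow> 'm"
  Comp :: "'m \<Rightarrow> 'm \<Rightarrow> 'm" (infixl \<open>\<cdot>\<index>\<close> 70)
    \<comment> \<open>\<open>g \<cdot> f\<close> is "\<open>g\<close> after \<open>f\<close>"; only meaningful if \<open>Cod f = Dom g\<close>\<close>

definition hom_set :: "('o, 'm) cat \<Rightarrow> 'o \<Rightarrow> 'o \<Rightarrow> 'm set" where
  "hom_set C x y = {f \<in> Arr C. Dom C f = x \<and> Cod C f = y}"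

locale category =
  fixes C :: "('o, 'm) cat" (structure)
  assumes Dom_in_Ob: "f \<in> Arr C \<Longrightarrow> Dom C f \<in> Ob C"
    and Cod_in_Ob: "f \<in> Arr C \<Longrightarrow> Cod C f \<in> Ob C"
    and Ident_in_hom: "x \<in> Ob C \<Longrightarrow> Ident C x \<in> hom_set C x x"
    and Comp_in_hom: "f \<in> hom_set C x y \<Longrightarrow> g \<in> hom_set C y z \<Longrightarrow> g \<cdot> f \<in> hom_set C x z"
    and Comp_assoc: "f \<in> hom_set C w x \<Longrightarrow> g \<in> hom_set C x y \<Longrightarrow> h \<in> hom_set C y z
          \<Longrightarrow> (h \<cdot> g) \<cdot> f = h \<cdot> (g \<cdot> f)"
    and Comp_Ident: "f \<in> hom_set C x y \<Longrightarrow> f \<cdot> Ident C x = f"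
    and Ident_Comp: "f \<in> hom_set C x y \<Longrightarrow> Ident C y \<cdot> f = f"

locale finite_category = category +
  assumes finite_Ob: "finite (Ob C)"
    and finite_Arr: "finite (Arr C)"

definition op_cat :: "('o, 'm) cat \<Rightarrow> ('o, 'm) cat" where
  "op_cat C = \<lparr>Ob = Ob C, Arr = Arr C, Dom = Cod C, Cod = Dom C, Ident = Ident C,
     Comp = (\<lambda>g f. f \<cdot>\<^bsub>C\<^esub> g)\<rparr>"

definition prod_cat :: "('o, 'm) cat \<Rightarrow> ('p, 'n) cat \<Rightarrow> ('o \<times> 'p, 'm \<times> 'n) cat" where
  "prod_cat C D = \<lparr>Ob = Ob C \<times> Ob D, Arr = Arr C \<times> Arr D,
     Dom = map_prod (Dom C) (Dom D), Cod = map_prod (Cod C) (Cod D),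
     Ident = map_prod (Ident C) (Ident D),
     Comp = (\<lambda>(g, g') (f, f'). (g \<cdot>\<^bsub>C\<^esub> f, g' \<cdot>\<^bsub>D\<^esub> f'))\<rparr>"

text \<open>
  The category of finite subsets of a type. A map is a triple of its source, an extensional
  function and its target, so that equality of arrows is equality of maps.
\<close>
type_synonym 'u set_map = "'u set \<times> ('u \<Rightarrow> 'u) \<times> 'u set"

definition fin_set_cat :: "('u set, 'u set_map) cat" where
  "fin_set_cat = \<lparr>Ob = {A. finite A},
     Arr = {(A, f, B). finite A \<and> finite B \<and> f \<in> A \<rightarrow>\<^sub>E B},
     Dom = (\<lambda>(A, f, B). A), Cod = (\<lambda>(A, f, B). B),
     Ident = (\<lambda>A. (A, \<lambda>u\<in>A. u, A)),
     Comp = (\<lambda>(B', g, C) (A, f, B). (A, compose A g f, C))\<rparr>"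

record ('o, 'm, 'p, 'n) ftr =
  OMap :: "'o \<Rightarrow> 'p"
  AMap :: "'m \<Rightarrow> 'n"

definition is_functor :: "('o, 'm) cat \<Rightarrow> ('p, 'n) cat \<Rightarrow> ('o, 'm, 'p, 'n) ftr \<Rightarrow> bool" where
  "is_functor C D F \<longleftrightarrow>
     (\<forall>x\<in>Ob C. OMap F x \<in> Ob D) \<and>
     (\<forall>x\<in>Ob C. \<forall>y\<in>Ob C. \<forall>f\<in>hom_set C x y. AMap F f \<in> hom_set D (OMap F x) (OMap F y)) \<and>
     (\<forall>x\<in>Ob C. AMap F (Ident C x) = Ident D (OMap F x)) \<and>
     (\<forall>x\<in>Ob C. \<forall>y\<in>Ob C. \<forall>z\<in>Ob C. \<forall>f\<in>hom_set C x y. \<forall>g\<in>hom_set C y z.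
        AMap F (g \<cdot>\<^bsub>C\<^esub> f) = AMap F g \<cdot>\<^bsub>D\<^esub> AMap F f)"

definition id_ftr :: "('o, 'm, 'o, 'm) ftr" where
  "id_ftr = \<lparr>OMap = id, AMap = id\<rparr>"

definition comp_ftr :: "('p, 'n, 'q, 'k) ftr \<Rightarrow> ('o, 'm, 'p, 'n) ftr \<Rightarrow> ('o, 'm, 'q, 'k) ftr" where
  "comp_ftr G F = \<lparr>OMap = OMap G \<circ> OMap F, AMap = AMap G \<circ> AMap F\<rparr>"

definition iso_arr :: "('o, 'm) cat \<Rightarrow> 'o \<Rightarrow> 'o \<Rightarrow> 'm \<Rightarrow> bool" where
  "iso_arr C x y f \<longleftrightarrow> f \<in> hom_set C x y \<and>
     (\<exists>g\<in>hom_set C y x. g \<cdot>\<^bsub>C\<^esub> f = Ident C x \<and> f \<cdot>\<^bsub>C\<^esub> g = Ident C y)"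

definition naturally_isomorphic ::
  "('o, 'm) cat \<Rightarrow> ('p, 'n) cat \<Rightarrow> ('o, 'm, 'p, 'n) ftr \<Rightarrow> ('o, 'm, 'p, 'n) ftr \<Rightarrow> bool" where
  "naturally_isomorphic C D F G \<longleftrightarrow> (\<exists>\<eta>.
     (\<forall>x\<in>Ob C. iso_arr D (OMap F x) (OMap G x) (\<eta> x)) \<and>
     (\<forall>x\<in>Ob C. \<forall>y\<in>Ob C. \<forall>f\<in>hom_set C x y. AMap G f \<cdot>\<^bsub>D\<^esub> \<eta> x = \<eta> y \<cdot>\<^bsub>D\<^esub> AMap F f))"

definition equivalent_categories :: "('o, 'm) cat \<Rightarrow> ('p, 'n) cat \<Rightarrow> bool" where
  "equivalent_categories C D \<longleftrightarrow> (\<exists>F G. is_functor C D F \<and> is_functor D C G \<and>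
     naturally_isomorphic C C (comp_ftr G F) id_ftr \<and>
     naturally_isomorphic D D (comp_ftr F G) id_ftr)"


section \<open>Idempotent completion\<close>

definition idempotents :: "('o, 'm) cat \<Rightarrow> 'm set" where
  "idempotents C = {e \<in> Arr C. Dom C e = Cod C e \<and> e \<cdot>\<^bsub>C\<^esub> e = e}"

text \<open>
  The same arrow of \<open>C\<close> may lie in \<open>f \<cdot> Hom(x, y) \<cdot> e\<close> for several pairs \<open>(e, f)\<close>, so a
  morphism \<open>e \<rightarrow> f\<close> is recorded as a triple \<open>(e, h, f)\<close>.
\<close>
definition idempotent_completion :: "('o, 'm) cat \<Rightarrow> ('m, 'm \<times> 'm \<times> 'm) cat" where
  "idempotent_completion C = \<lparr>Ob = idempotents C,
     Arr = {(e, h, f) | e h f. e \<in> idempotents C \<and> f \<in> idempotents C \<and>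
              h \<in> {f \<cdot>\<^bsub>C\<^esub> k \<cdot>\<^bsub>C\<^esub> e | k. k \<in> hom_set C (Dom C e) (Dom C f)}},
     Dom = (\<lambda>(e, h, f). e), Cod = (\<lambda>(e, h, f). f),
     Ident = (\<lambda>e. (e, e, e)),
     Comp = (\<lambda>(f', k, g) (e, h, f). (e, k \<cdot>\<^bsub>C\<^esub> h, g))\<rparr>"


section \<open>Bisets\<close>

type_synonym ('o, 'm, 'p, 'n, 'u) biset = "('o \<times> 'p, 'm \<times> 'n, 'u set, 'u set_map) ftr"

definition is_biset :: "('o, 'm) cat \<Rightarrow> ('p, 'n) cat \<Rightarrow> ('o, 'm, 'p, 'n, 'u) biset \<Rightarrow> bool" where
  "is_biset C D \<Omega> \<longleftrightarrow> is_functor (prod_cat C (op_cat D)) fin_set_cat \<Omega>"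

definition act :: "('o, 'm, 'p, 'n, 'u) biset \<Rightarrow> 'm \<Rightarrow> 'n \<Rightarrow> 'u \<Rightarrow> 'u" where
  "act \<Omega> f g = fst (snd (AMap \<Omega> (f, g)))"

definition biset_iso :: "('o, 'm) cat \<Rightarrow> ('p, 'n) cat \<Rightarrow>
    ('o, 'm, 'p, 'n, 'u) biset \<Rightarrow> ('o, 'm, 'p, 'n, 'v) biset \<Rightarrow> bool" where
  "biset_iso C D \<Omega> \<Psi> \<longleftrightarrow> (\<exists>\<eta>.
     (\<forall>x\<in>Ob C. \<forall>y\<in>Ob D. bij_betw (\<eta> x y) (OMap \<Omega> (x, y)) (OMap \<Psi> (x, y))) \<and>
     (\<forall>x\<in>Ob C. \<forall>x'\<in>Ob C. \<forall>y\<in>Ob D. \<forall>y'\<in>Ob D.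
        \<forall>f\<in>hom_set C x x'. \<forall>g\<in>hom_set D y' y. \<forall>u\<in>OMap \<Omega> (x, y).
          \<eta> x' y' (act \<Omega> f g u) = act \<Psi> f g (\<eta> x y u)))"

definition biset_union :: "('o, 'm, 'p, 'n, 'u) biset \<Rightarrow> ('o, 'm, 'p, 'n, 'v) biset \<Rightarrow>
    ('o, 'm, 'p, 'n, 'u + 'v) biset" where
  "biset_union \<Omega> \<Psi> = \<lparr>OMap = (\<lambda>p. OMap \<Omega> p <+> OMap \<Psi> p),
     AMap = (\<lambda>a. case (AMap \<Omega> a, AMap \<Psi> a) of ((A, f, A'), (B, g, B')) \<Rightarrow>
               (A <+> B, \<lambda>w\<in>A <+> B. map_sum f g w, A' <+> B'))\<rparr>"

definition id_biset :: "('o, 'm) cat \<Rightarrow> ('o, 'm, 'o, 'm, 'm) biset" where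
  "id_biset C = \<lparr>OMap = (\<lambda>(x, y). hom_set C y x),
     AMap = (\<lambda>(f, g).
       (hom_set C (Cod C g) (Dom C f), \<lambda>h\<in>hom_set C (Cod C g) (Dom C f). f \<cdot>\<^bsub>C\<^esub> h \<cdot>\<^bsub>C\<^esub> g,
        hom_set C (Dom C g) (Cod C f)))\<rparr>"

definition comp_pairs :: "('p, 'n) cat \<Rightarrow> ('o, 'm, 'p, 'n, 'u) biset \<Rightarrow>
    ('p, 'n, 'q, 'k, 'v) biset \<Rightarrow> 'o \<Rightarrow> 'q \<Rightarrow> ('p \<times> 'u \<times> 'v) set" where
  "comp_pairs D \<Omega> \<Psi> x z = {(y, u, v). y \<in> Ob D \<and> u \<in> OMap \<Omega> (x, y) \<and> v \<in> OMap \<Psi> (y, z)}"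

text \<open>
  One elementary step \<open>(u\<beta>, v) \<sim> (u, \<beta>v)\<close> for \<open>\<beta> : y' \<rightarrow> y\<close> in \<open>D\<close>, \<open>u \<in> \<Omega>(x, y)\<close>,
  \<open>v \<in> \<Psi>(y', z)\<close>.
\<close>
definition comp_step :: "('o, 'm) cat \<Rightarrow> ('p, 'n) cat \<Rightarrow> ('q, 'k) cat \<Rightarrow>
    ('o, 'm, 'p, 'n, 'u) biset \<Rightarrow> ('p, 'n, 'q, 'k, 'v) biset \<Rightarrow> 'o \<Rightarrow> 'q \<Rightarrow>
    'p \<times> 'u \<times> 'v \<Rightarrow> 'p \<times> 'u \<times> 'v \<Rightarrow> bool" where
  "comp_step C D E \<Omega> \<Psi> x z p q \<longleftrightarrow>
     (\<exists>y'\<in>Ob D. \<exists>y\<in>Ob D. \<exists>\<beta>\<in>hom_set D y' y. \<exists>u\<in>OMap \<Omega> (x, y). \<exists>v\<in>OMap \<Psi> (y', z).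
        p = (y', act \<Omega> (Ident C x) \<beta> u, v) \<and> q = (y, u, act \<Psi> \<beta> (Ident E z) v))"

definition comp_rel :: "('o, 'm) cat \<Rightarrow> ('p, 'n) cat \<Rightarrow> ('q, 'k) cat \<Rightarrow>
    ('o, 'm, 'p, 'n, 'u) biset \<Rightarrow> ('p, 'n, 'q, 'k, 'v) biset \<Rightarrow> 'o \<Rightarrow> 'q \<Rightarrow>
    (('p \<times> 'u \<times> 'v) \<times> ('p \<times> 'u \<times> 'v)) set" where
  "comp_rel C D E \<Omega> \<Psi> x z = {(p, q). p \<in> comp_pairs D \<Omega> \<Psi> x z \<and> q \<in> comp_pairs D \<Omega> \<Psi> x z \<and>
     equivclp (comp_step C D E \<Omega> \<Psi> x z) p q}"

definition comp_set :: "('o, 'm) cat \<Rightarrow> ('p, 'n) cat \<Rightarrow> ('q, 'k) cat \<Rightarrow>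
    ('o, 'm, 'p, 'n, 'u) biset \<Rightarrow> ('p, 'n, 'q, 'k, 'v) biset \<Rightarrow> 'o \<Rightarrow> 'q \<Rightarrow>
    ('p \<times> 'u \<times> 'v) set set" where
  "comp_set C D E \<Omega> \<Psi> x z = comp_pairs D \<Omega> \<Psi> x z // comp_rel C D E \<Omega> \<Psi> x z"

text \<open>
  An arrow \<open>(f, g)\<close>, \<open>f : x \<rightarrow> x'\<close> in \<open>C\<close> and \<open>g : z' \<rightarrow> z\<close> in \<open>E\<close>, sends the class of
  \<open>(u, v)\<close> to the class of \<open>(fu, vg)\<close>.
\<close>
definition comp_biset :: "('o, 'm) cat \<Rightarrow> ('p, 'n) cat \<Rightarrow> ('q, 'k) cat \<Rightarrow>
    ('o, 'm, 'p, 'n, 'u) biset \<Rightarrow> ('p, 'n, 'q, 'k, 'v) biset \<Rightarrow>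
    ('o, 'm, 'q, 'k, ('p \<times> 'u \<times> 'v) set) biset" where
  "comp_biset C D E \<Omega> \<Psi> = \<lparr>OMap = (\<lambda>(x, z). comp_set C D E \<Omega> \<Psi> x z),
     AMap = (\<lambda>(f, g).
       (comp_set C D E \<Omega> \<Psi> (Dom C f) (Cod E g),
        \<lambda>K\<in>comp_set C D E \<Omega> \<Psi> (Dom C f) (Cod E g).
          comp_rel C D E \<Omega> \<Psi> (Cod C f) (Dom E g) ``
            ((\<lambda>(y, u, v). (y, act \<Omega> f (Ident D y) u, act \<Psi> (Ident D y) g v)) ` K),
        comp_set C D E \<Omega> \<Psi> (Cod C f) (Dom E g)))\<rparr>"


section \<open>The Grothendieck group of bisets\<close>

text \<open>
  Over finite categories every biset is isomorphic to one with values in finite subsets of \<open>nat\<close>.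
  The isomorphism class of a biset, whatever the type of its elements, is represented by the set
  of all \<open>nat\<close>-valued bisets isomorphic to it.
\<close>
type_synonym ('o, 'm, 'p, 'n) biset_class = "('o, 'm, 'p, 'n, nat) biset set"

definition iso_class :: "('o, 'm) cat \<Rightarrow> ('p, 'n) cat \<Rightarrow> ('o, 'm, 'p, 'n, 'u) biset \<Rightarrow>
    ('o, 'm, 'p, 'n) biset_class" where
  "iso_class C D \<Omega> = {\<Theta>. is_biset C D \<Theta> \<and> biset_iso C D \<Omega> \<Theta>}"

definition biset_classes :: "('o, 'm) cat \<Rightarrow> ('p, 'n) cat \<Rightarrow> ('o, 'm, 'p, 'n) biset_class set" where
  "biset_classes C D = {iso_class C D \<Omega> | \<Omega> :: ('o, 'm, 'p, 'n, nat) biset. is_biset C D \<Omega>}"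

text \<open>\<open>K(C, D)\<close>: free abelian group on isomorphism classes, modulo \<open>[\<Omega> \<squnion> \<Psi>] = [\<Omega>] + [\<Psi>]\<close>.\<close>
definition K_rel :: "('o, 'm) cat \<Rightarrow> ('p, 'n) cat \<Rightarrow> (('o, 'm, 'p, 'n) biset_class \<Rightarrow>\<^sub>0 int) set" where
  "K_rel C D = generate (free_Abelian_group (biset_classes C D))
     {frag_of (iso_class C D (biset_union \<Omega> \<Psi>)) - frag_of (iso_class C D \<Omega>) - frag_of (iso_class C D \<Psi>)
       | (\<Omega> :: ('o, 'm, 'p, 'n, nat) biset) (\<Psi> :: ('o, 'm, 'p, 'n, nat) biset).
         is_biset C D \<Omega> \<and> is_biset C D \<Psi>}"

type_synonym ('o, 'm, 'p, 'n) biset_K = "(('o, 'm, 'p, 'n) biset_class \<Rightarrow>\<^sub>0 int) set"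

definition biset_K :: "('o, 'm) cat \<Rightarrow> ('p, 'n) cat \<Rightarrow> ('o, 'm, 'p, 'n) biset_K monoid" where
  "biset_K C D = free_Abelian_group (biset_classes C D) Mod K_rel C D"

definition K_class :: "('o, 'm) cat \<Rightarrow> ('p, 'n) cat \<Rightarrow> ('o, 'm, 'p, 'n, 'u) biset \<Rightarrow>
    ('o, 'm, 'p, 'n) biset_K" where
  "K_class C D \<Omega> = K_rel C D #>\<^bsub>free_Abelian_group (biset_classes C D)\<^esub> frag_of (iso_class C D \<Omega>)"

definition comp_class :: "('o, 'm) cat \<Rightarrow> ('p, 'n) cat \<Rightarrow> ('q, 'k) cat \<Rightarrow>
    ('o, 'm, 'p, 'n) biset_class \<Rightarrow> ('p, 'n, 'q, 'k) biset_class \<Rightarrow> ('o, 'm, 'q, 'k) biset_class" where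
  "comp_class C D E U V = (\<Union>\<Omega>\<in>U. \<Union>\<Psi>\<in>V. iso_class C E (comp_biset C D E \<Omega> \<Psi>))"

text \<open>
  The biadditive extension of the composition of isomorphism classes. As usual for operations on
  quotients, the result is the union, over all representatives, of the coset of the result; since
  the operation respects the relations, these cosets all coincide.
\<close>
definition comp_K :: "('o, 'm) cat \<Rightarrow> ('p, 'n) cat \<Rightarrow> ('q, 'k) cat \<Rightarrow>
    ('o, 'm, 'p, 'n) biset_K \<Rightarrow> ('p, 'n, 'q, 'k) biset_K \<Rightarrow> ('o, 'm, 'q, 'k) biset_K" where
  "comp_K C D E A B = (\<Union>a\<in>A. \<Union>b\<in>B. K_rel C E #>\<^bsub>free_Abelian_group (biset_classes C E)\<^esub>
     frag_extend (\<lambda>U. frag_extend (\<lambda>V. frag_of (comp_class C D E U V)) b) a)"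


section \<open>Tensor product of a ring with an abelian group over the integers\<close>

text \<open>
  The abelian group \<open>A\<close> is a multiplicatively written \<open>monoid\<close> record, whereas free abelian groups
  are written additively. Balancedness over the integers follows from biadditivity and is therefore
  not imposed separately.
\<close>
definition tensor_rel :: "('r, 'z) ring_scheme \<Rightarrow> ('a, 'b) monoid_scheme \<Rightarrow> ('r \<times> 'a \<Rightarrow>\<^sub>0 int) set" where
  "tensor_rel R A = generate (free_Abelian_group (carrier R \<times> carrier A))
     ({frag_of (r \<oplus>\<^bsub>R\<^esub> s, a) - frag_of (r, a) - frag_of (s, a)
        | r s a. r \<in> carrier R \<and> s \<in> carrier R \<and> a \<in> carrier A} \<union>
      {frag_of (r, a \<otimes>\<^bsub>A\<^esub> b) - frag_of (r, a) - frag_of (r, b)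
        | r a b. r \<in> carrier R \<and> a \<in> carrier A \<and> b \<in> carrier A})"

definition ring_tensor :: "('r, 'z) ring_scheme \<Rightarrow> ('a, 'b) monoid_scheme \<Rightarrow>
    ('r \<times> 'a \<Rightarrow>\<^sub>0 int) set monoid" where
  "ring_tensor R A = free_Abelian_group (carrier R \<times> carrier A) Mod tensor_rel R A"

definition pure_tensor :: "('r, 'z) ring_scheme \<Rightarrow> ('a, 'b) monoid_scheme \<Rightarrow> 'r \<Rightarrow> 'a \<Rightarrow>
    ('r \<times> 'a \<Rightarrow>\<^sub>0 int) set" where
  "pure_tensor R A r a = tensor_rel R A #>\<^bsub>free_Abelian_group (carrier R \<times> carrier A)\<^esub> frag_of (r, a)"

text \<open>
  The \<open>R\<close>-bilinear extension of a biadditive map \<open>\<phi>\<close> with values in \<open>A\<close>: it sends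
  \<open>(r \<otimes> a, s \<otimes> b)\<close> to \<open>rs \<otimes> \<phi>(a, b)\<close>.
\<close>
definition bilinear_extension :: "('r, 'z) ring_scheme \<Rightarrow> ('c, 'd) monoid_scheme \<Rightarrow>
    ('a \<Rightarrow> 'b \<Rightarrow> 'c) \<Rightarrow> ('r \<times> 'a \<Rightarrow>\<^sub>0 int) set \<Rightarrow> ('r \<times> 'b \<Rightarrow>\<^sub>0 int) set \<Rightarrow> ('r \<times> 'c \<Rightarrow>\<^sub>0 int) set" where
  "bilinear_extension R A \<phi> S T =
     (\<Union>s\<in>S. \<Union>t\<in>T. tensor_rel R A #>\<^bsub>free_Abelian_group (carrier R \<times> carrier A)\<^esub>
        frag_extend (\<lambda>(r, a). frag_extend (\<lambda>(r', b). frag_of (r \<otimes>\<^bsub>R\<^esub> r', \<phi> a b)) t) s)"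


section \<open>The biset category\<close>

text \<open>
  A morphism \<open>C \<rightarrow> D\<close> is built from \<open>(D, C)\<close>-bisets, so that composition of morphisms
  agrees with composition of bisets without a change of order. Hom-groups, composition, and
  identities are given polymorphically, because the objects may have different types.
\<close>
type_synonym ('r, 'o, 'm, 'p, 'n) biset_morphism = "('r \<times> ('p, 'n, 'o, 'm) biset_K \<Rightarrow>\<^sub>0 int) set"

definition Hom_B :: "('r, 'z) ring_scheme \<Rightarrow> ('o, 'm) cat \<Rightarrow> ('p, 'n) cat \<Rightarrow>
    ('r, 'o, 'm, 'p, 'n) biset_morphism monoid" where
  "Hom_B R C D = ring_tensor R (biset_K D C)"

definition comp_B :: "('r, 'z) ring_scheme \<Rightarrow> ('o, 'm) cat \<Rightarrow> ('p, 'n) cat \<Rightarrow> ('q, 'k) cat \<Rightarrow>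
    ('r, 'p, 'n, 'q, 'k) biset_morphism \<Rightarrow> ('r, 'o, 'm, 'p, 'n) biset_morphism \<Rightarrow>
    ('r, 'o, 'm, 'q, 'k) biset_morphism" where
  "comp_B R C D E \<beta> \<alpha> = bilinear_extension R (biset_K E C) (comp_K E D C) \<beta> \<alpha>"

definition id_B :: "('r, 'z) ring_scheme \<Rightarrow> ('o, 'm) cat \<Rightarrow> ('r, 'o, 'm, 'o, 'm) biset_morphism" where
  "id_B R C = pure_tensor R (biset_K C C) \<one>\<^bsub>R\<^esub> (K_class C C (id_biset C))"

definition isomorphic_in_B :: "('r, 'z) ring_scheme \<Rightarrow> ('o, 'm) cat \<Rightarrow> ('p, 'n) cat \<Rightarrow> bool" where
  "isomorphic_in_B R C D \<longleftrightarrow>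
     (\<exists>\<alpha>\<in>carrier (Hom_B R C D). \<exists>\<beta>\<in>carrier (Hom_B R D C).
        comp_B R C D C \<beta> \<alpha> = id_B R C \<and> comp_B R D C D \<alpha> \<beta> = id_B R D)"

end

(*
  Inside the idempotent completion E of C, both C and D sit as full subcategories: S is the
  canonical embedding of C, and T is the embedding of D into its own completion followed by the
  equivalence. The isomorphism is given by the bisets (x, y) |-> E(T y, S x) and
  (y, x) |-> E(S x, T y). Composition in E maps their composites to E(S -, S -) and E(T -, T -),
  which are the identity bisets since S and T are fully faithful. That map is bijective because
  every object of E is a retract of an object in the image of S, and of one in the image of T.
  Since the Hom-groups are defined by generators and relations, one also needs that composition
  of bisets respects isomorphisms and disjoint unions in each variable.
*)
theory Submission
  imports Defs
begin

section \<open>Bisets and their isomorphisms\<close>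

text \<open>Only morphisms of the form \<open>1 \<otimes> [\<Omega>]\<close> occur in the
  isomorphism, but this does not reduce the proof to bisets. Composition in the Hom-groups is a
  union of cosets over all representatives, and such a union has the expected value only if the
  operation is compatible with every relation. Two presented groups are nested here: the
  Grothendieck group, with relators from disjoint unions, and its tensor product with
  \<open>R\<close>. One abstract argument about generators and relators serves both levels. A second
  obstacle is the type of the elements of a biset. Isomorphism classes consist of
  \<open>nat\<close>-valued bisets, whereas the elements of morphism bisets, disjoint unions and
  composites are arrows, tagged elements and equivalence classes. Biset isomorphisms therefore
  relate different element types, and \<open>nat\<close>-valued copies are taken where a class or a
  relator is formed. The completion serves as ambient category because an object of \<open>D\<close>
  need not correspond to an object of \<open>C\<close>, only to an idempotent of
  \<open>C\<close>.\<close>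

lemma hom_set_iff: "f \<in> hom_set C x y \<longleftrightarrow> f \<in> Arr C \<and> Dom C f = x \<and> Cod C f = y"
  by (auto simp: hom_set_def)

lemma (in category) hom_set_Ob:
  assumes "f \<in> hom_set C x y"
  shows "x \<in> Ob C" "y \<in> Ob C"
  using assms Dom_in_Ob Cod_in_Ob by (auto simp: hom_set_def)

lemma hom_set_prod_op:
  "hom_set (prod_cat C (op_cat D)) (x, y) (x', y') = hom_set C x x' \<times> hom_set D y' y"
  by (auto simp: hom_set_def prod_cat_def op_cat_def)

lemma hom_set_fin_set_cat:
  "t \<in> hom_set fin_set_cat A B \<longleftrightarrow> finite A \<and> finite B \<and> (\<exists>f \<in> A \<rightarrow>\<^sub>E B. t = (A, f, B))"
  by (auto simp: hom_set_def fin_set_cat_def)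

text \<open>Functoriality is split into the shape of the triples in \<open>AMap\<close> and
  pointwise laws for \<open>act\<close>, so that later arguments can compute with elements. The
  order \<open>g \<cdot> g'\<close> in the second variable comes from the opposite of
  \<open>D\<close>.\<close>

lemma is_biset_iff:
  assumes C: "category C" and D: "category D"
  shows "is_biset C D \<Omega> \<longleftrightarrow>
     (\<forall>x\<in>Ob C. \<forall>y\<in>Ob D. finite (OMap \<Omega> (x, y))) \<and>
     (\<forall>x x' y y'. \<forall>f\<in>hom_set C x x'. \<forall>g\<in>hom_set D y' y.
        AMap \<Omega> (f, g) = (OMap \<Omega> (x, y), act \<Omega> f g, OMap \<Omega> (x', y')) \<and>
        act \<Omega> f g \<in> OMap \<Omega> (x, y) \<rightarrow>\<^sub>E OMap \<Omega> (x', y')) \<and>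
     (\<forall>x\<in>Ob C. \<forall>y\<in>Ob D. \<forall>u\<in>OMap \<Omega> (x, y). act \<Omega> (Ident C x) (Ident D y) u = u) \<and>
     (\<forall>x x' x'' y y' y''. \<forall>f\<in>hom_set C x x'. \<forall>f'\<in>hom_set C x' x''.
        \<forall>g\<in>hom_set D y' y. \<forall>g'\<in>hom_set D y'' y'. \<forall>u\<in>OMap \<Omega> (x, y).
          act \<Omega> (f' \<cdot>\<^bsub>C\<^esub> f) (g \<cdot>\<^bsub>D\<^esub> g') u = act \<Omega> f' g' (act \<Omega> f g u))"
  (is "_ \<longleftrightarrow> ?fin \<and> ?arr \<and> ?id \<and> ?comp")
proof
  interpret C: category C by fact
  interpret D: category D by fact
  assume "is_biset C D \<Omega>"
  then have F: "is_functor (prod_cat C (op_cat D)) fin_set_cat \<Omega>" by (simp add: is_biset_def)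
  have fin: ?fin
    using F by (auto simp: is_functor_def prod_cat_def op_cat_def fin_set_cat_def)
  have arr: ?arr
  proof (intro allI ballI)
    fix x x' y y' f g assume f: "f \<in> hom_set C x x'" and g: "g \<in> hom_set D y' y"
    then have "(f, g) \<in> hom_set (prod_cat C (op_cat D)) (x, y) (x', y')"
      by (simp add: hom_set_prod_op)
    moreover have "(x, y) \<in> Ob (prod_cat C (op_cat D))" "(x', y') \<in> Ob (prod_cat C (op_cat D))"
      using C.hom_set_Ob[OF f] D.hom_set_Ob[OF g] by (auto simp: prod_cat_def op_cat_def)
    ultimately have "AMap \<Omega> (f, g) \<in> hom_set fin_set_cat (OMap \<Omega> (x, y)) (OMap \<Omega> (x', y'))"
      using F unfolding is_functor_def by blast
    then show "AMap \<Omega> (f, g) = (OMap \<Omega> (x, y), act \<Omega> f g, OMap \<Omega> (x', y')) \<and>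
        act \<Omega> f g \<in> OMap \<Omega> (x, y) \<rightarrow>\<^sub>E OMap \<Omega> (x', y')"
      by (auto simp: hom_set_fin_set_cat act_def)
  qed
  have id: ?id
  proof (intro ballI)
    fix x y u assume "x \<in> Ob C" "y \<in> Ob D" and u: "u \<in> OMap \<Omega> (x, y)"
    then have "AMap \<Omega> (Ident C x, Ident D y) = Ident fin_set_cat (OMap \<Omega> (x, y))"
      using F by (auto simp: is_functor_def prod_cat_def op_cat_def)
    then show "act \<Omega> (Ident C x) (Ident D y) u = u"
      using u by (simp add: fin_set_cat_def act_def)
  qed
  have comp: ?comp
  proof (intro allI ballI)
    fix x x' x'' y y' y'' f f' g g' u
    assume f: "f \<in> hom_set C x x'" and f': "f' \<in> hom_set C x' x''"
      and g: "g \<in> hom_set D y' y" and g': "g' \<in> hom_set D y'' y'" and u: "u \<in> OMap \<Omega> (x, y)"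
    let ?P = "prod_cat C (op_cat D)"
    have ob: "(x, y) \<in> Ob ?P" "(x', y') \<in> Ob ?P" "(x'', y'') \<in> Ob ?P"
      using C.hom_set_Ob[OF f] C.hom_set_Ob[OF f'] D.hom_set_Ob[OF g] D.hom_set_Ob[OF g']
      by (auto simp: prod_cat_def op_cat_def)
    have "(f, g) \<in> hom_set ?P (x, y) (x', y')" "(f', g') \<in> hom_set ?P (x', y') (x'', y'')"
      using f f' g g' by (simp_all add: hom_set_prod_op)
    then have "AMap \<Omega> ((f', g') \<cdot>\<^bsub>?P\<^esub> (f, g)) = AMap \<Omega> (f', g') \<cdot>\<^bsub>fin_set_cat\<^esub> AMap \<Omega> (f, g)"
      using F ob unfolding is_functor_def by blast
    moreover have "AMap \<Omega> (f, g) = (OMap \<Omega> (x, y), act \<Omega> f g, OMap \<Omega> (x', y'))"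
      "AMap \<Omega> (f', g') = (OMap \<Omega> (x', y'), act \<Omega> f' g', OMap \<Omega> (x'', y''))"
      using arr f f' g g' by blast+
    moreover have "(f', g') \<cdot>\<^bsub>?P\<^esub> (f, g) = (f' \<cdot>\<^bsub>C\<^esub> f, g \<cdot>\<^bsub>D\<^esub> g')"
      by (simp add: prod_cat_def op_cat_def)
    ultimately have "AMap \<Omega> (f' \<cdot>\<^bsub>C\<^esub> f, g \<cdot>\<^bsub>D\<^esub> g') =
        (OMap \<Omega> (x, y), compose (OMap \<Omega> (x, y)) (act \<Omega> f' g') (act \<Omega> f g), OMap \<Omega> (x'', y''))"
      by (simp add: fin_set_cat_def)
    then show "act \<Omega> (f' \<cdot>\<^bsub>C\<^esub> f) (g \<cdot>\<^bsub>D\<^esub> g') u = act \<Omega> f' g' (act \<Omega> f g u)"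
      using u by (simp add: act_def compose_def)
  qed
  from fin arr id comp show "?fin \<and> ?arr \<and> ?id \<and> ?comp" by (intro conjI)
next
  interpret C: category C by fact
  interpret D: category D by fact
  assume *: "?fin \<and> ?arr \<and> ?id \<and> ?comp"
  note fin = conjunct1[OF *] and arr = conjunct1[OF conjunct2[OF *]]
    and id = conjunct1[OF conjunct2[OF conjunct2[OF *]]]
    and comp = conjunct2[OF conjunct2[OF conjunct2[OF *]]]
  let ?P = "prod_cat C (op_cat D)"
  have ob: "Ob ?P = Ob C \<times> Ob D" by (simp add: prod_cat_def op_cat_def)
  have A: "AMap \<Omega> (f, g) = (OMap \<Omega> (x, y), act \<Omega> f g, OMap \<Omega> (x', y'))"
    "act \<Omega> f g \<in> OMap \<Omega> (x, y) \<rightarrow>\<^sub>E OMap \<Omega> (x', y')"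
    if "f \<in> hom_set C x x'" "g \<in> hom_set D y' y" for f g x x' y y'
    using arr that by blast+
  have "is_functor ?P fin_set_cat \<Omega>"
    unfolding is_functor_def
  proof (intro conjI ballI)
    fix p assume "p \<in> Ob ?P" then show "OMap \<Omega> p \<in> Ob fin_set_cat"
      using fin by (auto simp: ob fin_set_cat_def)
  next
    fix p q h assume "p \<in> Ob ?P" "q \<in> Ob ?P" "h \<in> hom_set ?P p q"
    moreover obtain x y x' y' f g where "p = (x, y)" "q = (x', y')" "h = (f, g)"
      by (metis surj_pair)
    ultimately show "AMap \<Omega> h \<in> hom_set fin_set_cat (OMap \<Omega> p) (OMap \<Omega> q)"
      using fin A[of f x x' g y' y] by (auto simp: hom_set_fin_set_cat hom_set_prod_op ob)
  next
    fix p assume "p \<in> Ob ?P"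
    then obtain x y where p: "p = (x, y)" and x: "x \<in> Ob C" and y: "y \<in> Ob D" by (auto simp: ob)
    have "act \<Omega> (Ident C x) (Ident D y) = (\<lambda>u\<in>OMap \<Omega> (x, y). u)"
      using A(2)[OF C.Ident_in_hom[OF x] D.Ident_in_hom[OF y]] id x y
      by (auto simp: fun_eq_iff PiE_def extensional_def)
    then show "AMap \<Omega> (Ident ?P p) = Ident fin_set_cat (OMap \<Omega> p)"
      using A(1)[OF C.Ident_in_hom[OF x] D.Ident_in_hom[OF y]]
      by (simp add: p prod_cat_def op_cat_def fin_set_cat_def)
  next
    fix p q r h k assume "p \<in> Ob ?P" "q \<in> Ob ?P" "r \<in> Ob ?P"
      and h: "h \<in> hom_set ?P p q" and k: "k \<in> hom_set ?P q r"
    obtain x y x' y' x'' y'' f g f' g' where e: "p = (x, y)" "q = (x', y')" "r = (x'', y'')"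
      "h = (f, g)" "k = (f', g')"
      by (metis surj_pair)
    have f: "f \<in> hom_set C x x'" "f' \<in> hom_set C x' x''" and g: "g \<in> hom_set D y' y" "g' \<in> hom_set D y'' y'"
      using h k by (auto simp: e hom_set_prod_op)
    have "act \<Omega> (f' \<cdot>\<^bsub>C\<^esub> f) (g \<cdot>\<^bsub>D\<^esub> g') = compose (OMap \<Omega> (x, y)) (act \<Omega> f' g') (act \<Omega> f g)"
    proof
      fix u
      show "act \<Omega> (f' \<cdot>\<^bsub>C\<^esub> f) (g \<cdot>\<^bsub>D\<^esub> g') u = compose (OMap \<Omega> (x, y)) (act \<Omega> f' g') (act \<Omega> f g) u"
      proof (cases "u \<in> OMap \<Omega> (x, y)")
        case True then show ?thesis using comp f g by (simp add: compose_def)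
      next
        \<comment> \<open>Arrows of \<open>fin_set_cat\<close> carry extensional functions, so
          equality must also be checked outside the source set, where both sides are
          \<open>undefined\<close>.\<close>
        case False then show ?thesis
          using A(2)[OF C.Comp_in_hom[OF f] D.Comp_in_hom[OF g(2,1)]]
          by (simp add: compose_def PiE_def extensional_def)
      qed
    qed
    then show "AMap \<Omega> (k \<cdot>\<^bsub>?P\<^esub> h) = AMap \<Omega> k \<cdot>\<^bsub>fin_set_cat\<^esub> AMap \<Omega> h"
      using A(1)[OF C.Comp_in_hom[OF f] D.Comp_in_hom[OF g(2,1)]] A(1)[OF f(1) g(1)] A(1)[OF f(2) g(2)]
      by (simp add: e prod_cat_def op_cat_def fin_set_cat_def)
  qed
  then show "is_biset C D \<Omega>" by (simp add: is_biset_def)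
qed

locale biset = C: category C + D: category D
  for C :: "('o, 'm) cat" and D :: "('p, 'n) cat" +
  fixes \<Omega> :: "('o, 'm, 'p, 'n, 'u) biset"
  assumes is_biset: "is_biset C D \<Omega>"
begin

lemmas is_biset_conds = iffD1[OF is_biset_iff[OF C.category_axioms D.category_axioms] is_biset]

lemma finite_OMap: "x \<in> Ob C \<Longrightarrow> y \<in> Ob D \<Longrightarrow> finite (OMap \<Omega> (x, y))"
  using conjunct1[OF is_biset_conds] by simp

lemma AMap_eq:
  "f \<in> hom_set C x x' \<Longrightarrow> g \<in> hom_set D y' y \<Longrightarrow>
     AMap \<Omega> (f, g) = (OMap \<Omega> (x, y), act \<Omega> f g, OMap \<Omega> (x', y'))"
  using conjunct1[OF conjunct2[OF is_biset_conds]] by simp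

lemma act_in:
  "f \<in> hom_set C x x' \<Longrightarrow> g \<in> hom_set D y' y \<Longrightarrow> u \<in> OMap \<Omega> (x, y) \<Longrightarrow> act \<Omega> f g u \<in> OMap \<Omega> (x', y')"
  using conjunct1[OF conjunct2[OF is_biset_conds]] by (meson PiE_mem)

lemma act_Ident:
  "x \<in> Ob C \<Longrightarrow> y \<in> Ob D \<Longrightarrow> u \<in> OMap \<Omega> (x, y) \<Longrightarrow> act \<Omega> (Ident C x) (Ident D y) u = u"
  using conjunct1[OF conjunct2[OF conjunct2[OF is_biset_conds]]] by simp

lemma act_Comp:
  assumes "f \<in> hom_set C x x'" "f' \<in> hom_set C x' x''" "g \<in> hom_set D y' y" "g' \<in> hom_set D y'' y'"
    and "u \<in> OMap \<Omega> (x, y)"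
  shows "act \<Omega> f' g' (act \<Omega> f g u) = act \<Omega> (f' \<cdot>\<^bsub>C\<^esub> f) (g \<cdot>\<^bsub>D\<^esub> g') u"
  using conjunct2[OF conjunct2[OF conjunct2[OF is_biset_conds]]] assms by simp

text \<open>Each one-sided action carries an identity on the other side, so \<open>act_Comp\<close>
  and the unit laws give both orders. This is what lets outer actions pass an elementary step of a
  composite.\<close>

lemma act_commute:
  assumes f: "f \<in> hom_set C x x'" and g: "g \<in> hom_set D y' y" and u: "u \<in> OMap \<Omega> (x, y)"
  shows "act \<Omega> f (Ident D y') (act \<Omega> (Ident C x) g u) = act \<Omega> f g u"
    and "act \<Omega> (Ident C x') g (act \<Omega> f (Ident D y) u) = act \<Omega> f g u"
  using act_Comp[OF C.Ident_in_hom f g D.Ident_in_hom u] act_Comp[OF f C.Ident_in_hom D.Ident_in_hom g u]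
    C.hom_set_Ob[OF f] D.hom_set_Ob[OF g] C.Comp_Ident[OF f] C.Ident_Comp[OF f]
    D.Comp_Ident[OF g] D.Ident_Comp[OF g]
  by simp_all

end

text \<open>The raw action \<open>\<alpha>\<close> may be arbitrary outside the value sets, since
  only its restriction enters \<open>AMap\<close>; the laws are then checked on elements
  alone.\<close>

lemma bisetI:
  assumes "category C" "category D"
    and "\<And>x y. x \<in> Ob C \<Longrightarrow> y \<in> Ob D \<Longrightarrow> finite (OMap \<Omega> (x, y))"
    and "\<And>x x' y y' f g. f \<in> hom_set C x x' \<Longrightarrow> g \<in> hom_set D y' y \<Longrightarrow>
        AMap \<Omega> (f, g) = (OMap \<Omega> (x, y), restrict (\<alpha> f g) (OMap \<Omega> (x, y)), OMap \<Omega> (x', y'))"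
    and "\<And>x x' y y' f g u. f \<in> hom_set C x x' \<Longrightarrow> g \<in> hom_set D y' y \<Longrightarrow> u \<in> OMap \<Omega> (x, y) \<Longrightarrow>
        \<alpha> f g u \<in> OMap \<Omega> (x', y')"
    and "\<And>x y u. x \<in> Ob C \<Longrightarrow> y \<in> Ob D \<Longrightarrow> u \<in> OMap \<Omega> (x, y) \<Longrightarrow> \<alpha> (Ident C x) (Ident D y) u = u"
    and "\<And>x x' x'' y y' y'' f f' g g' u. f \<in> hom_set C x x' \<Longrightarrow> f' \<in> hom_set C x' x'' \<Longrightarrow>
        g \<in> hom_set D y' y \<Longrightarrow> g' \<in> hom_set D y'' y' \<Longrightarrow> u \<in> OMap \<Omega> (x, y) \<Longrightarrow>
        \<alpha> (f' \<cdot>\<^bsub>C\<^esub> f) (g \<cdot>\<^bsub>D\<^esub> g') u = \<alpha> f' g' (\<alpha> f g u)"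
  shows "biset C D \<Omega>"
proof -
  interpret C: category C by fact
  interpret D: category D by fact
  have act: "act \<Omega> f g = restrict (\<alpha> f g) (OMap \<Omega> (x, y))"
    if "f \<in> hom_set C x x'" "g \<in> hom_set D y' y" for f g x x' y y'
    using assms(4)[OF that] by (simp add: act_def)
  have "is_biset C D \<Omega>"
    unfolding is_biset_iff[OF assms(1,2)]
  proof (intro conjI ballI allI)
    fix x x' y y' f g assume fg: "f \<in> hom_set C x x'" "g \<in> hom_set D y' y"
    show "AMap \<Omega> (f, g) = (OMap \<Omega> (x, y), act \<Omega> f g, OMap \<Omega> (x', y'))"
      by (simp only: assms(4)[OF fg] act[OF fg])
    show "act \<Omega> f g \<in> OMap \<Omega> (x, y) \<rightarrow>\<^sub>E OMap \<Omega> (x', y')"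
      using assms(5)[OF fg] by (auto simp: act[OF fg])
  next
    fix x y u assume xy: "x \<in> Ob C" "y \<in> Ob D" and u: "u \<in> OMap \<Omega> (x, y)"
    show "act \<Omega> (Ident C x) (Ident D y) u = u"
      using assms(6)[OF xy u] u by (simp add: act[OF C.Ident_in_hom[OF xy(1)] D.Ident_in_hom[OF xy(2)]])
  next
    fix x x' x'' y y' y'' f f' g g' u
    assume f: "f \<in> hom_set C x x'" and f': "f' \<in> hom_set C x' x''"
      and g: "g \<in> hom_set D y' y" and g': "g' \<in> hom_set D y'' y'" and u: "u \<in> OMap \<Omega> (x, y)"
    show "act \<Omega> (f' \<cdot>\<^bsub>C\<^esub> f) (g \<cdot>\<^bsub>D\<^esub> g') u = act \<Omega> f' g' (act \<Omega> f g u)"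
      using u assms(5)[OF f g u]
      by (simp add: act[OF C.Comp_in_hom[OF f f'] D.Comp_in_hom[OF g' g]] act[OF f g] act[OF f' g']
          assms(7)[OF f f' g g'])
  qed (rule assms(3))
  then show ?thesis
    by (simp add: biset_def biset_axioms_def assms(1,2))
qed

section \<open>Isomorphic bisets and their \<open>nat\<close>-valued copies\<close>

lemma biset_isoI:
  assumes "\<And>x y. x \<in> Ob C \<Longrightarrow> y \<in> Ob D \<Longrightarrow> bij_betw (\<eta> x y) (OMap \<Omega> (x, y)) (OMap \<Psi> (x, y))"
    and "\<And>x x' y y' f g u. \<lbrakk>f \<in> hom_set C x x'; g \<in> hom_set D y' y; x \<in> Ob C; x' \<in> Ob C; y \<in> Ob D;
          y' \<in> Ob D; u \<in> OMap \<Omega> (x, y)\<rbrakk> \<Longrightarrow> \<eta> x' y' (act \<Omega> f g u) = act \<Psi> f g (\<eta> x y u)"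
  shows "biset_iso C D \<Omega> \<Psi>"
  unfolding biset_iso_def using assms by blast

lemma biset_isoE:
  assumes "biset_iso C D \<Omega> \<Psi>" "category C" "category D"
  obtains \<eta> where
    "\<And>x y. x \<in> Ob C \<Longrightarrow> y \<in> Ob D \<Longrightarrow> bij_betw (\<eta> x y) (OMap \<Omega> (x, y)) (OMap \<Psi> (x, y))"
    "\<And>x x' y y' f g u. \<lbrakk>f \<in> hom_set C x x'; g \<in> hom_set D y' y; u \<in> OMap \<Omega> (x, y)\<rbrakk> \<Longrightarrow>
       \<eta> x' y' (act \<Omega> f g u) = act \<Psi> f g (\<eta> x y u)"
proof -
  interpret C: category C by fact
  interpret D: category D by fact
  from assms(1) obtain \<eta> where
    b: "\<forall>x\<in>Ob C. \<forall>y\<in>Ob D. bij_betw (\<eta> x y) (OMap \<Omega> (x, y)) (OMap \<Psi> (x, y))" and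
    n: "\<forall>x\<in>Ob C. \<forall>x'\<in>Ob C. \<forall>y\<in>Ob D. \<forall>y'\<in>Ob D.
        \<forall>f\<in>hom_set C x x'. \<forall>g\<in>hom_set D y' y. \<forall>u\<in>OMap \<Omega> (x, y).
          \<eta> x' y' (act \<Omega> f g u) = act \<Psi> f g (\<eta> x y u)"
    unfolding biset_iso_def by blast
  show ?thesis
    by (rule that[of \<eta>]) (use b n C.hom_set_Ob D.hom_set_Ob in blast)+
qed

lemma biset_iso_trans:
  assumes "biset_iso C D \<Omega> \<Psi>" "biset_iso C D \<Psi> \<Theta>" "category C" "category D"
  shows "biset_iso C D \<Omega> \<Theta>"
proof -
  obtain \<eta> where \<eta>:
    "\<And>x y. x \<in> Ob C \<Longrightarrow> y \<in> Ob D \<Longrightarrow> bij_betw (\<eta> x y) (OMap \<Omega> (x, y)) (OMap \<Psi> (x, y))"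
    "\<And>x x' y y' f g u. \<lbrakk>f \<in> hom_set C x x'; g \<in> hom_set D y' y; u \<in> OMap \<Omega> (x, y)\<rbrakk> \<Longrightarrow>
       \<eta> x' y' (act \<Omega> f g u) = act \<Psi> f g (\<eta> x y u)"
    using biset_isoE[OF assms(1,3,4)] by metis
  obtain \<theta> where \<theta>:
    "\<And>x y. x \<in> Ob C \<Longrightarrow> y \<in> Ob D \<Longrightarrow> bij_betw (\<theta> x y) (OMap \<Psi> (x, y)) (OMap \<Theta> (x, y))"
    "\<And>x x' y y' f g u. \<lbrakk>f \<in> hom_set C x x'; g \<in> hom_set D y' y; u \<in> OMap \<Psi> (x, y)\<rbrakk> \<Longrightarrow>
       \<theta> x' y' (act \<Psi> f g u) = act \<Theta> f g (\<theta> x y u)"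
    using biset_isoE[OF assms(2,3,4)] by metis
  show ?thesis
  proof (rule biset_isoI[where \<eta> = "\<lambda>x y. \<theta> x y \<circ> \<eta> x y"])
    fix x y assume "x \<in> Ob C" "y \<in> Ob D"
    then show "bij_betw (\<theta> x y \<circ> \<eta> x y) (OMap \<Omega> (x, y)) (OMap \<Theta> (x, y))"
      using \<eta>(1) \<theta>(1) bij_betw_trans by blast
  qed (use \<eta> \<theta> bij_betwE in \<open>fastforce simp: \<eta>(2)\<close>)
qed

text \<open>Naturality of the inverse family follows by cancelling the injective
  \<open>\<eta>\<close>, which requires that the action stays inside \<open>\<Omega>\<close>; here
  the biset laws of the source enter.\<close>

lemma (in biset) biset_iso_sym:
  assumes "biset_iso C D \<Omega> \<Psi>"
  shows "biset_iso C D \<Psi> \<Omega>"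
proof -
  obtain \<eta> where \<eta>:
    "\<And>x y. x \<in> Ob C \<Longrightarrow> y \<in> Ob D \<Longrightarrow> bij_betw (\<eta> x y) (OMap \<Omega> (x, y)) (OMap \<Psi> (x, y))"
    "\<And>x x' y y' f g u. \<lbrakk>f \<in> hom_set C x x'; g \<in> hom_set D y' y; u \<in> OMap \<Omega> (x, y)\<rbrakk> \<Longrightarrow>
       \<eta> x' y' (act \<Omega> f g u) = act \<Psi> f g (\<eta> x y u)"
    using biset_isoE[OF assms C.category_axioms D.category_axioms] by metis
  show ?thesis
  proof (rule biset_isoI[where \<eta> = "\<lambda>x y. inv_into (OMap \<Omega> (x, y)) (\<eta> x y)"])
    fix x y assume "x \<in> Ob C" "y \<in> Ob D"
    then show "bij_betw (inv_into (OMap \<Omega> (x, y)) (\<eta> x y)) (OMap \<Psi> (x, y)) (OMap \<Omega> (x, y))"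
      using \<eta>(1) bij_betw_inv_into by blast
  next
    fix x x' y y' f g v
    assume f: "f \<in> hom_set C x x'" and g: "g \<in> hom_set D y' y" and
      ob: "x \<in> Ob C" "x' \<in> Ob C" "y \<in> Ob D" "y' \<in> Ob D" and v: "v \<in> OMap \<Psi> (x, y)"
    define u where "u = inv_into (OMap \<Omega> (x, y)) (\<eta> x y) v"
    have u: "u \<in> OMap \<Omega> (x, y)" "\<eta> x y u = v"
      using \<eta>(1)[OF ob(1,3)] v unfolding u_def
      by (simp_all add: bij_betw_def f_inv_into_f inv_into_into)
    have "inv_into (OMap \<Omega> (x', y')) (\<eta> x' y') (\<eta> x' y' (act \<Omega> f g u)) = act \<Omega> f g u"
      by (rule inv_into_f_f) (use \<eta>(1)[OF ob(2,4)] act_in[OF f g u(1)] in \<open>auto simp: bij_betw_def\<close>)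
    then show "inv_into (OMap \<Omega> (x', y')) (\<eta> x' y') (act \<Psi> f g v) =
        act \<Omega> f g (inv_into (OMap \<Omega> (x, y)) (\<eta> x y) v)"
      using \<eta>(2)[OF f g u(1)] u by (simp add: u_def)
  qed
qed

text \<open>Both classes are sets of \<open>nat\<close>-valued bisets, so they can be equal even
  when \<open>\<Omega>\<close> and \<open>\<Psi>\<close> have different element types. Symmetry and
  transitivity of isomorphism give the two inclusions.\<close>

lemma iso_class_eqI:
  assumes "biset C D \<Omega>" "biset_iso C D \<Omega> \<Psi>"
  shows "iso_class C D \<Omega> = iso_class C D \<Psi>"
proof -
  interpret biset C D \<Omega> by fact
  note cat = C.category_axioms D.category_axioms
  show ?thesis
    unfolding iso_class_def
    by (intro Collect_cong conj_cong refl iffI)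
      (rule biset_iso_trans[OF biset_iso_sym[OF assms(2)] _ cat] biset_iso_trans[OF assms(2) _ cat], assumption)+
qed

context biset begin

text \<open>Every value is finite and so injects into \<open>nat\<close>, independently for each
  pair of objects; the action is transported along these injections.\<close>

lemma ex_nat_biset:
  obtains \<Theta> :: "('o, 'm, 'p, 'n, nat) biset" where "is_biset C D \<Theta>" "biset_iso C D \<Omega> \<Theta>"
proof -
  have "\<exists>h :: 'u \<Rightarrow> nat. inj_on h (OMap \<Omega> p)" if "p \<in> Ob C \<times> Ob D" for p
  proof -
    have "finite (OMap \<Omega> p)" using that finite_OMap by (cases p) simp
    then show ?thesis using finite_imp_inj_to_nat_seg by blast
  qed
  then obtain h :: "'o \<times> 'p \<Rightarrow> 'u \<Rightarrow> nat" where h: "\<And>p. p \<in> Ob C \<times> Ob D \<Longrightarrow> inj_on (h p) (OMap \<Omega> p)"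
    by metis
  define k where "k p = inv_into (OMap \<Omega> p) (h p)" for p
  have kh: "k (x, y) (h (x, y) u) = u" if "x \<in> Ob C" "y \<in> Ob D" "u \<in> OMap \<Omega> (x, y)" for x y u
    using h that by (simp add: k_def)
  \<comment> \<open>The conjugated action: back to \<open>\<Omega>\<close> at the source of
    \<open>(f, g)\<close>, act, forward at its target. The source in the second variable is
    \<open>Cod D g\<close>, by contravariance.\<close>
  define \<alpha> where "\<alpha> f g n = h (Cod C f, Dom D g) (act \<Omega> f g (k (Dom C f, Cod D g) n))" for f g n
  define \<Theta> :: "('o, 'm, 'p, 'n, nat) biset" where "\<Theta> = \<lparr>OMap = (\<lambda>p. h p ` OMap \<Omega> p),
    AMap = (\<lambda>(f, g). (h (Dom C f, Cod D g) ` OMap \<Omega> (Dom C f, Cod D g),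
       restrict (\<alpha> f g) (h (Dom C f, Cod D g) ` OMap \<Omega> (Dom C f, Cod D g)),
       h (Cod C f, Dom D g) ` OMap \<Omega> (Cod C f, Dom D g)))\<rparr>"
  have O: "OMap \<Theta> p = h p ` OMap \<Omega> p" for p by (simp add: \<Theta>_def)
  have \<alpha>: "\<alpha> f g (h (x, y) u) = h (x', y') (act \<Omega> f g u)"
    if f: "f \<in> hom_set C x x'" and g: "g \<in> hom_set D y' y" and u: "u \<in> OMap \<Omega> (x, y)" for f g x x' y y' u
    using f g kh[OF C.hom_set_Ob(1)[OF f] D.hom_set_Ob(2)[OF g] u] by (simp add: \<alpha>_def hom_set_iff)
  have "biset C D \<Theta>"
  proof (rule bisetI[where \<alpha> = \<alpha>])
    fix x x' y y' f g assume "f \<in> hom_set C x x'" "g \<in> hom_set D y' y"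
    then show "AMap \<Theta> (f, g) = (OMap \<Theta> (x, y), restrict (\<alpha> f g) (OMap \<Theta> (x, y)), OMap \<Theta> (x', y'))"
      by (simp add: \<Theta>_def hom_set_iff)
  next
    fix x y u assume xy: "x \<in> Ob C" "y \<in> Ob D" and u: "u \<in> OMap \<Theta> (x, y)"
    then show "\<alpha> (Ident C x) (Ident D y) u = u"
      by (auto simp: O \<alpha>[OF C.Ident_in_hom[OF xy(1)] D.Ident_in_hom[OF xy(2)]] act_Ident)
  next
    fix x x' x'' y y' y'' f f' g g' u
    assume f: "f \<in> hom_set C x x'" and f': "f' \<in> hom_set C x' x''"
      and g: "g \<in> hom_set D y' y" and g': "g' \<in> hom_set D y'' y'" and u: "u \<in> OMap \<Theta> (x, y)"
    from u obtain w where w: "w \<in> OMap \<Omega> (x, y)" "u = h (x, y) w" by (auto simp: O)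
    show "\<alpha> (f' \<cdot>\<^bsub>C\<^esub> f) (g \<cdot>\<^bsub>D\<^esub> g') u = \<alpha> f' g' (\<alpha> f g u)"
      by (simp add: w \<alpha>[OF f g w(1)] \<alpha>[OF f' g' act_in[OF f g w(1)]] act_Comp[OF f f' g g' w(1)]
          \<alpha>[OF C.Comp_in_hom[OF f f'] D.Comp_in_hom[OF g' g] w(1)])
  next
    fix x x' y y' f g u assume f: "f \<in> hom_set C x x'" "g \<in> hom_set D y' y" and "u \<in> OMap \<Theta> (x, y)"
    then show "\<alpha> f g u \<in> OMap \<Theta> (x', y')"
      using act_in[OF f] by (auto simp: O \<alpha>[OF f])
  qed (auto simp: O finite_OMap C.category_axioms D.category_axioms)
  moreover have "biset_iso C D \<Omega> \<Theta>"
  proof (rule biset_isoI[where \<eta> = "\<lambda>x y. h (x, y)"])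
    fix x x' y y' f g u
    assume f: "f \<in> hom_set C x x'" and g: "g \<in> hom_set D y' y" and "x \<in> Ob C" "x' \<in> Ob C" "y \<in> Ob D"
      "y' \<in> Ob D" and u: "u \<in> OMap \<Omega> (x, y)"
    have "act \<Theta> f g (h (x, y) u) = \<alpha> f g (h (x, y) u)"
      using f g u by (simp add: \<Theta>_def act_def hom_set_iff)
    then show "h (x', y') (act \<Omega> f g u) = act \<Theta> f g (h (x, y) u)"
      by (simp add: \<alpha>[OF f g u])
  qed (auto simp: O h bij_betw_def)
  ultimately show thesis using that by (auto simp: biset_def biset_axioms_def)
qed

lemma iso_class_in_biset_classes: "iso_class C D \<Omega> \<in> biset_classes C D"
proof -
  obtain \<Theta> :: "('o, 'm, 'p, 'n, nat) biset" where "is_biset C D \<Theta>" "biset_iso C D \<Omega> \<Theta>"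
    by (rule ex_nat_biset)
  then show ?thesis
    using iso_class_eqI[OF biset_axioms] by (auto simp: biset_classes_def)
qed

end

section \<open>Disjoint unions of bisets\<close>

lemma OMap_biset_union: "OMap (biset_union \<Omega> \<Psi>) p = OMap \<Omega> p <+> OMap \<Psi> p"
  by (simp add: biset_union_def)

lemma act_biset_union:
  assumes "biset C D \<Omega>" "biset C D \<Psi>" and f: "f \<in> hom_set C x x'" and g: "g \<in> hom_set D y' y"
    and w: "w \<in> OMap \<Omega> (x, y) <+> OMap \<Psi> (x, y)"
  shows "act (biset_union \<Omega> \<Psi>) f g w = map_sum (act \<Omega> f g) (act \<Psi> f g) w"
proof -
  interpret \<Omega>: biset C D \<Omega> by fact
  interpret \<Psi>: biset C D \<Psi> by fact
  show ?thesis using w unfolding act_def biset_union_def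
    by (simp add: \<Omega>.AMap_eq[OF f g] \<Psi>.AMap_eq[OF f g])
qed

lemma biset_biset_union:
  assumes "biset C D \<Omega>" "biset C D \<Psi>"
  shows "biset C D (biset_union \<Omega> \<Psi>)"
proof -
  interpret \<Omega>: biset C D \<Omega> by fact
  interpret \<Psi>: biset C D \<Psi> by fact
  show ?thesis
  proof (rule bisetI[where \<alpha> = "\<lambda>f g. map_sum (act \<Omega> f g) (act \<Psi> f g)"])
    fix x x' y y' f g assume fg: "f \<in> hom_set C x x'" "g \<in> hom_set D y' y"
    show "AMap (biset_union \<Omega> \<Psi>) (f, g) = (OMap (biset_union \<Omega> \<Psi>) (x, y),
       restrict (map_sum (act \<Omega> f g) (act \<Psi> f g)) (OMap (biset_union \<Omega> \<Psi>) (x, y)),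
       OMap (biset_union \<Omega> \<Psi>) (x', y'))"
      by (simp add: biset_union_def \<Omega>.AMap_eq[OF fg] \<Psi>.AMap_eq[OF fg])
  next
    fix x x' x'' y y' y'' f f' g g' w
    assume fg: "f \<in> hom_set C x x'" "f' \<in> hom_set C x' x''" "g \<in> hom_set D y' y" "g' \<in> hom_set D y'' y'"
      and w: "w \<in> OMap (biset_union \<Omega> \<Psi>) (x, y)"
    show "map_sum (act \<Omega> (f' \<cdot>\<^bsub>C\<^esub> f) (g \<cdot>\<^bsub>D\<^esub> g')) (act \<Psi> (f' \<cdot>\<^bsub>C\<^esub> f) (g \<cdot>\<^bsub>D\<^esub> g')) w =
      map_sum (act \<Omega> f' g') (act \<Psi> f' g') (map_sum (act \<Omega> f g) (act \<Psi> f g) w)"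
      using w \<Omega>.act_Comp[OF fg] \<Psi>.act_Comp[OF fg] by (auto simp: OMap_biset_union)
  next
    fix x x' y y' f g w
    assume fg: "f \<in> hom_set C x x'" "g \<in> hom_set D y' y" and w: "w \<in> OMap (biset_union \<Omega> \<Psi>) (x, y)"
    show "map_sum (act \<Omega> f g) (act \<Psi> f g) w \<in> OMap (biset_union \<Omega> \<Psi>) (x', y')"
      using w \<Omega>.act_in[OF fg] \<Psi>.act_in[OF fg] by (auto simp: OMap_biset_union)
  next
    fix x y w
    assume "x \<in> Ob C" "y \<in> Ob D" "w \<in> OMap (biset_union \<Omega> \<Psi>) (x, y)"
    then show "map_sum (act \<Omega> (Ident C x) (Ident D y)) (act \<Psi> (Ident C x) (Ident D y)) w = w"
      by (auto simp: OMap_biset_union \<Omega>.act_Ident \<Psi>.act_Ident)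
  qed (simp_all add: OMap_biset_union \<Omega>.C.category_axioms \<Omega>.D.category_axioms \<Omega>.finite_OMap \<Psi>.finite_OMap)
qed

lemma bij_betw_map_sum:
  assumes "bij_betw f A A'" "bij_betw g B B'"
  shows "bij_betw (map_sum f g) (A <+> B) (A' <+> B')"
proof -
  have "map_sum f g ` (A <+> B) = f ` A <+> g ` B"
    by (simp add: Plus_def image_Un image_image)
  moreover have "inj_on (map_sum f g) (A <+> B)"
    using inj_onD[OF bij_betw_imp_inj_on[OF assms(1)]] inj_onD[OF bij_betw_imp_inj_on[OF assms(2)]]
    by (intro inj_onI) (elim PlusE; simp)
  ultimately show ?thesis
    using assms by (simp add: bij_betw_def)
qed

lemma biset_iso_union:
  assumes "biset C D \<Omega>" "biset C D \<Psi>" "biset C D \<Omega>'" "biset C D \<Psi>'"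
    and "biset_iso C D \<Omega> \<Omega>'" "biset_iso C D \<Psi> \<Psi>'"
  shows "biset_iso C D (biset_union \<Omega> \<Psi>) (biset_union \<Omega>' \<Psi>')"
proof -
  interpret \<Omega>: biset C D \<Omega> by fact
  interpret \<Psi>: biset C D \<Psi> by fact
  note cat = \<Omega>.C.category_axioms \<Omega>.D.category_axioms
  obtain \<eta> where \<eta>:
    "\<And>x y. x \<in> Ob C \<Longrightarrow> y \<in> Ob D \<Longrightarrow> bij_betw (\<eta> x y) (OMap \<Omega> (x, y)) (OMap \<Omega>' (x, y))"
    "\<And>x x' y y' f g u. \<lbrakk>f \<in> hom_set C x x'; g \<in> hom_set D y' y; u \<in> OMap \<Omega> (x, y)\<rbrakk> \<Longrightarrow>
       \<eta> x' y' (act \<Omega> f g u) = act \<Omega>' f g (\<eta> x y u)"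
    using biset_isoE[OF assms(5) cat] by metis
  obtain \<theta> where \<theta>:
    "\<And>x y. x \<in> Ob C \<Longrightarrow> y \<in> Ob D \<Longrightarrow> bij_betw (\<theta> x y) (OMap \<Psi> (x, y)) (OMap \<Psi>' (x, y))"
    "\<And>x x' y y' f g u. \<lbrakk>f \<in> hom_set C x x'; g \<in> hom_set D y' y; u \<in> OMap \<Psi> (x, y)\<rbrakk> \<Longrightarrow>
       \<theta> x' y' (act \<Psi> f g u) = act \<Psi>' f g (\<theta> x y u)"
    using biset_isoE[OF assms(6) cat] by metis
  show ?thesis
  proof (rule biset_isoI[where \<eta> = "\<lambda>x y. map_sum (\<eta> x y) (\<theta> x y)"])
    fix x y assume xy: "x \<in> Ob C" "y \<in> Ob D"
    show "bij_betw (map_sum (\<eta> x y) (\<theta> x y)) (OMap (biset_union \<Omega> \<Psi>) (x, y))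
      (OMap (biset_union \<Omega>' \<Psi>') (x, y))"
      unfolding OMap_biset_union by (rule bij_betw_map_sum[OF \<eta>(1)[OF xy] \<theta>(1)[OF xy]])
  next
    fix x x' y y' f g w
    assume f: "f \<in> hom_set C x x'" and g: "g \<in> hom_set D y' y"
      and ob: "x \<in> Ob C" "x' \<in> Ob C" "y \<in> Ob D" "y' \<in> Ob D" and w: "w \<in> OMap (biset_union \<Omega> \<Psi>) (x, y)"
    have w': "map_sum (\<eta> x y) (\<theta> x y) w \<in> OMap \<Omega>' (x, y) <+> OMap \<Psi>' (x, y)"
      using w bij_betwE[OF \<eta>(1)[OF ob(1,3)]] bij_betwE[OF \<theta>(1)[OF ob(1,3)]]
      by (auto simp: OMap_biset_union)
    show "map_sum (\<eta> x' y') (\<theta> x' y') (act (biset_union \<Omega> \<Psi>) f g w) =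
      act (biset_union \<Omega>' \<Psi>') f g (map_sum (\<eta> x y) (\<theta> x y) w)"
      unfolding act_biset_union[OF assms(1,2) f g w[unfolded OMap_biset_union]]
        act_biset_union[OF assms(3,4) f g w']
      using w by (auto simp: OMap_biset_union \<eta>(2)[OF f g] \<theta>(2)[OF f g])
  qed
qed

section \<open>Composition of bisets\<close>

text \<open>Compatibility with the generating steps extends along a zigzag by induction. The images
  of a step need only be related by the closure, so one step may become several, or none.\<close>

lemma equivclp_map:
  assumes "equivclp r p q" and "\<And>p q. r p q \<Longrightarrow> equivclp s (k p) (k q)"
  shows "equivclp s (k p) (k q)"
  using assms(1)
proof (induction rule: equivclp_induct)
  case (step q q')
  then show ?case
    using assms(2) equivclp_sym equivclp_trans by metis
qed simp

text \<open>The map on representatives that occurs inside \<open>comp_biset\<close>, named so that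
  its compatibility with elementary steps can be stated.\<close>

definition pair_act :: "('p, 'n) cat \<Rightarrow> ('o, 'm, 'p, 'n, 'u) biset \<Rightarrow> ('p, 'n, 'q, 'k, 'v) biset \<Rightarrow>
    'm \<Rightarrow> 'k \<Rightarrow> 'p \<times> 'u \<times> 'v \<Rightarrow> 'p \<times> 'u \<times> 'v" where
  "pair_act D \<Omega> \<Psi> f g = (\<lambda>(y, u, v). (y, act \<Omega> f (Ident D y) u, act \<Psi> (Ident D y) g v))"

text \<open>The middle category is finite because the composite collects pairs over all its objects
  and must again have finite values.\<close>

locale composable_bisets =
  D: finite_category D + \<Omega>: biset C D \<Omega> + \<Psi>: biset D E \<Psi>
  for C :: "('o, 'm) cat" and D :: "('p, 'n) cat" and E :: "('q, 'k) cat"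
    and \<Omega> :: "('o, 'm, 'p, 'n, 'u) biset" and \<Psi> :: "('p, 'n, 'q, 'k, 'v) biset"
begin

abbreviation "pairs \<equiv> comp_pairs D \<Omega> \<Psi>"
abbreviation "stp \<equiv> comp_step C D E \<Omega> \<Psi>"
abbreviation "rel \<equiv> comp_rel C D E \<Omega> \<Psi>"
abbreviation "cmp \<equiv> comp_biset C D E \<Omega> \<Psi>"

definition cls :: "'o \<Rightarrow> 'q \<Rightarrow> 'p \<times> 'u \<times> 'v \<Rightarrow> ('p \<times> 'u \<times> 'v) set" where
  "cls x z p = rel x z `` {p}"

lemma comp_step_in_pairs:
  assumes "x \<in> Ob C" "z \<in> Ob E" "stp x z p q"
  shows "p \<in> pairs x z" "q \<in> pairs x z"
  using assms \<Omega>.act_in[OF \<Omega>.C.Ident_in_hom[OF assms(1)]] \<Psi>.act_in[OF _ \<Psi>.D.Ident_in_hom[OF assms(2)]]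
  by (auto simp: comp_step_def comp_pairs_def)

lemma equivclp_in_pairs:
  assumes "equivclp (stp x z) p q" "x \<in> Ob C" "z \<in> Ob E" "p \<in> pairs x z"
  shows "q \<in> pairs x z"
  using assms(1,4) by (induction rule: equivclp_induct) (use comp_step_in_pairs[OF assms(2,3)] in blast)+

text \<open>Both ends of an elementary step are pairs over \<open>(x, z)\<close>, so a zigzag
  starting at such a pair never leaves them and the membership conditions in \<open>comp_rel\<close>
  take care of themselves.\<close>

lemma comp_rel_iff:
  assumes "x \<in> Ob C" "z \<in> Ob E" "p \<in> pairs x z"
  shows "(p, q) \<in> rel x z \<longleftrightarrow> equivclp (stp x z) p q"
proof -
  have "(p, q) \<in> rel x z \<longleftrightarrow> p \<in> pairs x z \<and> q \<in> pairs x z \<and> equivclp (stp x z) p q"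
    by (simp add: comp_rel_def)
  then show ?thesis using equivclp_in_pairs[OF _ assms] assms(3) by blast
qed

lemma equiv_comp_rel: "equiv (pairs x z) (rel x z)"
proof (intro equivI)
  show "sym (rel x z)"
    by (rule symI) (simp add: comp_rel_def equivclp_sym)
  show "trans (rel x z)"
    by (rule transI) (simp add: comp_rel_def, rule equivclp_trans, blast+)
qed (auto simp: comp_rel_def refl_on_def)

lemma cls_eq_iff:
  assumes "x \<in> Ob C" "z \<in> Ob E" "p \<in> pairs x z" "q \<in> pairs x z"
  shows "cls x z p = cls x z q \<longleftrightarrow> equivclp (stp x z) p q"
  unfolding cls_def eq_equiv_class_iff[OF equiv_comp_rel assms(3,4)] comp_rel_iff[OF assms(1-3)] ..

lemma OMap_comp: "OMap cmp (x, z) = comp_set C D E \<Omega> \<Psi> x z"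
  by (simp add: comp_biset_def)

lemma cls_in_comp: "p \<in> pairs x z \<Longrightarrow> cls x z p \<in> OMap cmp (x, z)"
  unfolding OMap_comp comp_set_def cls_def by (rule quotientI)

lemma comp_cases:
  assumes "K \<in> OMap cmp (x, z)"
  obtains p where "p \<in> pairs x z" "K = cls x z p"
  using assms unfolding OMap_comp comp_set_def cls_def by (rule quotientE)

lemma finite_comp:
  assumes "x \<in> Ob C" "z \<in> Ob E"
  shows "finite (OMap cmp (x, z))"
proof -
  have "pairs x z = (SIGMA y:Ob D. OMap \<Omega> (x, y) \<times> OMap \<Psi> (y, z))"
    by (auto simp: comp_pairs_def)
  then have "finite (pairs x z)"
    using D.finite_Ob \<Omega>.finite_OMap[OF assms(1)] \<Psi>.finite_OMap[OF _ assms(2)] by simp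
  then show ?thesis
    unfolding OMap_comp comp_set_def
    by (rule finite_quotient) (auto simp: comp_rel_def)
qed

context
  fixes f g x x' z z'
  assumes f: "f \<in> hom_set C x x'" and g: "g \<in> hom_set E z' z"
begin

lemma pair_act_in:
  assumes "p \<in> pairs x z"
  shows "pair_act D \<Omega> \<Psi> f g p \<in> pairs x' z'"
  using assms \<Omega>.act_in[OF f D.Ident_in_hom] \<Psi>.act_in[OF D.Ident_in_hom g]
  by (auto simp: comp_pairs_def pair_act_def)

text \<open>The same \<open>\<beta>\<close> witnesses the new step, with \<open>u\<close> and
  \<open>v\<close> replaced by their images: the outer actions and the inner action of
  \<open>\<beta>\<close> concern different variables and commute.\<close>

lemma pair_act_step:
  assumes "stp x z p q"
  shows "stp x' z' (pair_act D \<Omega> \<Psi> f g p) (pair_act D \<Omega> \<Psi> f g q)"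
proof -
  obtain y' y \<beta> u v where \<beta>: "\<beta> \<in> hom_set D y' y" and u: "u \<in> OMap \<Omega> (x, y)" and v: "v \<in> OMap \<Psi> (y', z)"
    and p: "p = (y', act \<Omega> (Ident C x) \<beta> u, v)" and q: "q = (y, u, act \<Psi> \<beta> (Ident E z) v)"
    using assms unfolding comp_step_def by blast
  have y: "y' \<in> Ob D" "y \<in> Ob D" using D.hom_set_Ob[OF \<beta>] by auto
  show ?thesis
    unfolding comp_step_def
  proof (intro bexI conjI)
    show "pair_act D \<Omega> \<Psi> f g p =
        (y', act \<Omega> (Ident C x') \<beta> (act \<Omega> f (Ident D y) u), act \<Psi> (Ident D y') g v)"
      by (simp add: p pair_act_def \<Omega>.act_commute[OF f \<beta> u])
    show "pair_act D \<Omega> \<Psi> f g q =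
        (y, act \<Omega> f (Ident D y) u, act \<Psi> \<beta> (Ident E z') (act \<Psi> (Ident D y') g v))"
      by (simp add: q pair_act_def \<Psi>.act_commute[OF \<beta> g v])
  qed (use y \<beta> \<Omega>.act_in[OF f D.Ident_in_hom[OF y(2)] u] \<Psi>.act_in[OF D.Ident_in_hom[OF y(1)] g v] in auto)
qed

text \<open>The image of a class under \<open>pair_act\<close> lies in one class but need not fill
  it, which is why \<open>comp_biset\<close> saturates the image by \<open>comp_rel\<close>. The
  saturation is the class of the image of any representative.\<close>

lemma comp_rel_pair_act_cls:
  assumes p: "p \<in> pairs x z"
  shows "rel x' z' `` (pair_act D \<Omega> \<Psi> f g ` cls x z p) = cls x' z' (pair_act D \<Omega> \<Psi> f g p)"
proof -
  note ob = \<Omega>.C.hom_set_Ob[OF f] \<Psi>.D.hom_set_Ob[OF g]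
  have "p \<in> cls x z p"
    using equiv_class_self[OF equiv_comp_rel p] by (simp add: cls_def)
  moreover have "(pair_act D \<Omega> \<Psi> f g p, pair_act D \<Omega> \<Psi> f g q) \<in> rel x' z'" if "q \<in> cls x z p" for q
  proof -
    have "equivclp (stp x z) p q"
      using that comp_rel_iff[OF ob(1,4) p] by (simp add: cls_def)
    then have "equivclp (stp x' z') (pair_act D \<Omega> \<Psi> f g p) (pair_act D \<Omega> \<Psi> f g q)"
      by (rule equivclp_map) (use pair_act_step in blast)
    then show ?thesis
      using comp_rel_iff[OF ob(2,3) pair_act_in[OF p]] by simp
  qed
  ultimately show ?thesis
    unfolding cls_def using equiv_comp_rel[of x' z'] by (blast elim: equivE dest: symD transD)
qed

end

lemma AMap_comp:
  assumes f: "f \<in> hom_set C x x'" and g: "g \<in> hom_set E z' z"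
  shows "AMap cmp (f, g) = (OMap cmp (x, z),
      restrict (\<lambda>K. rel (Cod C f) (Dom E g) `` (pair_act D \<Omega> \<Psi> f g ` K)) (OMap cmp (x, z)), OMap cmp (x', z'))"
  using assms by (simp add: comp_biset_def hom_set_iff pair_act_def)

lemma act_comp_cls:
  assumes f: "f \<in> hom_set C x x'" and g: "g \<in> hom_set E z' z" and p: "p \<in> pairs x z"
  shows "act cmp f g (cls x z p) = cls x' z' (pair_act D \<Omega> \<Psi> f g p)"
proof -
  have "act cmp f g (cls x z p) = rel x' z' `` (pair_act D \<Omega> \<Psi> f g ` cls x z p)"
    using f g cls_in_comp[OF p] by (simp add: act_def[of cmp] AMap_comp[OF f g] hom_set_iff)
  then show ?thesis
    by (simp add: comp_rel_pair_act_cls[OF f g p])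
qed

text \<open>On representatives the action is \<open>pair_act\<close>, so each law reduces to a law
  of \<open>\<Omega>\<close> in its first variable and one of \<open>\<Psi>\<close> in its
  second.\<close>

lemma biset_comp: "biset C E cmp"
proof (rule bisetI[where \<alpha> = "\<lambda>f g K. rel (Cod C f) (Dom E g) `` (pair_act D \<Omega> \<Psi> f g ` K)"])
  have *: "rel (Cod C f) (Dom E g) `` (pair_act D \<Omega> \<Psi> f g ` cls x z p) = cls x' z' (pair_act D \<Omega> \<Psi> f g p)"
    if "f \<in> hom_set C x x'" "g \<in> hom_set E z' z" "p \<in> pairs x z" for x x' z z' f g p
    using that comp_rel_pair_act_cls[OF that] by (simp add: hom_set_iff)
  {
    fix x x' z z' f g K
    assume fg: "f \<in> hom_set C x x'" "g \<in> hom_set E z' z" and K: "K \<in> OMap cmp (x, z)"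
    from K show "rel (Cod C f) (Dom E g) `` (pair_act D \<Omega> \<Psi> f g ` K) \<in> OMap cmp (x', z')"
      by (rule comp_cases) (simp add: *[OF fg] cls_in_comp pair_act_in[OF fg])
  next
    fix x z K
    assume xz: "x \<in> Ob C" "z \<in> Ob E" and K: "K \<in> OMap cmp (x, z)"
    obtain y u v where p: "(y, u, v) \<in> pairs x z" "K = cls x z (y, u, v)"
      using K by (rule comp_cases) auto
    have "pair_act D \<Omega> \<Psi> (Ident C x) (Ident E z) (y, u, v) = (y, u, v)"
      using p(1) \<Omega>.act_Ident[OF xz(1)] \<Psi>.act_Ident[OF _ xz(2)]
      by (simp add: pair_act_def comp_pairs_def)
    then show "rel (Cod C (Ident C x)) (Dom E (Ident E z)) `` (pair_act D \<Omega> \<Psi> (Ident C x) (Ident E z) ` K) = K"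
      by (simp add: p(2) *[OF \<Omega>.C.Ident_in_hom[OF xz(1)] \<Psi>.D.Ident_in_hom[OF xz(2)] p(1)])
  next
    fix x x' x'' z z' z'' f f' g g' K
    assume f: "f \<in> hom_set C x x'" and f': "f' \<in> hom_set C x' x''"
      and g: "g \<in> hom_set E z' z" and g': "g' \<in> hom_set E z'' z'" and K: "K \<in> OMap cmp (x, z)"
    obtain y u v where p: "(y, u, v) \<in> pairs x z" "K = cls x z (y, u, v)"
      using K by (rule comp_cases) auto
    have y: "y \<in> Ob D" and u: "u \<in> OMap \<Omega> (x, y)" and v: "v \<in> OMap \<Psi> (y, z)"
      using p(1) by (simp_all add: comp_pairs_def)
    note i = D.Ident_in_hom[OF y]
    have "pair_act D \<Omega> \<Psi> (f' \<cdot>\<^bsub>C\<^esub> f) (g \<cdot>\<^bsub>E\<^esub> g') (y, u, v) =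
        pair_act D \<Omega> \<Psi> f' g' (pair_act D \<Omega> \<Psi> f g (y, u, v))"
      using \<Omega>.act_Comp[OF f f' i i u] \<Psi>.act_Comp[OF i i g g' v] D.Comp_Ident[OF i]
      by (simp add: pair_act_def)
    then show "rel (Cod C (f' \<cdot>\<^bsub>C\<^esub> f)) (Dom E (g \<cdot>\<^bsub>E\<^esub> g')) `` (pair_act D \<Omega> \<Psi> (f' \<cdot>\<^bsub>C\<^esub> f) (g \<cdot>\<^bsub>E\<^esub> g') ` K) =
      rel (Cod C f') (Dom E g') `` (pair_act D \<Omega> \<Psi> f' g' ` (rel (Cod C f) (Dom E g) `` (pair_act D \<Omega> \<Psi> f g ` K)))"
      by (simp add: p(2) *[OF f g p(1)] *[OF f' g' pair_act_in[OF f g p(1)]]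
          *[OF \<Omega>.C.Comp_in_hom[OF f f'] \<Psi>.D.Comp_in_hom[OF g' g] p(1)])
  }
qed (fact \<Omega>.C.category_axioms \<Psi>.D.category_axioms finite_comp AMap_comp)+

text \<open>The universal property of the quotient: \<open>step\<close> lets \<open>\<pi>\<close>
  descend to classes, \<open>ker\<close> makes the descended map injective, and \<open>onto\<close>
  makes it surjective. All later descriptions of composites are obtained from this
  criterion.\<close>

lemma comp_biset_isoI:
  fixes X :: "('o, 'm, 'q, 'k, 'w) biset" and \<pi> :: "'o \<Rightarrow> 'q \<Rightarrow> 'p \<times> 'u \<times> 'v \<Rightarrow> 'w"
  assumes onto: "\<And>x z. x \<in> Ob C \<Longrightarrow> z \<in> Ob E \<Longrightarrow> \<pi> x z ` pairs x z = OMap X (x, z)"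
    and step: "\<And>x z p q. x \<in> Ob C \<Longrightarrow> z \<in> Ob E \<Longrightarrow> stp x z p q \<Longrightarrow> \<pi> x z p = \<pi> x z q"
    and ker: "\<And>x z p q. \<lbrakk>x \<in> Ob C; z \<in> Ob E; p \<in> pairs x z; q \<in> pairs x z; \<pi> x z p = \<pi> x z q\<rbrakk> \<Longrightarrow>
        equivclp (stp x z) p q"
    and nat: "\<And>x x' z z' f g p. \<lbrakk>f \<in> hom_set C x x'; g \<in> hom_set E z' z; p \<in> pairs x z\<rbrakk> \<Longrightarrow>
        \<pi> x' z' (pair_act D \<Omega> \<Psi> f g p) = act X f g (\<pi> x z p)"
  shows "biset_iso C E cmp X"
proof (rule biset_isoI[where \<eta> = "\<lambda>x z K. the_elem (\<pi> x z ` K)"])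
  \<comment> \<open>The image of a class under \<open>\<pi>\<close> is a singleton, so
    \<open>the_elem\<close> reads off the common value without choosing a representative.\<close>
  have lift: "the_elem (\<pi> x z ` cls x z p) = \<pi> x z p"
    if "x \<in> Ob C" "z \<in> Ob E" and p: "p \<in> pairs x z" for x z p
  proof -
    have *: "\<pi> x z q = \<pi> x z p" if "equivclp (stp x z) p q" for q
      using that
    proof (induction rule: equivclp_induct)
      case (step q q')
      then show ?case using assms(2)[OF \<open>x \<in> Ob C\<close> \<open>z \<in> Ob E\<close>] by metis
    qed simp
    have "p \<in> cls x z p"
      using equiv_class_self[OF equiv_comp_rel p] by (simp add: cls_def)
    then have "\<pi> x z ` cls x z p = {\<pi> x z p}"
      using * comp_rel_iff[OF that] unfolding cls_def by blast
    then show ?thesis by simp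
  qed
  {
    fix x z assume xz: "x \<in> Ob C" "z \<in> Ob E"
    show "bij_betw (\<lambda>K. the_elem (\<pi> x z ` K)) (OMap cmp (x, z)) (OMap X (x, z))"
      unfolding bij_betw_def
    proof
      show "inj_on (\<lambda>K. the_elem (\<pi> x z ` K)) (OMap cmp (x, z))"
      proof (rule inj_onI)
        fix K L assume KL: "K \<in> OMap cmp (x, z)" "L \<in> OMap cmp (x, z)"
          and eq: "the_elem (\<pi> x z ` K) = the_elem (\<pi> x z ` L)"
        obtain p where p: "p \<in> pairs x z" "K = cls x z p" using KL(1) by (rule comp_cases)
        obtain q where q: "q \<in> pairs x z" "L = cls x z q" using KL(2) by (rule comp_cases)
        show "K = L"
          using eq ker[OF xz p(1) q(1)] cls_eq_iff[OF xz p(1) q(1)]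
          by (simp add: p(2) q(2) lift[OF xz p(1)] lift[OF xz q(1)])
      qed
      have "OMap cmp (x, z) = cls x z ` pairs x z"
        by (auto simp: OMap_comp comp_set_def cls_def quotient_def)
      then have "(\<lambda>K. the_elem (\<pi> x z ` K)) ` OMap cmp (x, z) = (\<lambda>p. the_elem (\<pi> x z ` cls x z p)) ` pairs x z"
        by (simp add: image_image)
      also have "\<dots> = \<pi> x z ` pairs x z" by (rule image_cong) (simp_all add: lift[OF xz])
      finally show "(\<lambda>K. the_elem (\<pi> x z ` K)) ` OMap cmp (x, z) = OMap X (x, z)"
        by (simp add: onto[OF xz])
    qed
  next
    fix x x' z z' f g K
    assume f: "f \<in> hom_set C x x'" and g: "g \<in> hom_set E z' z"
      and ob: "x \<in> Ob C" "x' \<in> Ob C" "z \<in> Ob E" "z' \<in> Ob E" and K: "K \<in> OMap cmp (x, z)"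
    obtain p where p: "p \<in> pairs x z" "K = cls x z p" using K by (rule comp_cases)
    show "the_elem (\<pi> x' z' ` act cmp f g K) = act X f g (the_elem (\<pi> x z ` K))"
      by (simp add: p(2) act_comp_cls[OF f g p(1)] lift[OF ob(1,3) p(1)]
          lift[OF ob(2,4) pair_act_in[OF f g p(1)]] nat[OF f g p(1)])
  }
qed

\<comment> \<open>Composition respects isomorphisms and disjoint unions\<close>
end

lemma composable_bisetsI:
  "finite_category D \<Longrightarrow> biset C D \<Omega> \<Longrightarrow> biset D E \<Psi> \<Longrightarrow> composable_bisets C D E \<Omega> \<Psi>"
  by (simp add: composable_bisets_def)

lemma comp_stepE:
  assumes "comp_step C D E \<Omega> \<Psi> x z p q"
  obtains y' y \<beta> u v where "\<beta> \<in> hom_set D y' y" "y' \<in> Ob D" "y \<in> Ob D" "u \<in> OMap \<Omega> (x, y)" "v \<in> OMap \<Psi> (y', z)"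
    "p = (y', act \<Omega> (Ident C x) \<beta> u, v)" "q = (y, u, act \<Psi> \<beta> (Ident E z) v)"
  using assms unfolding comp_step_def by blast

lemma (in category) comp_stepI:
  assumes "\<beta> \<in> hom_set C y' y" "u \<in> OMap \<Omega> (x, y)" "v \<in> OMap \<Psi> (y', z)"
  shows "comp_step A C E \<Omega> \<Psi> x z (y', act \<Omega> (Ident A x) \<beta> u, v) (y, u, act \<Psi> \<beta> (Ident E z) v)"
  unfolding comp_step_def using assms hom_set_Ob by blast

text \<open>The two isomorphisms induce a bijection \<open>h\<close> of pairs that preserves and
  reflects elementary steps, hence matches the equivalences they generate.\<close>

lemma comp_biset_cong:
  assumes D: "finite_category D" and bis: "biset C D \<Omega>" "biset D E \<Psi>" "biset C D \<Omega>'" "biset D E \<Psi>'"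
    and iso: "biset_iso C D \<Omega> \<Omega>'" "biset_iso D E \<Psi> \<Psi>'"
  shows "biset_iso C E (comp_biset C D E \<Omega> \<Psi>) (comp_biset C D E \<Omega>' \<Psi>')"
proof -
  interpret P: composable_bisets C D E \<Omega> \<Psi> by (intro composable_bisetsI assms)
  interpret P': composable_bisets C D E \<Omega>' \<Psi>' by (intro composable_bisetsI assms)
  obtain \<eta> where \<eta>:
    "\<And>x y. x \<in> Ob C \<Longrightarrow> y \<in> Ob D \<Longrightarrow> bij_betw (\<eta> x y) (OMap \<Omega> (x, y)) (OMap \<Omega>' (x, y))"
    "\<And>x x' y y' f g u. \<lbrakk>f \<in> hom_set C x x'; g \<in> hom_set D y' y; u \<in> OMap \<Omega> (x, y)\<rbrakk> \<Longrightarrow>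
       \<eta> x' y' (act \<Omega> f g u) = act \<Omega>' f g (\<eta> x y u)"
    using biset_isoE[OF iso(1) P.\<Omega>.C.category_axioms P.D.category_axioms] by metis
  obtain \<theta> where \<theta>:
    "\<And>x y. x \<in> Ob D \<Longrightarrow> y \<in> Ob E \<Longrightarrow> bij_betw (\<theta> x y) (OMap \<Psi> (x, y)) (OMap \<Psi>' (x, y))"
    "\<And>x x' y y' f g u. \<lbrakk>f \<in> hom_set D x x'; g \<in> hom_set E y' y; u \<in> OMap \<Psi> (x, y)\<rbrakk> \<Longrightarrow>
       \<theta> x' y' (act \<Psi> f g u) = act \<Psi>' f g (\<theta> x y u)"
    using biset_isoE[OF iso(2) P.D.category_axioms P.\<Psi>.D.category_axioms] by metis
  define h where "h x z = (\<lambda>(y, u, v). (y, \<eta> x y u, \<theta> y z v))" for x z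
  have h: "bij_betw (h x z) (P.pairs x z) (P'.pairs x z)" if x: "x \<in> Ob C" and z: "z \<in> Ob E" for x z
    unfolding bij_betw_def
  proof
    show "inj_on (h x z) (P.pairs x z)"
    proof (rule inj_onI)
      fix p q assume pq: "p \<in> P.pairs x z" "q \<in> P.pairs x z" "h x z p = h x z q"
      obtain y u v where p: "p = (y, u, v)" by (cases p)
      obtain y' u' v' where q: "q = (y', u', v')" by (cases q)
      have "y' = y" using pq(3) by (simp add: h_def p q)
      then show "p = q"
        using pq bij_betw_imp_inj_on[OF \<eta>(1)[OF x, of y]] bij_betw_imp_inj_on[OF \<theta>(1)[OF _ z, of y]]
        by (simp add: p q h_def comp_pairs_def inj_on_eq_iff)
    qed
    show "h x z ` P.pairs x z = P'.pairs x z"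
    proof
      show "h x z ` P.pairs x z \<subseteq> P'.pairs x z"
        using bij_betwE[OF \<eta>(1)[OF x]] bij_betwE[OF \<theta>(1)[OF _ z]] by (auto simp: h_def comp_pairs_def)
      show "P'.pairs x z \<subseteq> h x z ` P.pairs x z"
      proof
        fix p assume "p \<in> P'.pairs x z"
        then obtain y u' v' where y: "y \<in> Ob D" and uv: "u' \<in> OMap \<Omega>' (x, y)" "v' \<in> OMap \<Psi>' (y, z)"
          and p: "p = (y, u', v')"
          by (auto simp: comp_pairs_def)
        from uv obtain u v where "u \<in> OMap \<Omega> (x, y)" "u' = \<eta> x y u" "v \<in> OMap \<Psi> (y, z)" "v' = \<theta> y z v"
          using bij_betw_imp_surj_on[OF \<eta>(1)[OF x y]] bij_betw_imp_surj_on[OF \<theta>(1)[OF y z]] by blast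
        then have "(y, u, v) \<in> P.pairs x z" "h x z (y, u, v) = p"
          using y by (simp_all add: p h_def comp_pairs_def)
        then show "p \<in> h x z ` P.pairs x z" by blast
      qed
    qed
  qed
  have step: "P'.stp x z (h x z p) (h x z q)" if x: "x \<in> Ob C" and z: "z \<in> Ob E" and pq: "P.stp x z p q" for x z p q
    using pq
  proof (cases rule: comp_stepE)
    case (1 y' y \<beta> u v)
    have "\<eta> x y u \<in> OMap \<Omega>' (x, y)" "\<theta> y' z v \<in> OMap \<Psi>' (y', z)"
      using bij_betwE[OF \<eta>(1)[OF x 1(3)]] bij_betwE[OF \<theta>(1)[OF 1(2) z]] 1(4,5) by auto
    from P.D.comp_stepI[where A = C and \<Omega> = \<Omega>' and \<Psi> = \<Psi>' and E = E, OF 1(1) this] show ?thesis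
      by (simp add: 1(6,7) h_def \<eta>(2)[OF P.\<Omega>.C.Ident_in_hom[OF x] 1(1,4)] \<theta>(2)[OF 1(1) P.\<Psi>.D.Ident_in_hom[OF z] 1(5)])
  qed
  \<comment> \<open>Pulling \<open>u'\<close> and \<open>v'\<close> back gives a step between pairs
    with the same images under \<open>h\<close> as \<open>p\<close> and \<open>q\<close>;
    injectivity of \<open>h\<close> identifies its ends with \<open>p\<close> and
    \<open>q\<close>.\<close>
  have step': "P.stp x z p q"
    if x: "x \<in> Ob C" and z: "z \<in> Ob E" and p: "p \<in> P.pairs x z" and q: "q \<in> P.pairs x z"
      and pq: "P'.stp x z (h x z p) (h x z q)" for x z p q
    using pq
  proof (cases rule: comp_stepE)
    case (1 y' y \<beta> u' v')
    obtain u v where u: "u \<in> OMap \<Omega> (x, y)" "u' = \<eta> x y u" and v: "v \<in> OMap \<Psi> (y', z)" "v' = \<theta> y' z v"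
      using 1(4,5) bij_betw_imp_surj_on[OF \<eta>(1)[OF x 1(3)]] bij_betw_imp_surj_on[OF \<theta>(1)[OF 1(2) z]] by blast
    have s: "P.stp x z (y', act \<Omega> (Ident C x) \<beta> u, v) (y, u, act \<Psi> \<beta> (Ident E z) v)"
      by (rule P.D.comp_stepI[OF 1(1) u(1) v(1)])
    have "h x z p = h x z (y', act \<Omega> (Ident C x) \<beta> u, v)"
      unfolding 1(6) by (simp add: h_def u v \<eta>(2)[OF P.\<Omega>.C.Ident_in_hom[OF x] 1(1) u(1)])
    then have "p = (y', act \<Omega> (Ident C x) \<beta> u, v)"
      using inj_onD[OF bij_betw_imp_inj_on[OF h[OF x z]]] p P.comp_step_in_pairs(1)[OF x z s] by metis
    moreover have "h x z q = h x z (y, u, act \<Psi> \<beta> (Ident E z) v)"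
      unfolding 1(7) by (simp add: h_def u v \<theta>(2)[OF 1(1) P.\<Psi>.D.Ident_in_hom[OF z] v(1)])
    then have "q = (y, u, act \<Psi> \<beta> (Ident E z) v)"
      using inj_onD[OF bij_betw_imp_inj_on[OF h[OF x z]]] q P.comp_step_in_pairs(2)[OF x z s] by metis
    ultimately show ?thesis using s by simp
  qed
  show ?thesis
  proof (rule P.comp_biset_isoI[where \<pi> = "\<lambda>x z p. P'.cls x z (h x z p)"])
    fix x z assume xz: "x \<in> Ob C" "z \<in> Ob E"
    have "OMap (comp_biset C D E \<Omega>' \<Psi>') (x, z) = P'.cls x z ` P'.pairs x z"
      using P'.cls_in_comp[of _ x z] by (auto elim: P'.comp_cases)
    then show "(\<lambda>p. P'.cls x z (h x z p)) ` P.pairs x z = OMap (comp_biset C D E \<Omega>' \<Psi>') (x, z)"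
      by (simp add: bij_betw_imp_surj_on[OF h[OF xz], symmetric] image_image)
  next
    fix x z p q assume xz: "x \<in> Ob C" "z \<in> Ob E" and s: "P.stp x z p q"
    have "equivclp (P'.stp x z) (h x z p) (h x z q)"
      using step[OF xz s] by (rule r_into_equivclp)
    then show "P'.cls x z (h x z p) = P'.cls x z (h x z q)"
      using P'.cls_eq_iff[OF xz P'.comp_step_in_pairs[OF xz step[OF xz s]]] by simp
  next
    fix x z p q
    assume xz: "x \<in> Ob C" "z \<in> Ob E" and p: "p \<in> P.pairs x z" and q: "q \<in> P.pairs x z"
      and eq: "P'.cls x z (h x z p) = P'.cls x z (h x z q)"
    note hE = bij_betwE[OF h[OF xz]]
    have "equivclp (P'.stp x z) (h x z p) (h x z q)"
      using eq P'.cls_eq_iff[OF xz] hE p q by blast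
    \<comment> \<open>The intermediate points of a zigzag in the target are not presented as images
      under \<open>h\<close>, so the whole zigzag is pulled back by the inverse \<open>k\<close>.
      The ends of every step are pairs, and there \<open>k\<close> does invert
      \<open>h\<close>.\<close>
    moreover define k where "k = inv_into (P.pairs x z) (h x z)"
    have kh: "k (h x z r) = r" if "r \<in> P.pairs x z" for r
      unfolding k_def using bij_betw_imp_inj_on[OF h[OF xz]] that by (rule inv_into_f_f)
    have k: "k r \<in> P.pairs x z" "h x z (k r) = r" if "r \<in> P'.pairs x z" for r
      unfolding k_def using bij_betw_imp_surj_on[OF h[OF xz]] that
      by (simp_all add: inv_into_into f_inv_into_f)
    have "equivclp (P.stp x z) (k r) (k s)" if "P'.stp x z r s" for r s
    proof (rule r_into_equivclp)
      note in_pairs = P'.comp_step_in_pairs[OF xz that]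
      show "P.stp x z (k r) (k s)"
        by (rule step'[OF xz k(1)[OF in_pairs(1)] k(1)[OF in_pairs(2)]])
          (simp add: k(2) in_pairs that)
    qed
    ultimately have "equivclp (P.stp x z) (k (h x z p)) (k (h x z q))"
      by (rule equivclp_map)
    then show "equivclp (P.stp x z) p q" by (simp add: kh p q)
  next
    fix x x' z z' f g p
    assume f: "f \<in> hom_set C x x'" and g: "g \<in> hom_set E z' z" and p: "p \<in> P.pairs x z"
    obtain y u v where yuv: "p = (y, u, v)" "y \<in> Ob D" "u \<in> OMap \<Omega> (x, y)" "v \<in> OMap \<Psi> (y, z)"
      using p by (auto simp: comp_pairs_def)
    note i = P.D.Ident_in_hom[OF yuv(2)]
    have "h x' z' (pair_act D \<Omega> \<Psi> f g p) = pair_act D \<Omega>' \<Psi>' f g (h x z p)"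
      by (simp add: pair_act_def h_def yuv(1) \<eta>(2)[OF f i yuv(3)] \<theta>(2)[OF i g yuv(4)])
    moreover have "h x z p \<in> P'.pairs x z"
      using bij_betwE[OF h[OF P.\<Omega>.C.hom_set_Ob(1)[OF f] P.\<Psi>.D.hom_set_Ob(2)[OF g]]] p by blast
    ultimately show "P'.cls x' z' (h x' z' (pair_act D \<Omega> \<Psi> f g p)) =
        act (comp_biset C D E \<Omega>' \<Psi>') f g (P'.cls x z (h x z p))"
      by (simp add: P'.act_comp_cls[OF f g])
  qed
qed

text \<open>Pairs over a disjoint union carry the tag of their first factor. The action of
  \<open>D\<close> keeps the tag, so no elementary step joins the two halves, and within one half
  the steps are those of the corresponding composite.\<close>

lemma comp_biset_union_left:
  assumes D: "finite_category D" and bis: "biset C D \<Omega>" "biset C D \<Omega>'" "biset D E \<Psi>"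
  shows "biset_iso C E (comp_biset C D E (biset_union \<Omega> \<Omega>') \<Psi>)
    (biset_union (comp_biset C D E \<Omega> \<Psi>) (comp_biset C D E \<Omega>' \<Psi>))"
proof -
  interpret P: composable_bisets C D E \<Omega> \<Psi> by (intro composable_bisetsI assms)
  interpret P': composable_bisets C D E \<Omega>' \<Psi> by (intro composable_bisetsI assms)
  interpret U: composable_bisets C D E "biset_union \<Omega> \<Omega>'" \<Psi>
    by (intro composable_bisetsI biset_biset_union assms)
  note act_union = act_biset_union[OF bis(1,2)]
  define \<pi> where "\<pi> x z = (\<lambda>(y, w, v). case w of Inl u \<Rightarrow> Inl (P.cls x z (y, u, v)) | Inr u \<Rightarrow> Inr (P'.cls x z (y, u, v)))" for x z
  have stepL: "U.stp x z (case p of (y, u, v) \<Rightarrow> (y, Inl u, v)) (case q of (y, u, v) \<Rightarrow> (y, Inl u, v))"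
    if x: "x \<in> Ob C" and pq: "P.stp x z p q" for x z p q
    using pq
  proof (cases rule: comp_stepE)
    case (1 y' y \<beta> u v)
    have "Inl u \<in> OMap (biset_union \<Omega> \<Omega>') (x, y)" by (simp add: OMap_biset_union 1(4) InlI InrI)
    from P.D.comp_stepI[where A = C and E = E, OF 1(1) this 1(5)] show ?thesis
      using act_union[OF P.\<Omega>.C.Ident_in_hom[OF x] 1(1), of "Inl u"] 1(4) by (simp add: 1(6,7) InlI InrI)
  qed
  have stepR: "U.stp x z (case p of (y, u, v) \<Rightarrow> (y, Inr u, v)) (case q of (y, u, v) \<Rightarrow> (y, Inr u, v))"
    if x: "x \<in> Ob C" and pq: "P'.stp x z p q" for x z p q
    using pq
  proof (cases rule: comp_stepE)
    case (1 y' y \<beta> u v)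
    have "Inr u \<in> OMap (biset_union \<Omega> \<Omega>') (x, y)" by (simp add: OMap_biset_union 1(4) InlI InrI)
    from P.D.comp_stepI[where A = C and E = E, OF 1(1) this 1(5)] show ?thesis
      using act_union[OF P.\<Omega>.C.Ident_in_hom[OF x] 1(1), of "Inr u"] 1(4) by (simp add: 1(6,7) InlI InrI)
  qed
  have pairs: "U.pairs x z = (\<lambda>(y, u, v). (y, Inl u, v)) ` P.pairs x z \<union> (\<lambda>(y, u, v). (y, Inr u, v)) ` P'.pairs x z" for x z
    by (auto simp: comp_pairs_def OMap_biset_union image_iff)
  have \<pi>: "\<pi> x z (case p of (y, u, v) \<Rightarrow> (y, Inl u, v)) = Inl (P.cls x z p)"
    "\<pi> x z (case p' of (y, u, v) \<Rightarrow> (y, Inr u, v)) = Inr (P'.cls x z p')" for x z p p'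
    by (simp_all add: \<pi>_def split: prod.split)
  show ?thesis
  proof (rule U.comp_biset_isoI[where \<pi> = \<pi>])
    fix x z assume xz: "x \<in> Ob C" "z \<in> Ob E"
    have "OMap (comp_biset C D E \<Omega> \<Psi>) (x, z) = P.cls x z ` P.pairs x z"
      using P.cls_in_comp[of _ x z] by (auto elim: P.comp_cases)
    moreover have "OMap (comp_biset C D E \<Omega>' \<Psi>) (x, z) = P'.cls x z ` P'.pairs x z"
      using P'.cls_in_comp[of _ x z] by (auto elim: P'.comp_cases)
    ultimately show "\<pi> x z ` U.pairs x z = OMap (biset_union (comp_biset C D E \<Omega> \<Psi>) (comp_biset C D E \<Omega>' \<Psi>)) (x, z)"
      unfolding pairs OMap_biset_union by (simp add: image_Un image_image \<pi> Plus_def)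
  next
    fix x z p q assume xz: "x \<in> Ob C" "z \<in> Ob E" and s: "U.stp x z p q"
    from s show "\<pi> x z p = \<pi> x z q"
    proof (cases rule: comp_stepE)
      case (1 y' y \<beta> w v)
      note i = P.\<Omega>.C.Ident_in_hom[OF xz(1)]
      show ?thesis
      proof (cases w)
        case (Inl u)
        then have u: "u \<in> OMap \<Omega> (x, y)" using 1(4) by (auto simp: OMap_biset_union)
        note s = P.D.comp_stepI[where A = C and E = E and \<Psi> = \<Psi>, OF 1(1) u 1(5)]
        have "P.cls x z (y', act \<Omega> (Ident C x) \<beta> u, v) = P.cls x z (y, u, act \<Psi> \<beta> (Ident E z) v)"
          using P.cls_eq_iff[OF xz P.comp_step_in_pairs[OF xz s]] s by (auto intro: r_into_equivclp)
        then show ?thesis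
          using u by (simp add: \<pi>_def 1(6,7) Inl act_union[OF i 1(1)] InlI InrI)
      next
        case (Inr u)
        then have u: "u \<in> OMap \<Omega>' (x, y)" using 1(4) by (auto simp: OMap_biset_union)
        note s = P.D.comp_stepI[where A = C and E = E and \<Psi> = \<Psi>, OF 1(1) u 1(5)]
        have "P'.cls x z (y', act \<Omega>' (Ident C x) \<beta> u, v) = P'.cls x z (y, u, act \<Psi> \<beta> (Ident E z) v)"
          using P'.cls_eq_iff[OF xz P'.comp_step_in_pairs[OF xz s]] s by (auto intro: r_into_equivclp)
        then show ?thesis
          using u by (simp add: \<pi>_def 1(6,7) Inr act_union[OF i 1(1)] InlI InrI)
      qed
    qed
  next
    fix x z p q
    assume xz: "x \<in> Ob C" "z \<in> Ob E" and p: "p \<in> U.pairs x z" and q: "q \<in> U.pairs x z"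
      and eq: "\<pi> x z p = \<pi> x z q"
    from p[unfolded pairs] show "equivclp (U.stp x z) p q"
    proof
      assume "p \<in> (\<lambda>(y, u, v). (y, Inl u, v)) ` P.pairs x z"
      then obtain a where a: "a \<in> P.pairs x z" "p = (case a of (y, u, v) \<Rightarrow> (y, Inl u, v))" by blast
      \<comment> \<open>Values of \<open>\<pi>\<close> carry the tag of their argument, so equality
        of values puts \<open>q\<close> in the same half as \<open>p\<close>.\<close>
      then obtain b where b: "b \<in> P.pairs x z" "q = (case b of (y, u, v) \<Rightarrow> (y, Inl u, v))"
        using q[unfolded pairs] eq by (elim UnE imageE) (simp_all add: \<pi>)
      have "equivclp (P.stp x z) a b"
        using eq P.cls_eq_iff[OF xz a(1) b(1)] by (simp add: a(2) b(2) \<pi>)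
      then show ?thesis unfolding a(2) b(2)
        by (rule equivclp_map) (intro r_into_equivclp stepL xz)
    next
      assume "p \<in> (\<lambda>(y, u, v). (y, Inr u, v)) ` P'.pairs x z"
      then obtain a where a: "a \<in> P'.pairs x z" "p = (case a of (y, u, v) \<Rightarrow> (y, Inr u, v))" by blast
      then obtain b where b: "b \<in> P'.pairs x z" "q = (case b of (y, u, v) \<Rightarrow> (y, Inr u, v))"
        using q[unfolded pairs] eq by (elim UnE imageE) (simp_all add: \<pi>)
      have "equivclp (P'.stp x z) a b"
        using eq P'.cls_eq_iff[OF xz a(1) b(1)] by (simp add: a(2) b(2) \<pi>)
      then show ?thesis unfolding a(2) b(2)
        by (rule equivclp_map) (intro r_into_equivclp stepR xz)
    qed
  next
    fix x x' z z' f g p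
    assume f: "f \<in> hom_set C x x'" and g: "g \<in> hom_set E z' z" and p: "p \<in> U.pairs x z"
    note act = act_biset_union[OF P.biset_comp P'.biset_comp f g]
    from p[unfolded pairs] show "\<pi> x' z' (pair_act D (biset_union \<Omega> \<Omega>') \<Psi> f g p) =
      act (biset_union (comp_biset C D E \<Omega> \<Psi>) (comp_biset C D E \<Omega>' \<Psi>)) f g (\<pi> x z p)"
    proof
      assume "p \<in> (\<lambda>(y, u, v). (y, Inl u, v)) ` P.pairs x z"
      then obtain y u v where a: "(y, u, v) \<in> P.pairs x z" "p = (y, Inl u, v)" by auto
      then have u: "u \<in> OMap \<Omega> (x, y)" "y \<in> Ob D" by (auto simp: comp_pairs_def)
      have "pair_act D (biset_union \<Omega> \<Omega>') \<Psi> f g p = (case pair_act D \<Omega> \<Psi> f g (y, u, v) of (y, u, v) \<Rightarrow> (y, Inl u, v))"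
        using u by (simp add: a(2) pair_act_def act_union[OF f P.D.Ident_in_hom] InlI InrI)
      moreover have "\<pi> x z p = Inl (P.cls x z (y, u, v))" by (simp add: a(2) \<pi>_def)
      ultimately show ?thesis
        using P.cls_in_comp[OF a(1)] by (simp add: act \<pi> InlI InrI P.act_comp_cls[OF f g a(1)])
    next
      assume "p \<in> (\<lambda>(y, u, v). (y, Inr u, v)) ` P'.pairs x z"
      then obtain y u v where a: "(y, u, v) \<in> P'.pairs x z" "p = (y, Inr u, v)" by auto
      then have u: "u \<in> OMap \<Omega>' (x, y)" "y \<in> Ob D" by (auto simp: comp_pairs_def)
      have "pair_act D (biset_union \<Omega> \<Omega>') \<Psi> f g p = (case pair_act D \<Omega>' \<Psi> f g (y, u, v) of (y, u, v) \<Rightarrow> (y, Inr u, v))"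
        using u by (simp add: a(2) pair_act_def act_union[OF f P.D.Ident_in_hom] InlI InrI)
      moreover have "\<pi> x z p = Inr (P'.cls x z (y, u, v))" by (simp add: a(2) \<pi>_def)
      ultimately show ?thesis
        using P'.cls_in_comp[OF a(1)] by (simp add: act \<pi> InlI InrI P'.act_comp_cls[OF f g a(1)])
    qed
  qed
qed

text \<open>The tag now sits on the second factor and is kept by the left action of \<open>D\<close>
  on \<open>\<Psi>\<close> and \<open>\<Psi>'\<close>; apart from this, the separation into two
  halves is as for unions on the left.\<close>

lemma comp_biset_union_right:
  assumes D: "finite_category D" and bis: "biset C D \<Omega>" "biset D E \<Psi>" "biset D E \<Psi>'"
  shows "biset_iso C E (comp_biset C D E \<Omega> (biset_union \<Psi> \<Psi>'))
    (biset_union (comp_biset C D E \<Omega> \<Psi>) (comp_biset C D E \<Omega> \<Psi>'))"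
proof -
  interpret P: composable_bisets C D E \<Omega> \<Psi> by (intro composable_bisetsI assms)
  interpret P': composable_bisets C D E \<Omega> \<Psi>' by (intro composable_bisetsI assms)
  interpret U: composable_bisets C D E \<Omega> "biset_union \<Psi> \<Psi>'"
    by (intro composable_bisetsI biset_biset_union assms)
  note act_union = act_biset_union[OF bis(2,3)]
  define \<pi> where "\<pi> x z = (\<lambda>(y, u, w). case w of Inl v \<Rightarrow> Inl (P.cls x z (y, u, v)) | Inr v \<Rightarrow> Inr (P'.cls x z (y, u, v)))" for x z
  have stepL: "U.stp x z (case p of (y, u, v) \<Rightarrow> (y, u, Inl v)) (case q of (y, u, v) \<Rightarrow> (y, u, Inl v))"
    if z: "z \<in> Ob E" and pq: "P.stp x z p q" for x z p q
    using pq
  proof (cases rule: comp_stepE)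
    case (1 y' y \<beta> u v)
    have "Inl v \<in> OMap (biset_union \<Psi> \<Psi>') (y', z)" by (simp add: OMap_biset_union 1(5) InlI)
    from P.D.comp_stepI[where A = C and E = E, OF 1(1,4) this] show ?thesis
      using act_union[OF 1(1) P.\<Psi>.D.Ident_in_hom[OF z], of "Inl v"] 1(5) by (simp add: 1(6,7) InlI)
  qed
  have stepR: "U.stp x z (case p of (y, u, v) \<Rightarrow> (y, u, Inr v)) (case q of (y, u, v) \<Rightarrow> (y, u, Inr v))"
    if z: "z \<in> Ob E" and pq: "P'.stp x z p q" for x z p q
    using pq
  proof (cases rule: comp_stepE)
    case (1 y' y \<beta> u v)
    have "Inr v \<in> OMap (biset_union \<Psi> \<Psi>') (y', z)" by (simp add: OMap_biset_union 1(5) InrI)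
    from P.D.comp_stepI[where A = C and E = E, OF 1(1,4) this] show ?thesis
      using act_union[OF 1(1) P.\<Psi>.D.Ident_in_hom[OF z], of "Inr v"] 1(5) by (simp add: 1(6,7) InrI)
  qed
  have pairs: "U.pairs x z = (\<lambda>(y, u, v). (y, u, Inl v)) ` P.pairs x z \<union> (\<lambda>(y, u, v). (y, u, Inr v)) ` P'.pairs x z" for x z
    by (auto simp: comp_pairs_def OMap_biset_union image_iff)
  have \<pi>: "\<pi> x z (case p of (y, u, v) \<Rightarrow> (y, u, Inl v)) = Inl (P.cls x z p)"
    "\<pi> x z (case p' of (y, u, v) \<Rightarrow> (y, u, Inr v)) = Inr (P'.cls x z p')" for x z p p'
    by (simp_all add: \<pi>_def split: prod.split)
  show ?thesis
  proof (rule U.comp_biset_isoI[where \<pi> = \<pi>])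
    fix x z assume xz: "x \<in> Ob C" "z \<in> Ob E"
    have "OMap (comp_biset C D E \<Omega> \<Psi>) (x, z) = P.cls x z ` P.pairs x z"
      using P.cls_in_comp[of _ x z] by (auto elim: P.comp_cases)
    moreover have "OMap (comp_biset C D E \<Omega> \<Psi>') (x, z) = P'.cls x z ` P'.pairs x z"
      using P'.cls_in_comp[of _ x z] by (auto elim: P'.comp_cases)
    ultimately show "\<pi> x z ` U.pairs x z = OMap (biset_union (comp_biset C D E \<Omega> \<Psi>) (comp_biset C D E \<Omega> \<Psi>')) (x, z)"
      unfolding pairs OMap_biset_union by (simp add: image_Un image_image \<pi> Plus_def)
  next
    fix x z p q assume xz: "x \<in> Ob C" "z \<in> Ob E" and s: "U.stp x z p q"
    from s show "\<pi> x z p = \<pi> x z q"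
    proof (cases rule: comp_stepE)
      case (1 y' y \<beta> u w)
      note i = P.\<Psi>.D.Ident_in_hom[OF xz(2)]
      show ?thesis
      proof (cases w)
        case (Inl v)
        then have v: "v \<in> OMap \<Psi> (y', z)" using 1(5) by (auto simp: OMap_biset_union)
        note s = P.D.comp_stepI[where A = C and E = E and \<Omega> = \<Omega>, OF 1(1,4) v]
        have "P.cls x z (y', act \<Omega> (Ident C x) \<beta> u, v) = P.cls x z (y, u, act \<Psi> \<beta> (Ident E z) v)"
          using P.cls_eq_iff[OF xz P.comp_step_in_pairs[OF xz s]] s by (auto intro: r_into_equivclp)
        then show ?thesis
          using v by (simp add: \<pi>_def 1(6,7) Inl act_union[OF 1(1) i] InlI InrI)
      next
        case (Inr v)
        then have v: "v \<in> OMap \<Psi>' (y', z)" using 1(5) by (auto simp: OMap_biset_union)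
        note s = P.D.comp_stepI[where A = C and E = E and \<Omega> = \<Omega>, OF 1(1,4) v]
        have "P'.cls x z (y', act \<Omega> (Ident C x) \<beta> u, v) = P'.cls x z (y, u, act \<Psi>' \<beta> (Ident E z) v)"
          using P'.cls_eq_iff[OF xz P'.comp_step_in_pairs[OF xz s]] s by (auto intro: r_into_equivclp)
        then show ?thesis
          using v by (simp add: \<pi>_def 1(6,7) Inr act_union[OF 1(1) i] InlI InrI)
      qed
    qed
  next
    fix x z p q
    assume xz: "x \<in> Ob C" "z \<in> Ob E" and p: "p \<in> U.pairs x z" and q: "q \<in> U.pairs x z"
      and eq: "\<pi> x z p = \<pi> x z q"
    from p[unfolded pairs] show "equivclp (U.stp x z) p q"
    proof
      assume "p \<in> (\<lambda>(y, u, v). (y, u, Inl v)) ` P.pairs x z"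
      then obtain a where a: "a \<in> P.pairs x z" "p = (case a of (y, u, v) \<Rightarrow> (y, u, Inl v))" by blast
      then obtain b where b: "b \<in> P.pairs x z" "q = (case b of (y, u, v) \<Rightarrow> (y, u, Inl v))"
        using q[unfolded pairs] eq by (elim UnE imageE) (simp_all add: \<pi>)
      have "equivclp (P.stp x z) a b"
        using eq P.cls_eq_iff[OF xz a(1) b(1)] by (simp add: a(2) b(2) \<pi>)
      then show ?thesis unfolding a(2) b(2)
        by (rule equivclp_map) (intro r_into_equivclp stepL xz)
    next
      assume "p \<in> (\<lambda>(y, u, v). (y, u, Inr v)) ` P'.pairs x z"
      then obtain a where a: "a \<in> P'.pairs x z" "p = (case a of (y, u, v) \<Rightarrow> (y, u, Inr v))" by blast
      then obtain b where b: "b \<in> P'.pairs x z" "q = (case b of (y, u, v) \<Rightarrow> (y, u, Inr v))"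
        using q[unfolded pairs] eq by (elim UnE imageE) (simp_all add: \<pi>)
      have "equivclp (P'.stp x z) a b"
        using eq P'.cls_eq_iff[OF xz a(1) b(1)] by (simp add: a(2) b(2) \<pi>)
      then show ?thesis unfolding a(2) b(2)
        by (rule equivclp_map) (intro r_into_equivclp stepR xz)
    qed
  next
    fix x x' z z' f g p
    assume f: "f \<in> hom_set C x x'" and g: "g \<in> hom_set E z' z" and p: "p \<in> U.pairs x z"
    note act = act_biset_union[OF P.biset_comp P'.biset_comp f g]
    from p[unfolded pairs] show "\<pi> x' z' (pair_act D \<Omega> (biset_union \<Psi> \<Psi>') f g p) =
      act (biset_union (comp_biset C D E \<Omega> \<Psi>) (comp_biset C D E \<Omega> \<Psi>')) f g (\<pi> x z p)"
    proof
      assume "p \<in> (\<lambda>(y, u, v). (y, u, Inl v)) ` P.pairs x z"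
      then obtain y u v where a: "(y, u, v) \<in> P.pairs x z" "p = (y, u, Inl v)" by auto
      then have v: "v \<in> OMap \<Psi> (y, z)" "y \<in> Ob D" by (auto simp: comp_pairs_def)
      have "pair_act D \<Omega> (biset_union \<Psi> \<Psi>') f g p = (case pair_act D \<Omega> \<Psi> f g (y, u, v) of (y, u, v) \<Rightarrow> (y, u, Inl v))"
        using v by (simp add: a(2) pair_act_def act_union[OF P.D.Ident_in_hom g] InlI InrI)
      moreover have "\<pi> x z p = Inl (P.cls x z (y, u, v))" by (simp add: a(2) \<pi>_def)
      ultimately show ?thesis
        using P.cls_in_comp[OF a(1)] by (simp add: act \<pi> InlI InrI P.act_comp_cls[OF f g a(1)])
    next
      assume "p \<in> (\<lambda>(y, u, v). (y, u, Inr v)) ` P'.pairs x z"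
      then obtain y u v where a: "(y, u, v) \<in> P'.pairs x z" "p = (y, u, Inr v)" by auto
      then have v: "v \<in> OMap \<Psi>' (y, z)" "y \<in> Ob D" by (auto simp: comp_pairs_def)
      have "pair_act D \<Omega> (biset_union \<Psi> \<Psi>') f g p = (case pair_act D \<Omega> \<Psi>' f g (y, u, v) of (y, u, v) \<Rightarrow> (y, u, Inr v))"
        using v by (simp add: a(2) pair_act_def act_union[OF P.D.Ident_in_hom g] InlI InrI)
      moreover have "\<pi> x z p = Inr (P'.cls x z (y, u, v))" by (simp add: a(2) \<pi>_def)
      ultimately show ?thesis
        using P'.cls_in_comp[OF a(1)] by (simp add: act \<pi> InlI InrI P'.act_comp_cls[OF f g a(1)])
    qed
  qed
qed

section \<open>Bilinear maps between presented abelian groups\<close>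

text \<open>The biadditive extension of \<open>m\<close> to free abelian groups. The expressions
  inside \<open>comp_K\<close> and \<open>bilinear_extension\<close> are instances of it, so both
  share one calculus.\<close>

definition frag_mult :: "('a \<Rightarrow> 'b \<Rightarrow> 'c) \<Rightarrow> ('a \<Rightarrow>\<^sub>0 int) \<Rightarrow> ('b \<Rightarrow>\<^sub>0 int) \<Rightarrow> ('c \<Rightarrow>\<^sub>0 int)" where
  "frag_mult m s t = frag_extend (\<lambda>x. frag_extend (\<lambda>y. frag_of (m x y)) t) s"

lemma frag_mult_of: "frag_mult m (frag_of x) (frag_of y) = frag_of (m x y)"
  by (simp add: frag_mult_def)

lemma frag_mult_0_left: "frag_mult m 0 t = 0"
  by (simp add: frag_mult_def)

lemma frag_mult_0_right: "frag_mult m s 0 = 0"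
  by (simp add: frag_mult_def frag_extend_eq_0)

lemma frag_mult_add_left: "frag_mult m (s + s') t = frag_mult m s t + frag_mult m s' t"
  by (simp add: frag_mult_def frag_extend_add)

lemma frag_mult_diff_left: "frag_mult m (s - s') t = frag_mult m s t - frag_mult m s' t"
  by (simp add: frag_mult_def frag_extend_diff)

lemma frag_mult_minus_left: "frag_mult m (- s) t = - frag_mult m s t"
  by (simp add: frag_mult_def frag_extend_minus)

lemma frag_mult_add_right: "frag_mult m s (t + t') = frag_mult m s t + frag_mult m s t'"
  by (simp add: frag_mult_def frag_extend_add) (simp add: frag_extend_def frag_cmul_distrib2 sum.distrib)

lemma frag_mult_minus_right: "frag_mult m s (- t) = - frag_mult m s t"
  using frag_mult_add_right[of m s t "- t"] by (simp add: frag_mult_0_right eq_neg_iff_add_eq_0 add.commute)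

lemma frag_mult_diff_right: "frag_mult m s (t - t') = frag_mult m s t - frag_mult m s t'"
  using frag_mult_add_right[of m s t "- t'"] by (simp add: frag_mult_minus_right)

lemma keys_frag_mult:
  assumes "Poly_Mapping.keys s \<subseteq> X" "Poly_Mapping.keys t \<subseteq> Y"
    and "\<And>x y. x \<in> X \<Longrightarrow> y \<in> Y \<Longrightarrow> m x y \<in> Z"
  shows "Poly_Mapping.keys (frag_mult m s t) \<subseteq> Z"
  unfolding frag_mult_def
  by (rule order_trans[OF keys_frag_extend UN_least], rule order_trans[OF keys_frag_extend UN_least])
    (use assms in auto)

text \<open>An abelian group presented by generators \<open>X\<close> and relators \<open>S\<close>.
  Both \<open>biset_K\<close> and \<open>ring_tensor\<close> have this form, so the arithmetic of
  their cosets is done once, additively.\<close>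

locale frag_presentation =
  fixes X :: "'a set" and S :: "('a \<Rightarrow>\<^sub>0 int) set"
  assumes relators: "S \<subseteq> carrier (free_Abelian_group X)"
begin

abbreviation "rels \<equiv> generate (free_Abelian_group X) S"
abbreviation coset :: "('a \<Rightarrow>\<^sub>0 int) \<Rightarrow> ('a \<Rightarrow>\<^sub>0 int) set" where
  "coset a \<equiv> rels #>\<^bsub>free_Abelian_group X\<^esub> a"

lemma subgroup_rels: "subgroup rels (free_Abelian_group X)"
  by (rule group.generate_is_subgroup[OF group_free_Abelian_group relators])

lemma normal_rels: "rels \<lhd> free_Abelian_group X"
  by (rule comm_group.subgroup_imp_normal[OF abelian_free_Abelian_group subgroup_rels])

lemma rels_keys: "n \<in> rels \<Longrightarrow> Poly_Mapping.keys n \<subseteq> X"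
  using subsetD[OF subgroup.subset[OF subgroup_rels]] by simp

lemma rels_0: "0 \<in> rels"
  using subgroup.one_closed[OF subgroup_rels] by simp

lemma rels_add: "n \<in> rels \<Longrightarrow> n' \<in> rels \<Longrightarrow> n + n' \<in> rels"
  using subgroup.m_closed[OF subgroup_rels] by simp

lemma rels_minus: "n \<in> rels \<Longrightarrow> - n \<in> rels"
  using subgroup.m_inv_closed[OF subgroup_rels] rels_keys by fastforce

lemma rels_diff: "n \<in> rels \<Longrightarrow> n' \<in> rels \<Longrightarrow> n - n' \<in> rels"
  using rels_add[of n "- n'"] rels_minus by simp

lemma coset_iff: "s \<in> coset a \<longleftrightarrow> (\<exists>n\<in>rels. s = n + a)"
  by (auto simp: r_coset_def)

lemma coset_eqI:
  assumes "a - b \<in> rels"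
  shows "coset a = coset b"
proof (intro Set.set_eqI iffI)
  fix s assume "s \<in> coset a"
  then obtain n where "n \<in> rels" "s = n + a" by (auto simp: coset_iff)
  then show "s \<in> coset b"
    unfolding coset_iff using assms rels_add by (intro bexI[of _ "n + (a - b)"]) auto
next
  fix s assume "s \<in> coset b"
  then obtain n where "n \<in> rels" "s = n + b" by (auto simp: coset_iff)
  then show "s \<in> coset a"
    unfolding coset_iff using assms rels_diff by (intro bexI[of _ "n - (a - b)"]) auto
qed

lemma group_quotient: "group (free_Abelian_group X Mod rels)"
  by (rule normal.factorgroup_is_group[OF normal_rels])

lemma coset_in_quotient:
  "Poly_Mapping.keys a \<subseteq> X \<Longrightarrow> coset a \<in> carrier (free_Abelian_group X Mod rels)"
  by (auto simp: FactGroup_def RCOSETS_def)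

lemma quotient_cases:
  assumes "A \<in> carrier (free_Abelian_group X Mod rels)"
  obtains a where "Poly_Mapping.keys a \<subseteq> X" "A = coset a"
  using assms by (auto simp: FactGroup_def RCOSETS_def)

lemma quotient_mult:
  assumes "Poly_Mapping.keys a \<subseteq> X" "Poly_Mapping.keys b \<subseteq> X"
  shows "coset a \<otimes>\<^bsub>free_Abelian_group X Mod rels\<^esub> coset b = coset (a + b)"
  using normal.rcos_sum[OF normal_rels, of a b] assms by (simp add: FactGroup_def)

end

text \<open>Compatibility is required only for a relator against a single generator, on either side;
  arbitrary relations against arbitrary elements follow by biadditivity.\<close>

locale frag_bilinear =
  X: frag_presentation X S + Y: frag_presentation Y T + Z: frag_presentation Z U
  for X :: "'a set" and S and Y :: "'b set" and T and Z :: "'c set" and U +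
  fixes m :: "'a \<Rightarrow> 'b \<Rightarrow> 'c"
  assumes m_closed: "x \<in> X \<Longrightarrow> y \<in> Y \<Longrightarrow> m x y \<in> Z"
    and left: "s \<in> S \<Longrightarrow> y \<in> Y \<Longrightarrow> frag_mult m s (frag_of y) \<in> Z.rels"
    and right: "x \<in> X \<Longrightarrow> t \<in> T \<Longrightarrow> frag_mult m (frag_of x) t \<in> Z.rels"
begin

lemma frag_mult_closed:
  "Poly_Mapping.keys s \<subseteq> X \<Longrightarrow> Poly_Mapping.keys t \<subseteq> Y \<Longrightarrow> Poly_Mapping.keys (frag_mult m s t) \<subseteq> Z"
  by (rule keys_frag_mult[OF _ _ m_closed])

text \<open>Two inductions: over the subgroup generated by the relators, with a fixed generator on
  the right, and then over the free abelian group containing \<open>t\<close>.\<close>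

lemma rels_left:
  assumes s: "s \<in> X.rels" and t: "Poly_Mapping.keys t \<subseteq> Y"
  shows "frag_mult m s t \<in> Z.rels"
proof -
  have *: "frag_mult m s (frag_of y) \<in> Z.rels" if y: "y \<in> Y" for y
    using s
  proof (induction rule: generate.induct)
    case one then show ?case by (simp add: frag_mult_0_left Z.rels_0)
  next
    case (incl h) then show ?case using left y by blast
  next
    case (inv h)
    then have "Poly_Mapping.keys h \<subseteq> X" using subsetD[OF X.relators] by simp
    then show ?case using left[OF inv y] by (simp add: frag_mult_minus_left Z.rels_minus)
  next
    case (eng h h') then show ?case by (simp add: frag_mult_add_left Z.rels_add)
  qed
  show ?thesis
    by (rule free_Abelian_group_induct[OF t])
      (auto simp: frag_mult_0_right frag_mult_diff_right Z.rels_0 intro: * Z.rels_diff)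
qed

lemma rels_right:
  assumes s: "Poly_Mapping.keys s \<subseteq> X" and t: "t \<in> Y.rels"
  shows "frag_mult m s t \<in> Z.rels"
proof -
  have *: "frag_mult m (frag_of x) t \<in> Z.rels" if x: "x \<in> X" for x
    using t
  proof (induction rule: generate.induct)
    case one then show ?case by (simp add: frag_mult_0_right Z.rels_0)
  next
    case (incl h) then show ?case using right x by blast
  next
    case (inv h)
    then have "Poly_Mapping.keys h \<subseteq> Y" using subsetD[OF Y.relators] by simp
    then show ?case using right[OF x inv] by (simp add: frag_mult_minus_right Z.rels_minus)
  next
    case (eng h h') then show ?case by (simp add: frag_mult_add_right Z.rels_add)
  qed
  show ?thesis
    by (rule free_Abelian_group_induct[OF s])
      (auto simp: frag_mult_0_left frag_mult_diff_left Z.rels_0 intro: * Z.rels_diff)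
qed

text \<open>Expanding the product of \<open>n + a\<close> and \<open>k + b\<close> leaves the
  product of \<open>a\<close> and \<open>b\<close> plus three terms, each with a relation as a
  factor. All cosets in the union therefore agree, and there is at least one since \<open>a\<close>
  and \<open>b\<close> represent their own cosets. This evaluates the operations defined by unions
  over representatives.\<close>

lemma Union_cosets:
  assumes a: "Poly_Mapping.keys a \<subseteq> X" and b: "Poly_Mapping.keys b \<subseteq> Y"
  shows "(\<Union>s\<in>X.coset a. \<Union>t\<in>Y.coset b. Z.coset (frag_mult m s t)) = Z.coset (frag_mult m a b)"
proof -
  have "Z.coset (frag_mult m s t) = Z.coset (frag_mult m a b)" if st: "s \<in> X.coset a" "t \<in> Y.coset b" for s t
  proof (rule Z.coset_eqI)
    obtain n k where n: "n \<in> X.rels" "s = n + a" and k: "k \<in> Y.rels" "t = k + b"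
      using st unfolding X.coset_iff Y.coset_iff by blast
    have "frag_mult m n k \<in> Z.rels" "frag_mult m n b \<in> Z.rels" "frag_mult m a k \<in> Z.rels"
      using rels_left[OF n(1)] rels_right[OF _ k(1)] Y.rels_keys[OF k(1)] a b by blast+
    moreover have "frag_mult m s t - frag_mult m a b = frag_mult m n k + frag_mult m n b + frag_mult m a k"
      by (simp add: n k frag_mult_add_left frag_mult_add_right)
    ultimately show "frag_mult m s t - frag_mult m a b \<in> Z.rels"
      by (simp add: Z.rels_add)
  qed
  moreover have "a \<in> X.coset a" "b \<in> Y.coset b"
    using X.rels_0 Y.rels_0 by (force simp: X.coset_iff Y.coset_iff)+
  ultimately show ?thesis by blast
qed

end

section \<open>Composition in the biset category\<close>

definition union_relators :: "('o, 'm) cat \<Rightarrow> ('p, 'n) cat \<Rightarrow> (('o, 'm, 'p, 'n) biset_class \<Rightarrow>\<^sub>0 int) set" where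
  "union_relators C D =
     {frag_of (iso_class C D (biset_union \<Omega> \<Psi>)) - frag_of (iso_class C D \<Omega>) - frag_of (iso_class C D \<Psi>)
       | (\<Omega> :: ('o, 'm, 'p, 'n, nat) biset) (\<Psi> :: ('o, 'm, 'p, 'n, nat) biset).
         is_biset C D \<Omega> \<and> is_biset C D \<Psi>}"

lemma K_rel_eq: "K_rel C D = generate (free_Abelian_group (biset_classes C D)) (union_relators C D)"
  by (simp add: K_rel_def union_relators_def)

lemma keys_relator:
  assumes "a \<in> X" "b \<in> X" "c \<in> X"
  shows "Poly_Mapping.keys (frag_of a - frag_of b - frag_of c) \<subseteq> X"
proof -
  have "Poly_Mapping.keys (frag_of a - frag_of b) \<subseteq> X"
    by (rule order_trans[OF keys_diff]) (use assms in simp)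
  then show ?thesis
    by (intro order_trans[OF keys_diff]) (use assms in simp)
qed

lemma biset_classesE:
  assumes "U \<in> biset_classes C D" "category C" "category D"
  obtains \<Omega> :: "('o, 'm, 'p, 'n, nat) biset" where "biset C D \<Omega>" "U = iso_class C D \<Omega>"
  using assms by (auto simp: biset_classes_def biset_def biset_axioms_def)

lemma union_relatorsE:
  assumes "s \<in> union_relators C D" "category C" "category D"
  obtains \<Omega> \<Psi> :: "('o, 'm, 'p, 'n, nat) biset" where "biset C D \<Omega>" "biset C D \<Psi>"
    "s = frag_of (iso_class C D (biset_union \<Omega> \<Psi>)) - frag_of (iso_class C D \<Omega>) - frag_of (iso_class C D \<Psi>)"
  using assms by (auto simp: union_relators_def biset_def biset_axioms_def)

lemma frag_presentation_K:
  assumes "category C" "category D"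
  shows "frag_presentation (biset_classes C D) (union_relators C D)"
proof
  have "frag_of (iso_class C D (biset_union \<Omega> \<Psi>)) - frag_of (iso_class C D \<Omega>) - frag_of (iso_class C D \<Psi>)
      \<in> carrier (free_Abelian_group (biset_classes C D))"
    if "is_biset C D \<Omega>" "is_biset C D \<Psi>" for \<Omega> \<Psi> :: "('a, 'b, 'c, 'd, nat) biset"
  proof -
    have bis: "biset C D \<Omega>" "biset C D \<Psi>" using that assms by (auto simp: biset_def biset_axioms_def)
    show ?thesis
      unfolding carrier_free_Abelian_group_iff
      by (intro keys_relator biset.iso_class_in_biset_classes biset_biset_union bis)
  qed
  then show "union_relators C D \<subseteq> carrier (free_Abelian_group (biset_classes C D))"
    unfolding union_relators_def by blast
qed

text \<open>The defining relators involve \<open>nat\<close>-valued bisets only. For other element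
  types both summands are replaced by \<open>nat\<close>-valued copies, whose union is isomorphic to
  the original one. Composites need this generality.\<close>

lemma union_in_K_rel:
  assumes bis: "biset C D \<Omega>" "biset C D \<Psi>"
  shows "frag_of (iso_class C D (biset_union \<Omega> \<Psi>)) - frag_of (iso_class C D \<Omega>) - frag_of (iso_class C D \<Psi>)
    \<in> K_rel C D"
proof -
  interpret \<Omega>: biset C D \<Omega> by fact
  interpret \<Psi>: biset C D \<Psi> by fact
  obtain \<Omega>' :: "('a, 'b, 'c, 'd, nat) biset" where \<Omega>': "is_biset C D \<Omega>'" "biset_iso C D \<Omega> \<Omega>'"
    by (rule \<Omega>.ex_nat_biset)
  obtain \<Psi>' :: "('a, 'b, 'c, 'd, nat) biset" where \<Psi>': "is_biset C D \<Psi>'" "biset_iso C D \<Psi> \<Psi>'"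
    by (rule \<Psi>.ex_nat_biset)
  have bis': "biset C D \<Omega>'" "biset C D \<Psi>'"
    using \<Omega>'(1) \<Psi>'(1) \<Omega>.C.category_axioms \<Omega>.D.category_axioms by (auto simp: biset_def biset_axioms_def)
  have "iso_class C D (biset_union \<Omega> \<Psi>) = iso_class C D (biset_union \<Omega>' \<Psi>')"
    by (intro iso_class_eqI biset_biset_union biset_iso_union bis bis' \<Omega>' \<Psi>')
  moreover have "iso_class C D \<Omega> = iso_class C D \<Omega>'" "iso_class C D \<Psi> = iso_class C D \<Psi>'"
    by (intro iso_class_eqI bis \<Omega>' \<Psi>')+
  ultimately show ?thesis
    unfolding K_rel_eq union_relators_def using \<Omega>'(1) \<Psi>'(1) by (intro generate.incl CollectI) metis
qed

text \<open>The union defining \<open>comp_class\<close> collapses: composites of isomorphic bisets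
  are isomorphic, so all its members are the same class, and \<open>nat\<close>-valued
  representatives exist on both sides.\<close>

lemma comp_class_iso_class:
  assumes D: "finite_category D" and bis: "biset C D \<Omega>" "biset D E \<Psi>"
  shows "comp_class C D E (iso_class C D \<Omega>) (iso_class D E \<Psi>) = iso_class C E (comp_biset C D E \<Omega> \<Psi>)"
proof -
  interpret P: composable_bisets C D E \<Omega> \<Psi> by (intro composable_bisetsI assms)
  have *: "iso_class C E (comp_biset C D E \<Omega>' \<Psi>') = iso_class C E (comp_biset C D E \<Omega> \<Psi>)"
    if "\<Omega>' \<in> iso_class C D \<Omega>" "\<Psi>' \<in> iso_class D E \<Psi>" for \<Omega>' \<Psi>'
  proof (rule sym, rule iso_class_eqI[OF P.biset_comp], rule comp_biset_cong[OF D bis])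
    show "biset C D \<Omega>'" "biset D E \<Psi>'" "biset_iso C D \<Omega> \<Omega>'" "biset_iso D E \<Psi> \<Psi>'"
      using that P.\<Omega>.C.category_axioms P.D.category_axioms P.\<Psi>.D.category_axioms
      by (auto simp: iso_class_def biset_def biset_axioms_def)
  qed
  obtain \<Omega>' where "\<Omega>' \<in> iso_class C D \<Omega>"
    by (rule P.\<Omega>.ex_nat_biset) (auto simp: iso_class_def)
  moreover obtain \<Psi>' where "\<Psi>' \<in> iso_class D E \<Psi>"
    by (rule P.\<Psi>.ex_nat_biset) (auto simp: iso_class_def)
  ultimately show ?thesis
    unfolding comp_class_def using * by blast
qed

text \<open>Composition distributes over disjoint unions up to isomorphism, so a relator composed
  with a class is the relator of two composites. These composites are not \<open>nat\<close>-valued,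
  hence the appeal to \<open>union_in_K_rel\<close>.\<close>

lemma frag_bilinear_K:
  fixes C :: "('a, 'b) cat" and D :: "('c, 'd) cat" and E :: "('e, 'f) cat"
  assumes C: "category C" and D: "finite_category D" and E: "category E"
  shows "frag_bilinear (biset_classes C D) (union_relators C D) (biset_classes D E) (union_relators D E)
    (biset_classes C E) (union_relators C E) (comp_class C D E)"
proof -
  interpret D: finite_category D by fact
  note catD = D.category_axioms
  interpret X: frag_presentation "biset_classes C D" "union_relators C D" by (rule frag_presentation_K[OF C catD])
  interpret Y: frag_presentation "biset_classes D E" "union_relators D E" by (rule frag_presentation_K[OF catD E])
  interpret Z: frag_presentation "biset_classes C E" "union_relators C E" by (rule frag_presentation_K[OF C E])
  have biset_comp: "biset C E (comp_biset C D E \<Omega> \<Psi>)" if "biset C D \<Omega>" "biset D E \<Psi>" for \<Omega> \<Psi>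
    by (intro composable_bisets.biset_comp composable_bisetsI D that)
  show ?thesis
  proof
    fix U V assume UV: "U \<in> biset_classes C D" "V \<in> biset_classes D E"
    obtain \<Omega> :: "('a, 'b, 'c, 'd, nat) biset" where b: "biset C D \<Omega>" "U = iso_class C D \<Omega>"
      by (rule biset_classesE[OF UV(1) C catD])
    obtain \<Psi> :: "('c, 'd, 'e, 'f, nat) biset" where b': "biset D E \<Psi>" "V = iso_class D E \<Psi>"
      by (rule biset_classesE[OF UV(2) catD E])
    from b b' show "comp_class C D E U V \<in> biset_classes C E"
      by (simp add: comp_class_iso_class[OF D] biset.iso_class_in_biset_classes[OF biset_comp])
  next
    fix s V assume sV: "s \<in> union_relators C D" "V \<in> biset_classes D E"
    obtain \<Psi> :: "('c, 'd, 'e, 'f, nat) biset" where b3: "biset D E \<Psi>" and V: "V = iso_class D E \<Psi>"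
      by (rule biset_classesE[OF sV(2) catD E])
    obtain \<Omega> \<Omega>' :: "('a, 'b, 'c, 'd, nat) biset" where b12: "biset C D \<Omega>" "biset C D \<Omega>'"
      and s: "s = frag_of (iso_class C D (biset_union \<Omega> \<Omega>')) - frag_of (iso_class C D \<Omega>) - frag_of (iso_class C D \<Omega>')"
      by (rule union_relatorsE[OF sV(1) C catD])
    note b = b12 b3
    have "iso_class C E (comp_biset C D E (biset_union \<Omega> \<Omega>') \<Psi>) =
        iso_class C E (biset_union (comp_biset C D E \<Omega> \<Psi>) (comp_biset C D E \<Omega>' \<Psi>))"
      by (intro iso_class_eqI comp_biset_union_left biset_comp biset_biset_union b D)
    then have "frag_mult (comp_class C D E) s (frag_of V) =
        frag_of (iso_class C E (biset_union (comp_biset C D E \<Omega> \<Psi>) (comp_biset C D E \<Omega>' \<Psi>)))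
        - frag_of (iso_class C E (comp_biset C D E \<Omega> \<Psi>)) - frag_of (iso_class C E (comp_biset C D E \<Omega>' \<Psi>))"
      by (simp add: s V frag_mult_diff_left frag_mult_of comp_class_iso_class[OF D] b biset_biset_union)
    then show "frag_mult (comp_class C D E) s (frag_of V) \<in> Z.rels"
      using union_in_K_rel[OF biset_comp[OF b(1,3)] biset_comp[OF b(2,3)]] by (simp add: K_rel_eq)
  next
    fix t U assume Ut: "U \<in> biset_classes C D" "t \<in> union_relators D E"
    obtain \<Omega> :: "('a, 'b, 'c, 'd, nat) biset" where b3: "biset C D \<Omega>" and U: "U = iso_class C D \<Omega>"
      by (rule biset_classesE[OF Ut(1) C catD])
    obtain \<Psi> \<Psi>' :: "('c, 'd, 'e, 'f, nat) biset" where b12: "biset D E \<Psi>" "biset D E \<Psi>'"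
      and t: "t = frag_of (iso_class D E (biset_union \<Psi> \<Psi>')) - frag_of (iso_class D E \<Psi>) - frag_of (iso_class D E \<Psi>')"
      by (rule union_relatorsE[OF Ut(2) catD E])
    note b = b12 b3
    have "iso_class C E (comp_biset C D E \<Omega> (biset_union \<Psi> \<Psi>')) =
        iso_class C E (biset_union (comp_biset C D E \<Omega> \<Psi>) (comp_biset C D E \<Omega> \<Psi>'))"
      by (intro iso_class_eqI comp_biset_union_right biset_comp biset_biset_union b D)
    then have "frag_mult (comp_class C D E) (frag_of U) t =
        frag_of (iso_class C E (biset_union (comp_biset C D E \<Omega> \<Psi>) (comp_biset C D E \<Omega> \<Psi>')))
        - frag_of (iso_class C E (comp_biset C D E \<Omega> \<Psi>)) - frag_of (iso_class C E (comp_biset C D E \<Omega> \<Psi>'))"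
      by (simp add: t U frag_mult_diff_right frag_mult_of comp_class_iso_class[OF D] b biset_biset_union)
    then show "frag_mult (comp_class C D E) (frag_of U) t \<in> Z.rels"
      using union_in_K_rel[OF biset_comp[OF b(3,1)] biset_comp[OF b(3,2)]] by (simp add: K_rel_eq)
  qed
qed

lemma group_biset_K: "category C \<Longrightarrow> category D \<Longrightarrow> group (biset_K C D)"
  unfolding biset_K_def K_rel_eq by (intro frag_presentation.group_quotient frag_presentation_K)

lemma K_class_in_biset_K: "biset C D \<Omega> \<Longrightarrow> K_class C D \<Omega> \<in> carrier (biset_K C D)"
  unfolding biset_K_def K_rel_eq K_class_def
  by (intro frag_presentation.coset_in_quotient frag_presentation_K)
    (auto simp: biset_def biset_axioms_def biset.iso_class_in_biset_classes)

section \<open>Biadditivity of composition on Grothendieck groups\<close>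

context
  fixes C :: "('o, 'm) cat" and D :: "('p, 'n) cat" and E :: "('q, 'k) cat"
  assumes C: "category C" and D: "finite_category D" and E: "category E"
begin

interpretation D: finite_category D by (rule D)

interpretation B: frag_bilinear "biset_classes C D" "union_relators C D" "biset_classes D E" "union_relators D E"
    "biset_classes C E" "union_relators C E" "comp_class C D E"
  by (rule frag_bilinear_K[OF C D E])

lemma comp_K_cosets:
  assumes "Poly_Mapping.keys a \<subseteq> biset_classes C D" "Poly_Mapping.keys b \<subseteq> biset_classes D E"
  shows "comp_K C D E (B.X.coset a) (B.Y.coset b) = B.Z.coset (frag_mult (comp_class C D E) a b)"
  using B.Union_cosets[OF assms] by (simp add: comp_K_def K_rel_eq frag_mult_def)

lemma comp_K_K_class:
  assumes "biset C D \<Omega>" "biset D E \<Psi>"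
  shows "comp_K C D E (K_class C D \<Omega>) (K_class D E \<Psi>) = K_class C E (comp_biset C D E \<Omega> \<Psi>)"
  using comp_K_cosets[of "frag_of (iso_class C D \<Omega>)" "frag_of (iso_class D E \<Psi>)"] assms
  by (simp add: K_class_def K_rel_eq biset.iso_class_in_biset_classes frag_mult_of comp_class_iso_class[OF D])

lemma comp_K_closed:
  assumes "A \<in> carrier (biset_K C D)" "B \<in> carrier (biset_K D E)"
  shows "comp_K C D E A B \<in> carrier (biset_K C E)"
proof -
  obtain a b where ab: "Poly_Mapping.keys a \<subseteq> biset_classes C D" "A = B.X.coset a"
    "Poly_Mapping.keys b \<subseteq> biset_classes D E" "B = B.Y.coset b"
    using assms unfolding biset_K_def K_rel_eq by (metis B.X.quotient_cases B.Y.quotient_cases)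
  then show ?thesis
    by (simp add: comp_K_cosets biset_K_def K_rel_eq B.Z.coset_in_quotient B.frag_mult_closed)
qed

lemma comp_K_mult_left:
  assumes "A \<in> carrier (biset_K C D)" "A' \<in> carrier (biset_K C D)" "B \<in> carrier (biset_K D E)"
  shows "comp_K C D E (A \<otimes>\<^bsub>biset_K C D\<^esub> A') B = comp_K C D E A B \<otimes>\<^bsub>biset_K C E\<^esub> comp_K C D E A' B"
proof -
  obtain a a' b where ab: "Poly_Mapping.keys a \<subseteq> biset_classes C D" "A = B.X.coset a"
    "Poly_Mapping.keys a' \<subseteq> biset_classes C D" "A' = B.X.coset a'"
    "Poly_Mapping.keys b \<subseteq> biset_classes D E" "B = B.Y.coset b"
    using assms unfolding biset_K_def K_rel_eq by (metis B.X.quotient_cases B.Y.quotient_cases)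
  have "Poly_Mapping.keys (a + a') \<subseteq> biset_classes C D"
    using ab(1,3) keys_add[of a a'] by blast
  then show ?thesis
    using ab by (simp add: comp_K_cosets biset_K_def K_rel_eq B.X.quotient_mult B.Z.quotient_mult
        B.frag_mult_closed frag_mult_add_left del: mult_FactGroup)
qed

lemma comp_K_mult_right:
  assumes "A \<in> carrier (biset_K C D)" "B \<in> carrier (biset_K D E)" "B' \<in> carrier (biset_K D E)"
  shows "comp_K C D E A (B \<otimes>\<^bsub>biset_K D E\<^esub> B') = comp_K C D E A B \<otimes>\<^bsub>biset_K C E\<^esub> comp_K C D E A B'"
proof -
  obtain a b b' where ab: "Poly_Mapping.keys a \<subseteq> biset_classes C D" "A = B.X.coset a"
    "Poly_Mapping.keys b \<subseteq> biset_classes D E" "B = B.Y.coset b"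
    "Poly_Mapping.keys b' \<subseteq> biset_classes D E" "B' = B.Y.coset b'"
    using assms unfolding biset_K_def K_rel_eq by (metis B.X.quotient_cases B.Y.quotient_cases)
  have "Poly_Mapping.keys (b + b') \<subseteq> biset_classes D E"
    using ab(3,5) keys_add[of b b'] by blast
  then show ?thesis
    using ab by (simp add: comp_K_cosets biset_K_def K_rel_eq B.Y.quotient_mult B.Z.quotient_mult
        B.frag_mult_closed frag_mult_add_right del: mult_FactGroup)
qed

end

section \<open>Pure tensors and the bilinear extension\<close>

definition tensor_relators :: "('r, 'z) ring_scheme \<Rightarrow> ('a, 'b) monoid_scheme \<Rightarrow> ('r \<times> 'a \<Rightarrow>\<^sub>0 int) set" where
  "tensor_relators R A =
      {frag_of (r \<oplus>\<^bsub>R\<^esub> s, a) - frag_of (r, a) - frag_of (s, a)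
        | r s a. r \<in> carrier R \<and> s \<in> carrier R \<and> a \<in> carrier A} \<union>
      {frag_of (r, a \<otimes>\<^bsub>A\<^esub> b) - frag_of (r, a) - frag_of (r, b)
        | r a b. r \<in> carrier R \<and> a \<in> carrier A \<and> b \<in> carrier A}"

lemma tensor_rel_eq:
  "tensor_rel R A = generate (free_Abelian_group (carrier R \<times> carrier A)) (tensor_relators R A)"
  by (simp add: tensor_rel_def tensor_relators_def)

lemma frag_presentation_tensor:
  assumes "ring R" "group A"
  shows "frag_presentation (carrier R \<times> carrier A) (tensor_relators R A)"
proof
  interpret R: ring R by fact
  interpret A: group A by fact
  show "tensor_relators R A \<subseteq> carrier (free_Abelian_group (carrier R \<times> carrier A))"
    unfolding tensor_relators_def
    by (intro subsetI; elim UnE CollectE exE conjE; simp only: carrier_free_Abelian_group_iff)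
      (intro keys_relator; simp)+
qed

lemma pure_tensor_in_ring_tensor:
  assumes "ring R" "group A" "r \<in> carrier R" "a \<in> carrier A"
  shows "pure_tensor R A r a \<in> carrier (ring_tensor R A)"
  unfolding pure_tensor_def ring_tensor_def tensor_rel_eq
  by (rule frag_presentation.coset_in_quotient[OF frag_presentation_tensor]) (use assms in auto)

text \<open>On generators the product is \<open>m\<close>, which multiplies scalars and applies
  \<open>\<phi>\<close>. Relators from addition in \<open>R\<close> are respected by distributivity,
  those from \<open>A\<close> and \<open>B\<close> by biadditivity of \<open>\<phi>\<close>; each
  goes to a relator of the same kind over \<open>M\<close>. The coset computation for presented
  groups then applies.\<close>

lemma bilinear_extension_pure_tensor:
  assumes R: "cring R" and "group A" "group B" "group M"
    and closed: "\<And>a b. a \<in> carrier A \<Longrightarrow> b \<in> carrier B \<Longrightarrow> \<phi> a b \<in> carrier M"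
    and left: "\<And>a a' b. \<lbrakk>a \<in> carrier A; a' \<in> carrier A; b \<in> carrier B\<rbrakk> \<Longrightarrow>
        \<phi> (a \<otimes>\<^bsub>A\<^esub> a') b = \<phi> a b \<otimes>\<^bsub>M\<^esub> \<phi> a' b"
    and right: "\<And>a b b'. \<lbrakk>a \<in> carrier A; b \<in> carrier B; b' \<in> carrier B\<rbrakk> \<Longrightarrow>
        \<phi> a (b \<otimes>\<^bsub>B\<^esub> b') = \<phi> a b \<otimes>\<^bsub>M\<^esub> \<phi> a b'"
    and r: "r \<in> carrier R" "s \<in> carrier R" and ab: "a \<in> carrier A" "b \<in> carrier B"
  shows "bilinear_extension R M \<phi> (pure_tensor R A r a) (pure_tensor R B s b) =
    pure_tensor R M (r \<otimes>\<^bsub>R\<^esub> s) (\<phi> a b)"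
proof -
  interpret R: cring R by fact
  interpret A: group A by fact
  interpret B: group B by fact
  interpret M: group M by fact
  define m where "m = (\<lambda>(r, a) (r', b). (r \<otimes>\<^bsub>R\<^esub> r', \<phi> a b))"
  interpret X: frag_presentation "carrier R \<times> carrier A" "tensor_relators R A"
    by (rule frag_presentation_tensor) unfold_locales
  interpret Y: frag_presentation "carrier R \<times> carrier B" "tensor_relators R B"
    by (rule frag_presentation_tensor) unfold_locales
  interpret Z: frag_presentation "carrier R \<times> carrier M" "tensor_relators R M"
    by (rule frag_presentation_tensor) unfold_locales
  have relator1: "frag_of (r \<oplus>\<^bsub>R\<^esub> s, a) - frag_of (r, a) - frag_of (s, a) \<in> Z.rels"
    if "r \<in> carrier R" "s \<in> carrier R" "a \<in> carrier M" for r s a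
    by (rule generate.incl) (use that in \<open>auto simp: tensor_relators_def\<close>)
  have relator2: "frag_of (r, a \<otimes>\<^bsub>M\<^esub> b) - frag_of (r, a) - frag_of (r, b) \<in> Z.rels"
    if "r \<in> carrier R" "a \<in> carrier M" "b \<in> carrier M" for r a b
    by (rule generate.incl) (use that in \<open>auto simp: tensor_relators_def\<close>)
  interpret frag_bilinear "carrier R \<times> carrier A" "tensor_relators R A" "carrier R \<times> carrier B"
    "tensor_relators R B" "carrier R \<times> carrier M" "tensor_relators R M" m
  proof
    fix p q assume "p \<in> carrier R \<times> carrier A" "q \<in> carrier R \<times> carrier B"
    then show "m p q \<in> carrier R \<times> carrier M" by (auto simp: m_def closed)
  next
    fix t q assume t: "t \<in> tensor_relators R A" and "q \<in> carrier R \<times> carrier B"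
    then obtain r' b where q: "q = (r', b)" "r' \<in> carrier R" "b \<in> carrier B" by auto
    from t[unfolded tensor_relators_def] show "frag_mult m t (frag_of q) \<in> Z.rels"
      by (elim UnE CollectE exE conjE)
        (simp_all add: q frag_mult_diff_left frag_mult_of m_def R.l_distr left closed relator1 relator2)
  next
    fix t q assume "q \<in> carrier R \<times> carrier A" and t: "t \<in> tensor_relators R B"
    then obtain r' a where q: "q = (r', a)" "r' \<in> carrier R" "a \<in> carrier A" by auto
    from t[unfolded tensor_relators_def] show "frag_mult m (frag_of q) t \<in> Z.rels"
      by (elim UnE CollectE exE conjE)
        (simp_all add: q frag_mult_diff_right frag_mult_of m_def R.r_distr right closed relator1 relator2)
  qed
  have "frag_extend (\<lambda>(r, a). frag_extend (\<lambda>(r', b). frag_of (r \<otimes>\<^bsub>R\<^esub> r', \<phi> a b)) t) s = frag_mult m s t" for s t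
    by (simp add: frag_mult_def m_def case_prod_unfold)
  then show ?thesis
    using Union_cosets[of "frag_of (r, a)" "frag_of (s, b)"] r ab
    by (simp add: bilinear_extension_def pure_tensor_def tensor_rel_eq frag_mult_of) (simp add: m_def)
qed

section \<open>Bisets of morphisms between two functors\<close>

lemma functor_Ob: "is_functor C D F \<Longrightarrow> x \<in> Ob C \<Longrightarrow> OMap F x \<in> Ob D"
  by (simp add: is_functor_def)

lemma functor_Ident: "is_functor C D F \<Longrightarrow> x \<in> Ob C \<Longrightarrow> AMap F (Ident C x) = Ident D (OMap F x)"
  by (simp add: is_functor_def)

lemma (in category) functor_hom:
  "is_functor C D F \<Longrightarrow> f \<in> hom_set C x y \<Longrightarrow> AMap F f \<in> hom_set D (OMap F x) (OMap F y)"
  using hom_set_Ob[of f x y] by (simp add: is_functor_def)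

lemma (in category) functor_Comp:
  "is_functor C D F \<Longrightarrow> f \<in> hom_set C x y \<Longrightarrow> g \<in> hom_set C y z \<Longrightarrow>
     AMap F (g \<cdot> f) = AMap F g \<cdot>\<^bsub>D\<^esub> AMap F f"
  using hom_set_Ob[of f x y] hom_set_Ob[of g y z] by (simp add: is_functor_def)

lemma is_functor_comp_ftr:
  assumes "category C" "category D" "is_functor C D F" "is_functor D E G"
  shows "is_functor C E (comp_ftr G F)"
proof -
  interpret C: category C by fact
  interpret D: category D by fact
  note F = C.functor_hom[OF assms(3)] and G = D.functor_hom[OF assms(4)]
  show ?thesis
    unfolding is_functor_def comp_ftr_def
    using functor_Ob[OF assms(3)] functor_Ob[OF assms(4)] F G functor_Ident[OF assms(3)]
      functor_Ident[OF assms(4)] C.functor_Comp[OF assms(3)] D.functor_Comp[OF assms(4) F F]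
    by simp
qed

lemma is_functor_id_ftr: "is_functor C C id_ftr"
  by (simp add: is_functor_def id_ftr_def)

text \<open>The Hom-bifunctor of \<open>E\<close> restricted along \<open>S\<close> and
  \<open>T\<close>. The contravariant variable is the one of \<open>T\<close>, which agrees with the
  convention for identity bisets: they are the case \<open>S = T = id\<close>.\<close>

definition hom_biset :: "('e, 'k) cat \<Rightarrow> ('o, 'm, 'e, 'k) ftr \<Rightarrow> ('p, 'n, 'e, 'k) ftr \<Rightarrow>
    ('o, 'm) cat \<Rightarrow> ('p, 'n) cat \<Rightarrow> ('o, 'm, 'p, 'n, 'k) biset" where
  "hom_biset E S T C D = \<lparr>OMap = (\<lambda>(x, y). hom_set E (OMap T y) (OMap S x)),
     AMap = (\<lambda>(f, g).
       (hom_set E (OMap T (Cod D g)) (OMap S (Dom C f)),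
        \<lambda>h\<in>hom_set E (OMap T (Cod D g)) (OMap S (Dom C f)). AMap S f \<cdot>\<^bsub>E\<^esub> h \<cdot>\<^bsub>E\<^esub> AMap T g,
        hom_set E (OMap T (Dom D g)) (OMap S (Cod C f))))\<rparr>"

lemma id_biset_eq_hom_biset: "id_biset C = hom_biset C id_ftr id_ftr C C"
  by (simp add: id_biset_def hom_biset_def id_ftr_def)

lemma OMap_hom_biset: "OMap (hom_biset E S T C D) (x, y) = hom_set E (OMap T y) (OMap S x)"
  by (simp add: hom_biset_def)

lemma act_hom_biset:
  assumes "f \<in> hom_set C x x'" "g \<in> hom_set D y' y" "h \<in> hom_set E (OMap T y) (OMap S x)"
  shows "act (hom_biset E S T C D) f g h = AMap S f \<cdot>\<^bsub>E\<^esub> h \<cdot>\<^bsub>E\<^esub> AMap T g"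
  using assms by (simp add: hom_biset_def act_def hom_set_iff)

lemma biset_hom_biset:
  assumes "category C" "category D" "finite_category E" and S: "is_functor C E S" and T: "is_functor D E T"
  shows "biset C D (hom_biset E S T C D)"
proof -
  interpret C: category C by fact
  interpret D: category D by fact
  interpret E: finite_category E by fact
  note Sh = C.functor_hom[OF S] and Th = D.functor_hom[OF T]
  show ?thesis
  proof (rule bisetI[where \<alpha> = "\<lambda>f g h. AMap S f \<cdot>\<^bsub>E\<^esub> h \<cdot>\<^bsub>E\<^esub> AMap T g"])
    fix x y
    have "hom_set E (OMap T y) (OMap S x) \<subseteq> Arr E" by (auto simp: hom_set_def)
    then show "finite (OMap (hom_biset E S T C D) (x, y))"
      using E.finite_Arr finite_subset by (auto simp: OMap_hom_biset)
  next
    fix x x' y y' f g assume "f \<in> hom_set C x x'" "g \<in> hom_set D y' y"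
    then show "AMap (hom_biset E S T C D) (f, g) = (OMap (hom_biset E S T C D) (x, y),
        \<lambda>h\<in>OMap (hom_biset E S T C D) (x, y). AMap S f \<cdot>\<^bsub>E\<^esub> h \<cdot>\<^bsub>E\<^esub> AMap T g,
        OMap (hom_biset E S T C D) (x', y'))"
      by (simp add: hom_biset_def hom_set_iff)
  next
    fix x x' y y' f g h
    assume "f \<in> hom_set C x x'" "g \<in> hom_set D y' y" "h \<in> OMap (hom_biset E S T C D) (x, y)"
    then show "AMap S f \<cdot>\<^bsub>E\<^esub> h \<cdot>\<^bsub>E\<^esub> AMap T g \<in> OMap (hom_biset E S T C D) (x', y')"
      unfolding OMap_hom_biset by (intro E.Comp_in_hom[OF Th E.Comp_in_hom[OF _ Sh]])
  next
    fix x y h assume "x \<in> Ob C" "y \<in> Ob D" "h \<in> OMap (hom_biset E S T C D) (x, y)"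
    then show "AMap S (Ident C x) \<cdot>\<^bsub>E\<^esub> h \<cdot>\<^bsub>E\<^esub> AMap T (Ident D y) = h"
      by (simp add: OMap_hom_biset functor_Ident[OF S] functor_Ident[OF T] E.Ident_Comp E.Comp_Ident)
  next
    fix x x' x'' y y' y'' f f' g g' h
    assume f: "f \<in> hom_set C x x'" "f' \<in> hom_set C x' x''" and g: "g \<in> hom_set D y' y" "g' \<in> hom_set D y'' y'"
      and "h \<in> OMap (hom_biset E S T C D) (x, y)"
    then have h: "h \<in> hom_set E (OMap T y) (OMap S x)" by (simp add: OMap_hom_biset)
    note Sf = Sh[OF f(1)] Sh[OF f(2)] and Tg = Th[OF g(1)] Th[OF g(2)]
    have "AMap S (f' \<cdot>\<^bsub>C\<^esub> f) \<cdot>\<^bsub>E\<^esub> h \<cdot>\<^bsub>E\<^esub> AMap T (g \<cdot>\<^bsub>D\<^esub> g') =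
        AMap S f' \<cdot>\<^bsub>E\<^esub> AMap S f \<cdot>\<^bsub>E\<^esub> h \<cdot>\<^bsub>E\<^esub> (AMap T g \<cdot>\<^bsub>E\<^esub> AMap T g')"
      by (simp add: C.functor_Comp[OF S f] D.functor_Comp[OF T g(2,1)])
    also have "\<dots> = AMap S f' \<cdot>\<^bsub>E\<^esub> (AMap S f \<cdot>\<^bsub>E\<^esub> h) \<cdot>\<^bsub>E\<^esub> (AMap T g \<cdot>\<^bsub>E\<^esub> AMap T g')"
      by (simp add: E.Comp_assoc[OF h Sf])
    also have "\<dots> = AMap S f' \<cdot>\<^bsub>E\<^esub> (AMap S f \<cdot>\<^bsub>E\<^esub> h) \<cdot>\<^bsub>E\<^esub> AMap T g \<cdot>\<^bsub>E\<^esub> AMap T g'"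
      by (simp add: E.Comp_assoc[OF Tg(2,1) E.Comp_in_hom[OF E.Comp_in_hom[OF h Sf(1)] Sf(2)]])
    also have "\<dots> = AMap S f' \<cdot>\<^bsub>E\<^esub> (AMap S f \<cdot>\<^bsub>E\<^esub> h \<cdot>\<^bsub>E\<^esub> AMap T g) \<cdot>\<^bsub>E\<^esub> AMap T g'"
      by (simp add: E.Comp_assoc[OF Tg(1) E.Comp_in_hom[OF h Sf(1)] Sf(2)])
    finally show "AMap S (f' \<cdot>\<^bsub>C\<^esub> f) \<cdot>\<^bsub>E\<^esub> h \<cdot>\<^bsub>E\<^esub> AMap T (g \<cdot>\<^bsub>D\<^esub> g') =
        AMap S f' \<cdot>\<^bsub>E\<^esub> (AMap S f \<cdot>\<^bsub>E\<^esub> h \<cdot>\<^bsub>E\<^esub> AMap T g) \<cdot>\<^bsub>E\<^esub> AMap T g'" .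
  qed (rule assms(1,2))+
qed

definition fully_faithful :: "('o, 'm) cat \<Rightarrow> ('p, 'n) cat \<Rightarrow> ('o, 'm, 'p, 'n) ftr \<Rightarrow> bool" where
  "fully_faithful C D F \<longleftrightarrow>
     (\<forall>x\<in>Ob C. \<forall>y\<in>Ob C. bij_betw (AMap F) (hom_set C x y) (hom_set D (OMap F x) (OMap F y)))"

text \<open>The isomorphism is \<open>S\<close> itself: full faithfulness makes it bijective on each
  Hom-set, and preservation of composition is its naturality.\<close>

lemma id_biset_iso_hom_biset:
  assumes "category C" "category E" and S: "is_functor C E S" and ff: "fully_faithful C E S"
  shows "biset_iso C C (id_biset C) (hom_biset E S S C C)"
proof -
  interpret C: category C by fact
  interpret E: category E by fact
  show ?thesis
    unfolding id_biset_eq_hom_biset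
  proof (rule biset_isoI[where \<eta> = "\<lambda>_ _. AMap S"])
    fix x y assume "x \<in> Ob C" "y \<in> Ob C"
    then show "bij_betw (AMap S) (OMap (hom_biset C id_ftr id_ftr C C) (x, y)) (OMap (hom_biset E S S C C) (x, y))"
      using ff by (simp add: fully_faithful_def OMap_hom_biset id_ftr_def)
  next
    fix x x' y y' f g h
    assume f: "f \<in> hom_set C x x'" and g: "g \<in> hom_set C y' y"
      and "h \<in> OMap (hom_biset C id_ftr id_ftr C C) (x, y)"
    then have h: "h \<in> hom_set C y x" by (simp add: OMap_hom_biset id_ftr_def)
    then have h': "h \<in> hom_set C (OMap id_ftr y) (OMap id_ftr x)" by (simp add: id_ftr_def)
    have "act (hom_biset C id_ftr id_ftr C C) f g h = f \<cdot>\<^bsub>C\<^esub> h \<cdot>\<^bsub>C\<^esub> g"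
      by (simp only: act_hom_biset[OF f g h']) (simp add: id_ftr_def)
    then show "AMap S (act (hom_biset C id_ftr id_ftr C C) f g h) = act (hom_biset E S S C C) f g (AMap S h)"
      by (simp add: act_hom_biset[OF f g C.functor_hom[OF S h]] C.functor_Comp[OF S g C.Comp_in_hom[OF h f]]
          C.functor_Comp[OF S h f])
  qed
qed

section \<open>Retracts and composites of morphism bisets\<close>

definition retract :: "('o, 'm) cat \<Rightarrow> 'o \<Rightarrow> 'o \<Rightarrow> bool" where
  "retract C x y \<longleftrightarrow> (\<exists>i\<in>hom_set C x y. \<exists>p\<in>hom_set C y x. p \<cdot>\<^bsub>C\<^esub> i = Ident C x)"

lemma (in category) retract_trans:
  assumes "retract C x y" "retract C y z"
  shows "retract C x z"
proof -
  obtain i p where ip: "i \<in> hom_set C x y" "p \<in> hom_set C y x" "p \<cdot> i = Ident C x"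
    using assms(1) by (auto simp: retract_def)
  obtain j q where jq: "j \<in> hom_set C y z" "q \<in> hom_set C z y" "q \<cdot> j = Ident C y"
    using assms(2) by (auto simp: retract_def)
  have "(p \<cdot> q) \<cdot> (j \<cdot> i) = p \<cdot> (q \<cdot> (j \<cdot> i))"
    by (rule Comp_assoc[OF Comp_in_hom[OF ip(1) jq(1)] jq(2) ip(2)])
  also have "\<dots> = p \<cdot> (q \<cdot> j \<cdot> i)"
    by (simp add: Comp_assoc[OF ip(1) jq(1,2)])
  also have "\<dots> = Ident C x"
    by (simp add: jq(3) Ident_Comp[OF ip(1)] ip(3))
  finally show ?thesis
    unfolding retract_def using Comp_in_hom[OF ip(1) jq(1)] Comp_in_hom[OF jq(2) ip(2)] by blast
qed

lemma (in category) functor_retract: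
  assumes F: "is_functor C D F" and "retract C x y"
  shows "retract D (OMap F x) (OMap F y)"
proof -
  obtain i p where ip: "i \<in> hom_set C x y" "p \<in> hom_set C y x" "p \<cdot> i = Ident C x"
    using assms(2) by (auto simp: retract_def)
  have "AMap F p \<cdot>\<^bsub>D\<^esub> AMap F i = Ident D (OMap F x)"
    using functor_Comp[OF F ip(1,2)] functor_Ident[OF F hom_set_Ob(1)[OF ip(1)]] ip(3) by simp
  then show ?thesis
    unfolding retract_def using functor_hom[OF F ip(1)] functor_hom[OF F ip(2)] by blast
qed

lemma iso_arr_retract: "iso_arr C x y f \<Longrightarrow> retract C x y \<and> retract C y x"
  unfolding iso_arr_def retract_def by blast

text \<open>
  If \<open>i : S' z \<rightarrow> T y\<^sub>0\<close> has the retraction \<open>p\<close>, then every \<open>(u, v)\<close> over \<open>y\<close> is equivalent to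
  \<open>(u v p, i)\<close>: since \<open>T\<close> is full, \<open>v p : T y\<^sub>0 \<rightarrow> T y\<close> comes from \<open>D\<close> and can be moved across.
  The class of \<open>(u, v)\<close> therefore depends on \<open>u v\<close> only.
\<close>
lemma comp_hom_bisets:
  assumes C: "category C" and D: "finite_category D" and C': "category C'" and E: "finite_category E"
    and S: "is_functor C E S" and T: "is_functor D E T" and S': "is_functor C' E S'"
    and full: "fully_faithful D E T"
    and retr: "\<And>z. z \<in> Ob C' \<Longrightarrow> \<exists>y\<in>Ob D. retract E (OMap S' z) (OMap T y)"
  shows "biset_iso C C' (comp_biset C D C' (hom_biset E S T C D) (hom_biset E T S' D C')) (hom_biset E S S' C C')"
proof -
  interpret C: category C by fact
  interpret D: finite_category D by fact
  interpret C': category C' by fact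
  interpret E: finite_category E by fact
  interpret P: composable_bisets C D C' "hom_biset E S T C D" "hom_biset E T S' D C'"
    by (intro composable_bisetsI biset_hom_biset assms D.category_axioms)
  note Sh = C.functor_hom[OF S] and Th = D.functor_hom[OF T] and Sh' = C'.functor_hom[OF S']
  have pairsD: "y \<in> Ob D" "u \<in> hom_set E (OMap T y) (OMap S x)" "v \<in> hom_set E (OMap S' z) (OMap T y)"
    if "(y, u, v) \<in> P.pairs x z" for x y z u v
    using that by (auto simp: comp_pairs_def OMap_hom_biset)
  define \<pi> where "\<pi> = (\<lambda>(y :: 'c, u, v). u \<cdot>\<^bsub>E\<^esub> v)"
  have act1: "act (hom_biset E S T C D) (Ident C x) \<beta> u = u \<cdot>\<^bsub>E\<^esub> AMap T \<beta>"
    if x: "x \<in> Ob C" and \<beta>: "\<beta> \<in> hom_set D y' y" and u: "u \<in> hom_set E (OMap T y) (OMap S x)" for x \<beta> y' y u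
    by (simp add: act_hom_biset[OF C.Ident_in_hom[OF x] \<beta> u] functor_Ident[OF S x] E.Ident_Comp[OF u])
  have act2: "act (hom_biset E T S' D C') \<beta> (Ident C' z) v = AMap T \<beta> \<cdot>\<^bsub>E\<^esub> v"
    if z: "z \<in> Ob C'" and \<beta>: "\<beta> \<in> hom_set D y' y" and v: "v \<in> hom_set E (OMap S' z) (OMap T y')" for z \<beta> y' y v
    by (simp add: act_hom_biset[OF \<beta> C'.Ident_in_hom[OF z] v] functor_Ident[OF S' z]
        E.Comp_Ident[OF E.Comp_in_hom[OF v Th[OF \<beta>]]])
  show ?thesis
  proof (rule P.comp_biset_isoI[where \<pi> = "\<lambda>_ _. \<pi>"])
    fix x z assume x: "x \<in> Ob C" and z: "z \<in> Ob C'"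
    obtain y i p where y: "y \<in> Ob D" and i: "i \<in> hom_set E (OMap S' z) (OMap T y)"
      and p: "p \<in> hom_set E (OMap T y) (OMap S' z)" and pi: "p \<cdot>\<^bsub>E\<^esub> i = Ident E (OMap S' z)"
      using retr[OF z] by (auto simp: retract_def)
    show "\<pi> ` P.pairs x z = OMap (hom_biset E S S' C C') (x, z)"
    proof
      show "\<pi> ` P.pairs x z \<subseteq> OMap (hom_biset E S S' C C') (x, z)"
        using E.Comp_in_hom[OF pairsD(3,2)] by (auto simp: \<pi>_def OMap_hom_biset)
      show "OMap (hom_biset E S S' C C') (x, z) \<subseteq> \<pi> ` P.pairs x z"
      proof
        fix h assume "h \<in> OMap (hom_biset E S S' C C') (x, z)"
        then have h: "h \<in> hom_set E (OMap S' z) (OMap S x)" by (simp add: OMap_hom_biset)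
        \<comment> \<open>For surjectivity, \<open>h\<close> is factored through \<open>T y\<close>:
          since \<open>p\<close> retracts \<open>i\<close>, composing \<open>h \<cdot> p\<close>
          with \<open>i\<close> gives back \<open>h\<close>.\<close>
        have "(y, h \<cdot>\<^bsub>E\<^esub> p, i) \<in> P.pairs x z"
          using y i E.Comp_in_hom[OF p h] by (simp add: comp_pairs_def OMap_hom_biset)
        moreover have "\<pi> (y, h \<cdot>\<^bsub>E\<^esub> p, i) = h"
          by (simp add: \<pi>_def E.Comp_assoc[OF i p h] pi E.Comp_Ident[OF h])
        ultimately show "h \<in> \<pi> ` P.pairs x z" by force
      qed
    qed
    have normal: "equivclp (P.stp x z) (y, \<pi> q \<cdot>\<^bsub>E\<^esub> p, i) q" if "q \<in> P.pairs x z" for q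
    proof -
      obtain y' u v where q: "q = (y', u, v)" by (cases q)
      note y' = pairsD[OF that[unfolded q]]
      have "v \<cdot>\<^bsub>E\<^esub> p \<in> hom_set E (OMap T y) (OMap T y')" by (rule E.Comp_in_hom[OF p y'(3)])
      then obtain \<beta> where \<beta>: "\<beta> \<in> hom_set D y y'" "AMap T \<beta> = v \<cdot>\<^bsub>E\<^esub> p"
        using full y y'(1) unfolding fully_faithful_def bij_betw_def by (metis imageE)
      \<comment> \<open>A single step along \<open>\<beta>\<close> suffices: acting on
        \<open>u\<close> it yields \<open>u \<cdot> v \<cdot> p\<close>, and acting on
        \<open>i\<close> it yields \<open>v \<cdot> p \<cdot> i\<close>, which is
        \<open>v\<close>.\<close>
      have "P.stp x z (y, act (hom_biset E S T C D) (Ident C x) \<beta> u, i)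
          (y', u, act (hom_biset E T S' D C') \<beta> (Ident C' z) i)"
        by (rule D.comp_stepI[OF \<beta>(1)]) (simp_all add: OMap_hom_biset y' i)
      moreover have "act (hom_biset E S T C D) (Ident C x) \<beta> u = \<pi> q \<cdot>\<^bsub>E\<^esub> p"
        by (simp add: act1[OF x \<beta>(1) y'(2)] \<beta>(2) q \<pi>_def E.Comp_assoc[OF p y'(3,2)])
      moreover have "act (hom_biset E T S' D C') \<beta> (Ident C' z) i = v"
        by (simp add: act2[OF z \<beta>(1) i] \<beta>(2) E.Comp_assoc[OF i p y'(3)] pi E.Comp_Ident[OF y'(3)])
      ultimately show ?thesis by (simp add: q r_into_equivclp)
    qed
    show "equivclp (P.stp x z) q r" if "q \<in> P.pairs x z" "r \<in> P.pairs x z" "\<pi> q = \<pi> r" for q r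
      using equivclp_trans[OF equivclp_sym[OF normal[OF that(1)]]] normal[OF that(2)] that(3) by simp
    show "\<pi> q = \<pi> r" if "P.stp x z q r" for q r
      using that
    proof (cases rule: comp_stepE)
      case (1 y' y \<beta> u v)
      then have u: "u \<in> hom_set E (OMap T y) (OMap S x)" and v: "v \<in> hom_set E (OMap S' z) (OMap T y')"
        by (simp_all add: OMap_hom_biset)
      show ?thesis
        by (simp add: 1(6,7) \<pi>_def act1[OF x 1(1) u] act2[OF z 1(1) v] E.Comp_assoc[OF v Th[OF 1(1)] u])
    qed
  next
    fix x x' z z' f g q
    assume f: "f \<in> hom_set C x x'" and g: "g \<in> hom_set C' z' z" and q: "q \<in> P.pairs x z"
    obtain y u v where yuv: "q = (y, u, v)" by (cases q)
    note y = pairsD[OF q[unfolded yuv]]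
    note i = D.Ident_in_hom[OF y(1)]
    have fu: "AMap S f \<cdot>\<^bsub>E\<^esub> u \<in> hom_set E (OMap T y) (OMap S x')" by (rule E.Comp_in_hom[OF y(2) Sh[OF f]])
    have uv: "u \<cdot>\<^bsub>E\<^esub> v \<in> hom_set E (OMap S' z) (OMap S x)" by (rule E.Comp_in_hom[OF y(3,2)])
    have "\<pi> (pair_act D (hom_biset E S T C D) (hom_biset E T S' D C') f g q) =
        (AMap S f \<cdot>\<^bsub>E\<^esub> u) \<cdot>\<^bsub>E\<^esub> (v \<cdot>\<^bsub>E\<^esub> AMap S' g)"
      by (simp add: \<pi>_def yuv pair_act_def act_hom_biset[OF f i y(2)] act_hom_biset[OF i g y(3)]
          functor_Ident[OF T y(1)] E.Comp_Ident[OF fu] E.Ident_Comp[OF y(3)])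
    also have "\<dots> = AMap S f \<cdot>\<^bsub>E\<^esub> u \<cdot>\<^bsub>E\<^esub> v \<cdot>\<^bsub>E\<^esub> AMap S' g"
      by (simp add: E.Comp_assoc[OF Sh'[OF g] y(3) fu])
    also have "\<dots> = AMap S f \<cdot>\<^bsub>E\<^esub> (u \<cdot>\<^bsub>E\<^esub> v) \<cdot>\<^bsub>E\<^esub> AMap S' g"
      by (simp add: E.Comp_assoc[OF y(3,2) Sh[OF f]])
    finally show "\<pi> (pair_act D (hom_biset E S T C D) (hom_biset E T S' D C') f g q) =
        act (hom_biset E S S' C C') f g (\<pi> q)"
      by (simp add: act_hom_biset[OF f g uv] yuv \<pi>_def)
  qed
qed

section \<open>Equivalences and the idempotent completion\<close>

lemma natural_iso_idE:
  assumes "category C" and iso: "naturally_isomorphic C C (comp_ftr G F) id_ftr"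
  obtains \<eta> where "\<And>x. x \<in> Ob C \<Longrightarrow> iso_arr C (OMap G (OMap F x)) x (\<eta> x)"
    "\<And>x y f. f \<in> hom_set C x y \<Longrightarrow> f \<cdot>\<^bsub>C\<^esub> \<eta> x = \<eta> y \<cdot>\<^bsub>C\<^esub> AMap G (AMap F f)"
proof -
  interpret C: category C by fact
  obtain \<eta> where \<eta>: "\<forall>x\<in>Ob C. iso_arr C (OMap G (OMap F x)) x (\<eta> x)"
    "\<forall>x\<in>Ob C. \<forall>y\<in>Ob C. \<forall>f\<in>hom_set C x y. f \<cdot>\<^bsub>C\<^esub> \<eta> x = \<eta> y \<cdot>\<^bsub>C\<^esub> AMap G (AMap F f)"
    using iso by (auto simp: naturally_isomorphic_def comp_ftr_def id_ftr_def)
  show thesis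
  proof (rule that[of \<eta>])
    fix x y f assume f: "f \<in> hom_set C x y"
    then show "f \<cdot>\<^bsub>C\<^esub> \<eta> x = \<eta> y \<cdot>\<^bsub>C\<^esub> AMap G (AMap F f)"
      using \<eta>(2) C.hom_set_Ob[OF f] by simp
  qed (simp add: \<eta>(1))
qed

text \<open>Naturality of \<open>\<eta>\<close> recovers an arrow \<open>h\<close> from
  \<open>G (F h)\<close> by conjugation with \<open>\<eta>\<close>, hence from \<open>F h\<close>.
  Only the natural isomorphism on the side of \<open>C\<close> enters, so the lemma applies to
  \<open>F\<close> and to \<open>G\<close> separately.\<close>

lemma equivalence_faithful:
  assumes C: "category C" and D: "category D"
    and F: "is_functor C D F" and G: "is_functor D C G"
    and iso: "naturally_isomorphic C C (comp_ftr G F) id_ftr"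
    and f: "f \<in> hom_set C x y" and g: "g \<in> hom_set C x y" and eq: "AMap F f = AMap F g"
  shows "f = g"
proof -
  interpret C: category C by fact
  interpret D: category D by fact
  obtain \<eta> where \<eta>: "\<And>x. x \<in> Ob C \<Longrightarrow> iso_arr C (OMap G (OMap F x)) x (\<eta> x)"
    and nat: "\<And>x y f. f \<in> hom_set C x y \<Longrightarrow> f \<cdot>\<^bsub>C\<^esub> \<eta> x = \<eta> y \<cdot>\<^bsub>C\<^esub> AMap G (AMap F f)"
    using natural_iso_idE[OF C iso] by metis
  have x: "x \<in> Ob C" using C.hom_set_Ob[OF f] by simp
  obtain \<eta>' where \<eta>': "\<eta>' \<in> hom_set C x (OMap G (OMap F x))" "\<eta> x \<cdot>\<^bsub>C\<^esub> \<eta>' = Ident C x"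
    and \<eta>x: "\<eta> x \<in> hom_set C (OMap G (OMap F x)) x"
    using \<eta>[OF x] by (auto simp: iso_arr_def)
  have "h = \<eta> y \<cdot>\<^bsub>C\<^esub> AMap G (AMap F h) \<cdot>\<^bsub>C\<^esub> \<eta>'" if h: "h \<in> hom_set C x y" for h
    using C.Comp_assoc[OF \<eta>'(1) \<eta>x h] by (simp add: \<eta>'(2) C.Comp_Ident[OF h] nat[OF h])
  from this[OF f] this[OF g] show ?thesis by (simp add: eq)
qed

text \<open>For fullness, \<open>h\<close> is pulled back to \<open>f\<close> by conjugating
  \<open>G h\<close> with \<open>\<eta>\<close>. Naturality and cancellation give
  \<open>G (F f) = G h\<close>, and faithfulness of \<open>G\<close>, which comes from the other
  natural isomorphism, gives \<open>F f = h\<close>.\<close>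

lemma equivalence_fully_faithful:
  assumes C: "category C" and D: "category D"
    and F: "is_functor C D F" and G: "is_functor D C G"
    and isoC: "naturally_isomorphic C C (comp_ftr G F) id_ftr"
    and isoD: "naturally_isomorphic D D (comp_ftr F G) id_ftr"
  shows "fully_faithful C D F"
  unfolding fully_faithful_def
proof (intro ballI)
  interpret C: category C by fact
  interpret D: category D by fact
  fix x y assume x: "x \<in> Ob C" and y: "y \<in> Ob C"
  note Fh = C.functor_hom[OF F] and Gh = D.functor_hom[OF G]
  obtain \<eta> where \<eta>: "\<And>x. x \<in> Ob C \<Longrightarrow> iso_arr C (OMap G (OMap F x)) x (\<eta> x)"
    and nat: "\<And>x y f. f \<in> hom_set C x y \<Longrightarrow> f \<cdot>\<^bsub>C\<^esub> \<eta> x = \<eta> y \<cdot>\<^bsub>C\<^esub> AMap G (AMap F f)"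
    using natural_iso_idE[OF C isoC] by metis
  obtain \<eta>' where \<eta>': "\<eta>' \<in> hom_set C x (OMap G (OMap F x))" "\<eta>' \<cdot>\<^bsub>C\<^esub> \<eta> x = Ident C (OMap G (OMap F x))"
    and \<eta>x: "\<eta> x \<in> hom_set C (OMap G (OMap F x)) x"
    using \<eta>[OF x] by (auto simp: iso_arr_def)
  obtain \<theta> where \<theta>: "\<theta> \<in> hom_set C y (OMap G (OMap F y))" "\<theta> \<cdot>\<^bsub>C\<^esub> \<eta> y = Ident C (OMap G (OMap F y))"
    and \<eta>y: "\<eta> y \<in> hom_set C (OMap G (OMap F y)) y"
    using \<eta>[OF y] by (auto simp: iso_arr_def)
  show "bij_betw (AMap F) (hom_set C x y) (hom_set D (OMap F x) (OMap F y))"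
    unfolding bij_betw_def
  proof
    show "inj_on (AMap F) (hom_set C x y)"
      by (rule inj_onI) (rule equivalence_faithful[OF C D F G isoC])
    show "AMap F ` hom_set C x y = hom_set D (OMap F x) (OMap F y)"
    proof
      show "AMap F ` hom_set C x y \<subseteq> hom_set D (OMap F x) (OMap F y)" using Fh by blast
      show "hom_set D (OMap F x) (OMap F y) \<subseteq> AMap F ` hom_set C x y"
      proof
        fix h assume h: "h \<in> hom_set D (OMap F x) (OMap F y)"
        note Gh' = Gh[OF h]
        define f where "f = \<eta> y \<cdot>\<^bsub>C\<^esub> AMap G h \<cdot>\<^bsub>C\<^esub> \<eta>'"
        have yh: "\<eta> y \<cdot>\<^bsub>C\<^esub> AMap G h \<in> hom_set C (OMap G (OMap F x)) y" by (rule C.Comp_in_hom[OF Gh' \<eta>y])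
        have f: "f \<in> hom_set C x y" unfolding f_def by (rule C.Comp_in_hom[OF \<eta>'(1) yh])
        have "\<eta> y \<cdot>\<^bsub>C\<^esub> AMap G (AMap F f) = f \<cdot>\<^bsub>C\<^esub> \<eta> x" by (simp add: nat[OF f])
        also have "\<dots> = \<eta> y \<cdot>\<^bsub>C\<^esub> AMap G h"
          by (simp add: f_def C.Comp_assoc[OF \<eta>x \<eta>'(1) yh] \<eta>'(2) C.Comp_Ident[OF yh])
        finally have *: "\<eta> y \<cdot>\<^bsub>C\<^esub> AMap G (AMap F f) = \<eta> y \<cdot>\<^bsub>C\<^esub> AMap G h" .
        \<comment> \<open>\<open>\<theta>\<close> is a left inverse of \<open>\<eta> y\<close>, so
          composition with \<open>\<eta> y\<close> on the left can be cancelled.\<close>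
        have "k = \<theta> \<cdot>\<^bsub>C\<^esub> (\<eta> y \<cdot>\<^bsub>C\<^esub> k)" if k: "k \<in> hom_set C (OMap G (OMap F x)) (OMap G (OMap F y))" for k
          by (simp add: C.Comp_assoc[OF k \<eta>y \<theta>(1), symmetric] \<theta>(2) C.Ident_Comp[OF k])
        from this[OF Gh[OF Fh[OF f]]] this[OF Gh'] * have "AMap G (AMap F f) = AMap G h" by simp
        then have "AMap F f = h" by (rule equivalence_faithful[OF D C G F isoD Fh[OF f] h])
        then show "h \<in> AMap F ` hom_set C x y" using f by blast
      qed
    qed
  qed
qed

lemma fully_faithful_comp_ftr:
  assumes "is_functor C D F" "fully_faithful C D F" "fully_faithful D E G"
  shows "fully_faithful C E (comp_ftr G F)"
  unfolding fully_faithful_def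
proof (intro ballI)
  fix x y assume xy: "x \<in> Ob C" "y \<in> Ob C"
  have "bij_betw (AMap F) (hom_set C x y) (hom_set D (OMap F x) (OMap F y))"
    using assms(2) xy by (simp add: fully_faithful_def)
  moreover have "bij_betw (AMap G) (hom_set D (OMap F x) (OMap F y))
      (hom_set E (OMap G (OMap F x)) (OMap G (OMap F y)))"
    using assms(3) functor_Ob[OF assms(1)] xy by (simp add: fully_faithful_def)
  ultimately show "bij_betw (AMap (comp_ftr G F)) (hom_set C x y)
      (hom_set E (OMap (comp_ftr G F) x) (OMap (comp_ftr G F) y))"
    by (simp add: comp_ftr_def bij_betw_trans)
qed

section \<open>The embedding of a category into its idempotent completion\<close>

definition completion_embedding :: "('o, 'm) cat \<Rightarrow> ('o, 'm, 'm, 'm \<times> 'm \<times> 'm) ftr" where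
  "completion_embedding C =
     \<lparr>OMap = Ident C, AMap = (\<lambda>f. (Ident C (Dom C f), f, Ident C (Cod C f)))\<rparr>"

context category begin

lemma idempotent_hom: "e \<in> idempotents C \<Longrightarrow> e \<in> hom_set C (Dom C e) (Dom C e) \<and> e \<cdot> e = e"
  by (simp add: idempotents_def hom_set_def)

lemma Ident_idempotent: "x \<in> Ob C \<Longrightarrow> Ident C x \<in> idempotents C"
  using Ident_in_hom[of x] Comp_Ident[OF Ident_in_hom] by (simp add: idempotents_def hom_set_def)

lemma Dom_Ident: "x \<in> Ob C \<Longrightarrow> Dom C (Ident C x) = x"
  using Ident_in_hom[of x] by (simp add: hom_set_def)

text \<open>An arrow has the form \<open>f \<cdot> k \<cdot> e\<close> exactly if it absorbs
  \<open>f\<close> on the left and \<open>e\<close> on the right, because both are idempotent. The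
  absorption equations are stable under composition and avoid carrying the witness
  \<open>k\<close>.\<close>

lemma hom_set_completion:
  "t \<in> hom_set (idempotent_completion C) e f \<longleftrightarrow> e \<in> idempotents C \<and> f \<in> idempotents C \<and>
     (\<exists>h\<in>hom_set C (Dom C e) (Dom C f). t = (e, h, f) \<and> f \<cdot> h = h \<and> h \<cdot> e = h)"
    (is "_ \<longleftrightarrow> ?R")
proof
  assume "t \<in> hom_set (idempotent_completion C) e f"
  then obtain k where ef: "e \<in> idempotents C" "f \<in> idempotents C" and k: "k \<in> hom_set C (Dom C e) (Dom C f)"
    and t: "t = (e, f \<cdot> k \<cdot> e, f)"
    by (auto simp: hom_set_def idempotent_completion_def)
  note e = idempotent_hom[OF ef(1)] and f = idempotent_hom[OF ef(2)]
  have fk: "f \<cdot> k \<in> hom_set C (Dom C e) (Dom C f)" using Comp_in_hom[OF k] f by blast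
  have fke: "f \<cdot> k \<cdot> e \<in> hom_set C (Dom C e) (Dom C f)" using Comp_in_hom[OF _ fk] e by blast
  have "f \<cdot> (f \<cdot> k \<cdot> e) = f \<cdot> (f \<cdot> k) \<cdot> e"
    using Comp_assoc[OF conjunct1[OF e] fk conjunct1[OF f]] by simp
  also have "f \<cdot> (f \<cdot> k) = f \<cdot> k"
    using Comp_assoc[OF k conjunct1[OF f] conjunct1[OF f]] f by simp
  finally have "f \<cdot> (f \<cdot> k \<cdot> e) = f \<cdot> k \<cdot> e" .
  moreover have "f \<cdot> k \<cdot> e \<cdot> e = f \<cdot> k \<cdot> e"
    using Comp_assoc[OF conjunct1[OF e] conjunct1[OF e] fk] e by simp
  ultimately show ?R using ef fke t by blast
next
  assume ?R
  then obtain h where h: "e \<in> idempotents C" "f \<in> idempotents C" "h \<in> hom_set C (Dom C e) (Dom C f)"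
    "t = (e, h, f)" "f \<cdot> h = h" "h \<cdot> e = h" by blast
  then have "\<exists>k. h = f \<cdot> k \<cdot> e \<and> k \<in> hom_set C (Dom C e) (Dom C f)" by metis
  with h(1,2,4) show "t \<in> hom_set (idempotent_completion C) e f"
    unfolding hom_set_iff[of t "idempotent_completion C"] by (simp add: idempotent_completion_def)
qed

lemma Comp_completion: "(f', k, g) \<cdot>\<^bsub>idempotent_completion C\<^esub> (e, h, f) = (e, k \<cdot> h, g)"
  by (simp add: idempotent_completion_def)

lemma Ident_completion: "Ident (idempotent_completion C) e = (e, e, e)"
  by (simp add: idempotent_completion_def)

lemma Ob_completion: "Ob (idempotent_completion C) = idempotents C"
  by (simp add: idempotent_completion_def)

text \<open>The identity at \<open>e\<close> is \<open>e\<close> itself rather than the identity of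
  its underlying object; the unit laws are the absorption equations.\<close>

lemma category_completion: "category (idempotent_completion C)"
proof
  let ?K = "idempotent_completion C"
  fix t assume "t \<in> Arr ?K"
  then show "Dom ?K t \<in> Ob ?K" "Cod ?K t \<in> Ob ?K" by (auto simp: idempotent_completion_def)
next
  let ?K = "idempotent_completion C"
  fix e assume "e \<in> Ob ?K"
  then show "Ident ?K e \<in> hom_set ?K e e"
    using idempotent_hom[of e] by (auto simp: hom_set_completion Ident_completion Ob_completion)
next
  let ?K = "idempotent_completion C"
  fix s t e f g assume "s \<in> hom_set ?K e f" "t \<in> hom_set ?K f g"
  then obtain h k where h: "e \<in> idempotents C" "f \<in> idempotents C" "h \<in> hom_set C (Dom C e) (Dom C f)"
      "s = (e, h, f)" "f \<cdot> h = h" "h \<cdot> e = h"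
    and k: "g \<in> idempotents C" "k \<in> hom_set C (Dom C f) (Dom C g)"
      "t = (f, k, g)" "g \<cdot> k = k" "k \<cdot> f = k"
    by (auto simp: hom_set_completion)
  have "g \<cdot> (k \<cdot> h) = k \<cdot> h" "k \<cdot> h \<cdot> e = k \<cdot> h"
    using Comp_assoc[OF h(3) k(2) conjunct1[OF idempotent_hom[OF k(1)]]] k(4)
      Comp_assoc[OF conjunct1[OF idempotent_hom[OF h(1)]] h(3) k(2)] h(6) by simp_all
  then show "t \<cdot>\<^bsub>?K\<^esub> s \<in> hom_set ?K e g"
    using h(1) k(1) Comp_in_hom[OF h(3) k(2)] by (simp add: h(4) k(3) Comp_completion hom_set_completion)
next
  let ?K = "idempotent_completion C"
  fix r s t d e f g assume "r \<in> hom_set ?K d e" "s \<in> hom_set ?K e f" "t \<in> hom_set ?K f g"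
  then show "(t \<cdot>\<^bsub>?K\<^esub> s) \<cdot>\<^bsub>?K\<^esub> r = t \<cdot>\<^bsub>?K\<^esub> (s \<cdot>\<^bsub>?K\<^esub> r)"
    by (auto simp: hom_set_completion Comp_completion Comp_assoc)
next
  let ?K = "idempotent_completion C"
  fix t e f assume "t \<in> hom_set ?K e f"
  then show "t \<cdot>\<^bsub>?K\<^esub> Ident ?K e = t" "Ident ?K f \<cdot>\<^bsub>?K\<^esub> t = t"
    by (auto simp: hom_set_completion Comp_completion Ident_completion)
qed

lemma is_functor_completion_embedding:
  "is_functor C (idempotent_completion C) (completion_embedding C)"
  unfolding is_functor_def
proof (intro conjI ballI)
  fix x y f assume xy: "x \<in> Ob C" "y \<in> Ob C" and f: "f \<in> hom_set C x y"
  have "AMap (completion_embedding C) f = (Ident C x, f, Ident C y)"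
    using f by (simp add: completion_embedding_def hom_set_iff)
  then show "AMap (completion_embedding C) f \<in> hom_set (idempotent_completion C)
      (OMap (completion_embedding C) x) (OMap (completion_embedding C) y)"
    using xy f Ident_idempotent Dom_Ident Comp_Ident[OF f] Ident_Comp[OF f]
    by (simp add: hom_set_completion completion_embedding_def)
next
  fix x y z f g assume f: "f \<in> hom_set C x y" and g: "g \<in> hom_set C y z"
  then show "AMap (completion_embedding C) (g \<cdot> f) =
      AMap (completion_embedding C) g \<cdot>\<^bsub>idempotent_completion C\<^esub> AMap (completion_embedding C) f"
    using Comp_in_hom[OF f g] by (simp add: completion_embedding_def Comp_completion hom_set_iff)
qed (use Ident_idempotent Ident_in_hom in
    \<open>simp_all add: completion_embedding_def Ob_completion Ident_completion hom_set_iff\<close>)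

text \<open>Between identities the absorption equations hold for every arrow, so the triples are
  just the arrows of \<open>C\<close> with their source and target recorded.\<close>

lemma fully_faithful_completion_embedding:
  "fully_faithful C (idempotent_completion C) (completion_embedding C)"
  unfolding fully_faithful_def
proof (intro ballI)
  let ?K = "idempotent_completion C" and ?\<iota> = "completion_embedding C"
  fix x y assume xy: "x \<in> Ob C" "y \<in> Ob C"
  show "bij_betw (AMap ?\<iota>) (hom_set C x y) (hom_set ?K (OMap ?\<iota> x) (OMap ?\<iota> y))"
    unfolding bij_betw_def
  proof
    show "inj_on (AMap ?\<iota>) (hom_set C x y)" by (auto simp: inj_on_def completion_embedding_def)
    show "AMap ?\<iota> ` hom_set C x y = hom_set ?K (OMap ?\<iota> x) (OMap ?\<iota> y)"
    proof
      show "AMap ?\<iota> ` hom_set C x y \<subseteq> hom_set ?K (OMap ?\<iota> x) (OMap ?\<iota> y)"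
        using functor_hom[OF is_functor_completion_embedding] by blast
      show "hom_set ?K (OMap ?\<iota> x) (OMap ?\<iota> y) \<subseteq> AMap ?\<iota> ` hom_set C x y"
      proof
        fix t assume "t \<in> hom_set ?K (OMap ?\<iota> x) (OMap ?\<iota> y)"
        then obtain h where h: "h \<in> hom_set C x y" "t = (Ident C x, h, Ident C y)"
          using Dom_Ident xy by (auto simp: hom_set_completion completion_embedding_def)
        then have "t = AMap ?\<iota> h" by (simp add: completion_embedding_def hom_set_iff)
        then show "t \<in> AMap ?\<iota> ` hom_set C x y" using h(1) by blast
      qed
    qed
  qed
qed

text \<open>Every idempotent splits in the completion: \<open>e\<close> read as an arrow from
  \<open>e\<close> to the identity of its object is the section, and \<open>e\<close> read in the
  other direction is the retraction. Their composite is \<open>e \<cdot> e = e\<close>, the identity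
  at \<open>e\<close>.\<close>

lemma retract_completion:
  assumes "e \<in> Ob (idempotent_completion C)"
  obtains x where "x \<in> Ob C" "retract (idempotent_completion C) e (OMap (completion_embedding C) x)"
proof -
  let ?x = "Dom C e"
  have e: "e \<in> idempotents C" "e \<in> hom_set C ?x ?x" "e \<cdot> e = e"
    using assms idempotent_hom[of e] by (auto simp: Ob_completion)
  have x: "?x \<in> Ob C" using hom_set_Ob[OF e(2)] by simp
  have "(e, e, Ident C ?x) \<in> hom_set (idempotent_completion C) e (Ident C ?x)"
    "(Ident C ?x, e, e) \<in> hom_set (idempotent_completion C) (Ident C ?x) e"
    using e x Ident_idempotent[OF x] Dom_Ident[OF x] Ident_Comp[OF e(2)] Comp_Ident[OF e(2)]
    by (auto simp: hom_set_completion)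
  moreover have "(Ident C ?x, e, e) \<cdot>\<^bsub>idempotent_completion C\<^esub> (e, e, Ident C ?x) = Ident (idempotent_completion C) e"
    by (simp add: Comp_completion Ident_completion e(3))
  ultimately have "retract (idempotent_completion C) e (OMap (completion_embedding C) ?x)"
    unfolding retract_def completion_embedding_def by auto
  then show thesis using x that by blast
qed

end

lemma (in finite_category) finite_category_completion: "finite_category (idempotent_completion C)"
proof -
  interpret K: category "idempotent_completion C" by (rule category_completion)
  show ?thesis
  proof
    show "finite (Ob (idempotent_completion C))"
      using finite_Arr by (rule finite_subset[rotated]) (auto simp: Ob_completion idempotents_def)
    have "Arr (idempotent_completion C) \<subseteq> Arr C \<times> Arr C \<times> Arr C"
    proof
      fix t assume "t \<in> Arr (idempotent_completion C)"
      then obtain e f where "t \<in> hom_set (idempotent_completion C) e f" by (auto simp: hom_set_def)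
      then show "t \<in> Arr C \<times> Arr C \<times> Arr C"
        unfolding hom_set_completion by (auto simp: idempotents_def hom_set_iff)
    qed
    then show "finite (Arr (idempotent_completion C))"
      by (rule finite_subset) (simp add: finite_Arr)
  qed
qed

text \<open>Reduces composition in the biset category to composition of actual bisets, as the
  scalars multiply to \<open>1\<close>. The factors keep their order because a morphism from
  \<open>C\<close> to \<open>D\<close> is built from \<open>(D, C)\<close>-bisets.\<close>

lemma comp_B_pure:
  assumes R: "cring R" and C: "category C" and D: "finite_category D" and E: "category E"
    and bis: "biset E D \<Psi>" "biset D C \<Omega>"
  shows "comp_B R C D E (pure_tensor R (biset_K E D) \<one>\<^bsub>R\<^esub> (K_class E D \<Psi>))
      (pure_tensor R (biset_K D C) \<one>\<^bsub>R\<^esub> (K_class D C \<Omega>)) =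
    pure_tensor R (biset_K E C) \<one>\<^bsub>R\<^esub> (K_class E C (comp_biset E D C \<Psi> \<Omega>))"
proof -
  interpret R: cring R by fact
  interpret D: finite_category D by fact
  note catD = D.category_axioms
  have "comp_B R C D E (pure_tensor R (biset_K E D) \<one>\<^bsub>R\<^esub> (K_class E D \<Psi>))
      (pure_tensor R (biset_K D C) \<one>\<^bsub>R\<^esub> (K_class D C \<Omega>)) =
    pure_tensor R (biset_K E C) (\<one>\<^bsub>R\<^esub> \<otimes>\<^bsub>R\<^esub> \<one>\<^bsub>R\<^esub>) (comp_K E D C (K_class E D \<Psi>) (K_class D C \<Omega>))"
    unfolding comp_B_def
    by (rule bilinear_extension_pure_tensor[OF R group_biset_K[OF E catD] group_biset_K[OF catD C]
          group_biset_K[OF E C] comp_K_closed[OF E D C] comp_K_mult_left[OF E D C] comp_K_mult_right[OF E D C]])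
      (use bis K_class_in_biset_K in auto)
  then show ?thesis
    by (simp add: comp_K_K_class[OF E D C bis])
qed

theorem theorem4p7:
  fixes R :: "('r, 'z) ring_scheme"
    and C :: "('o, 'm) cat"
    and D :: "('p, 'n) cat"
  assumes "cring R"
    and "finite_category C"
    and "finite_category D"
    and "equivalent_categories (idempotent_completion C) (idempotent_completion D)"
  shows "isomorphic_in_B R C D"
proof -
  interpret R: cring R by fact
  interpret C: finite_category C by fact
  interpret D: finite_category D by fact
  note cat = C.category_axioms D.category_axioms
  let ?E = "idempotent_completion C" and ?E' = "idempotent_completion D"
  note E = C.finite_category_completion and E' = D.category_completion
  interpret E: finite_category ?E by (rule E)
  interpret E': category ?E' by (rule E')
  obtain F G where F: "is_functor ?E ?E' F" and G: "is_functor ?E' ?E G"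
    and isoE: "naturally_isomorphic ?E ?E (comp_ftr G F) id_ftr"
    and isoE': "naturally_isomorphic ?E' ?E' (comp_ftr F G) id_ftr"
    using assms(4) unfolding equivalent_categories_def by blast
  define S where "S = completion_embedding C"
  define T where "T = comp_ftr G (completion_embedding D)"
  have S: "is_functor C ?E S" "fully_faithful C ?E S"
    unfolding S_def by (rule C.is_functor_completion_embedding C.fully_faithful_completion_embedding)+
  \<comment> \<open>\<open>G\<close> is fully faithful by the lemma on equivalences, with the roles
    of the two natural isomorphisms exchanged.\<close>
  have T: "is_functor D ?E T" "fully_faithful D ?E T"
    unfolding T_def
    by (rule is_functor_comp_ftr[OF cat(2) E' D.is_functor_completion_embedding G],
        rule fully_faithful_comp_ftr[OF D.is_functor_completion_embedding D.fully_faithful_completion_embedding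
          equivalence_fully_faithful[OF E' E.category_axioms G F isoE' isoE]])
  have retrS: "\<exists>x\<in>Ob C. retract ?E e (OMap S x)" if "e \<in> Ob ?E" for e
    using C.retract_completion[OF that] unfolding S_def by blast
  \<comment> \<open>\<open>e\<close> is isomorphic to \<open>G (F e)\<close>; in the completion of
    \<open>D\<close>, \<open>F e\<close> is a retract of an embedded object, and \<open>G\<close>
    preserves retracts.\<close>
  have retrT: "\<exists>y\<in>Ob D. retract ?E e (OMap T y)" if e: "e \<in> Ob ?E" for e
  proof -
    obtain y where y: "y \<in> Ob D" "retract ?E' (OMap F e) (OMap (completion_embedding D) y)"
      by (rule D.retract_completion[OF functor_Ob[OF F e]])
    have "retract ?E e (OMap G (OMap F e))"
      using isoE e iso_arr_retract unfolding naturally_isomorphic_def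
      by (fastforce simp: comp_ftr_def id_ftr_def)
    from E.retract_trans[OF this E'.functor_retract[OF G y(2)]] y(1) show ?thesis
      by (auto simp: T_def comp_ftr_def)
  qed
  define \<Psi> where "\<Psi> = hom_biset ?E S T C D"
  define \<Omega> where "\<Omega> = hom_biset ?E T S D C"
  have \<Psi>: "biset C D \<Psi>" and \<Omega>: "biset D C \<Omega>"
    unfolding \<Psi>_def \<Omega>_def by (intro biset_hom_biset cat E S(1) T(1))+
  have id_biset: "biset A A (id_biset A)" if "finite_category A" for A :: "('x, 'y) cat"
    using that finite_category.axioms(1)[OF that]
    unfolding id_biset_eq_hom_biset by (intro biset_hom_biset is_functor_id_ftr)
  \<comment> \<open>This composite runs through \<open>D\<close>, so each \<open>S z\<close> has to
    be a retract of some \<open>T y\<close>; the other composite runs through \<open>C\<close> and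
    uses \<open>retrS\<close> instead. In both cases the composite and the identity biset are
    compared with the same morphism biset.\<close>
  have "biset_iso C C (comp_biset C D C \<Psi> \<Omega>) (hom_biset ?E S S C C)"
    unfolding \<Psi>_def \<Omega>_def
    by (intro comp_hom_bisets cat assms(3) E S T retrT functor_Ob[OF S(1)])
  then have 1: "K_class C C (comp_biset C D C \<Psi> \<Omega>) = K_class C C (id_biset C)"
    unfolding K_class_def
    by (simp add: iso_class_eqI[OF composable_bisets.biset_comp[OF composable_bisetsI[OF assms(3) \<Psi> \<Omega>]]]
        iso_class_eqI[OF id_biset[OF assms(2)] id_biset_iso_hom_biset[OF cat(1) E.category_axioms S]])
  have "biset_iso D D (comp_biset D C D \<Omega> \<Psi>) (hom_biset ?E T T D D)"
    unfolding \<Psi>_def \<Omega>_def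
    by (intro comp_hom_bisets cat assms(2) E S T retrS functor_Ob[OF T(1)])
  then have 2: "K_class D D (comp_biset D C D \<Omega> \<Psi>) = K_class D D (id_biset D)"
    unfolding K_class_def
    by (simp add: iso_class_eqI[OF composable_bisets.biset_comp[OF composable_bisetsI[OF assms(2) \<Omega> \<Psi>]]]
        iso_class_eqI[OF id_biset[OF assms(3)] id_biset_iso_hom_biset[OF cat(2) E.category_axioms T]])
  \<comment> \<open>The direction of the Hom-groups makes the \<open>(D, C)\<close>-biset
    \<open>\<Omega>\<close> the morphism from \<open>C\<close> to \<open>D\<close>, and
    \<open>\<Psi>\<close> the one back.\<close>
  define \<alpha> where "\<alpha> = pure_tensor R (biset_K D C) \<one>\<^bsub>R\<^esub> (K_class D C \<Omega>)"
  define \<beta> where "\<beta> = pure_tensor R (biset_K C D) \<one>\<^bsub>R\<^esub> (K_class C D \<Psi>)"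
  have "\<alpha> \<in> carrier (Hom_B R C D)" "\<beta> \<in> carrier (Hom_B R D C)"
    unfolding \<alpha>_def \<beta>_def Hom_B_def
    by (intro pure_tensor_in_ring_tensor group_biset_K K_class_in_biset_K cat \<Psi> \<Omega> R.ring_axioms R.one_closed)+
  moreover have "comp_B R C D C \<beta> \<alpha> = id_B R C"
    unfolding \<alpha>_def \<beta>_def id_B_def
    by (simp only: comp_B_pure[OF assms(1) cat(1) assms(3) cat(1) \<Psi> \<Omega>] 1)
  moreover have "comp_B R D C D \<alpha> \<beta> = id_B R D"
    unfolding \<alpha>_def \<beta>_def id_B_def
    by (simp only: comp_B_pure[OF assms(1) cat(2) assms(2) cat(2) \<Omega> \<Psi>] 2)
  ultimately show ?thesis
    unfolding isomorphic_in_B_def by blast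
qed

end
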